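(* Let $X$ be the space of Whitney umbrellas up to four-jets, identified with a subset of a Euclidean space. For a Whitney umbrella $f$, let $h=h_{\kappa_1}:(\mathcal{M}_0,\mathcal{E}_0)\to\mathbb{R}^3$ be its principal curvature surface with respect to the bounded principal curvature $\kappa_1$, and let $K$ and $H$ be the Gaussian and mean curvatures of $h$. (1) There exists an algebraic subset $A_k\subsetneq X$ such that, for any $f\in X\setminus A_k$, the principal curvature surface $h$ has no singular point on $\mathcal{E}_0$, and the number of zeros of the Gaussian curvature $K$ on $\mathcal{E}_0$ is $2n-1$ for some $n\in\{1,\ldots,11\}$. (2) There exists an algebraic subset $A_h\subsetneq X$ such that, for any $f\in X\setminus A_h$, the principal curvature surface $h$ has no singular point on $\mathcal{E}_0$, and the number of zeros of the mean curvature $H$ on $\mathcal{E}_0$ is $2n$ for some $n\in\{0,1,\ldots,9\}$.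
   Context: All maps and germs are $C^\infty$. A map-germ $f:(\mathbb{R}^2,0)\to(\mathbb{R}^3,0)$ is a Whitney umbrella if there are diffeomorphism-germs $\lambda$ of $(\mathbb{R}^2,0)$ and $\mu$ of $(\mathbb{R}^3,0)$ with $\mu\circ f\circ\lambda^{-1}(u,v)=(u,v^2,uv)$. Normal form: by an orientation preserving diffeomorphism-germ of the source and an element of $SO(3)$ in the target, a Whitney umbrella can be brought to the form $$f(u,v)=\big(u,\;u^2f_{21}(u)+v^2,\;u^2f_{31}(u)+v^2(uf_{321}(u)+vf_{322}(u,v))+uvf_{331}(u)\big),\qquad f_{331}(0)>0,$$ where $f_{21},f_{31},f_{321},f_{331}$ are function-germs of one variable and $f_{322}$ of two variables, and these functions are uniquely determined by $f$. Space $X$: $X$ is the set of tuples $(j^2f_{21}(0),j^2f_{31}(0),j^1f_{321}(0),j^1f_{322}(0,0),j^2f_{331}(0))$ with $f_{331}(0)>0$ (jets include the constant term), regarded as a subset of a Euclidean space via Taylor coefficients; it parametrizes four-jets of Whitney umbrellas up to source diffeomorphisms and $SO(3)$. An algebraic subset of $X$ is the zero set in $X$ of polynomials in these coordinates. Writing $f\in X\setminus A$ means that $f$ is a Whitney umbrella, written in normal form, whose tuple of jets lies in $X\setminus A$. Blow-up: $\mathcal{M}$ is the quotient of $\mathbb{R}\times(\mathbb{R}/2\pi\mathbb{Z})$ by $(r,\theta)\sim(-r,\theta+\pi)$, with $\pi:\mathcal{M}\to\mathbb{R}^2$, $\pi(r,\theta)=(r\cos\theta,r\sin\theta)$. One identifies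 $f$ with $f\circ\pi$. $\mathcal{E}=\{(0,\theta)\in\mathcal{M}\}$, $\mathcal{E}_0=\{(0,\theta)\in\mathcal{E}:\cos\theta\neq0\}$, and $\mathcal{M}_0\subset\mathcal{M}$ is the open set of points $(r,\theta)$ such that, if $r=0$, then $(\cos\theta,\sin\theta)\notin\ker df_0$. Maps $(\mathcal{M}_0,\mathcal{E}_0)\to\cdot$ are germs along $\mathcal{E}_0$. Principal curvature surface: the unit normal $\nu$ of $f$ extends smoothly, up to sign, across $\mathcal{E}$. The principal curvatures are the roots $k$ of $\det(\mathrm{II}-k\,\mathrm{I})=0$, where $\mathrm{I},\mathrm{II}$ are the matrices of the first and second fundamental forms of $f$ in the coordinates $(u,v)$ (second with respect to $\nu$). Exactly one of them is bounded near $\mathcal{E}_0$ and it extends smoothly there; it is denoted $\kappa_1$, and $h_{\kappa_1}=f+\kappa_1\nu$. Curvatures of $h$: $K=(LN-M^2)/(EG-F^2)$ and $H=(EN-2FM+GL)/(2(EG-F^2))$, where $E,F,G$ and $L,M,N$ are the coefficients of the first and second fundamental forms of $h$ with respect to a unit normal of $h$; they are defined on $\mathcal{M}_0\setminus S(h)$, where $S(h)$ is the set of singular points of $h$. Zeros are counted as points of $\mathcal{E}_0$ (equivalently as values of $t=\tan\theta\in\mathbb{R}$). *)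

theory Defs
  imports "HOL-Analysis.Analysis"
begin

section \<open>Smooth maps and germs\<close>

primrec Ck_on ::
  "nat \<Rightarrow> 'a::euclidean_space set \<Rightarrow> ('a \<Rightarrow> 'b::real_normed_vector) \<Rightarrow> bool" where
  "Ck_on 0 S f \<longleftrightarrow> continuous_on S f"
| "Ck_on (Suc k) S f \<longleftrightarrow>
     (\<forall>x\<in>S. f differentiable (at x)) \<and> (\<forall>v. Ck_on k S (\<lambda>x. frechet_derivative f (at x) v))"

text \<open>Only meant for open sets, since derivatives are taken with respect to full neighbourhoods.\<close>

definition smooth_on :: "'a::euclidean_space set \<Rightarrow> ('a \<Rightarrow> 'b::real_normed_vector) \<Rightarrow> bool" where
  "smooth_on S f \<longleftrightarrow> (\<forall>k. Ck_on k S f)"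

text \<open>Germs at a point are represented by total functions, of which only the restriction to an
  unspecified neighbourhood of the point matters.\<close>

definition smooth_germ :: "('a::euclidean_space \<Rightarrow> 'b::real_normed_vector) \<Rightarrow> 'a \<Rightarrow> bool" where
  "smooth_germ f a \<longleftrightarrow> (\<exists>S. open S \<and> a \<in> S \<and> smooth_on S f)"

definition diffeo_germ ::
  "('a::euclidean_space \<Rightarrow> 'a) \<Rightarrow> ('a \<Rightarrow> 'a) \<Rightarrow> bool" where
  "diffeo_germ \<phi> \<psi> \<longleftrightarrow> \<phi> 0 = 0 \<and>
     (\<exists>S T. open S \<and> 0 \<in> S \<and> open T \<and> \<phi> ` S = T \<and> \<psi> ` T = S \<and>
        smooth_on S \<phi> \<and> smooth_on T \<psi> \<and>
        (\<forall>x\<in>S. \<psi> (\<phi> x) = x) \<and> (\<forall>y\<in>T. \<phi> (\<psi> y) = y))"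


section \<open>Fundamental forms and curvatures of a parametrized surface\<close>

definition partial1 :: "(real \<times> real \<Rightarrow> 'b::real_normed_vector) \<Rightarrow> real \<times> real \<Rightarrow> 'b" where
  "partial1 g p = frechet_derivative g (at p) (1, 0)"

definition partial2 :: "(real \<times> real \<Rightarrow> 'b::real_normed_vector) \<Rightarrow> real \<times> real \<Rightarrow> 'b" where
  "partial2 g p = frechet_derivative g (at p) (0, 1)"

definition is_unit_normal :: "(real \<times> real \<Rightarrow> real^3) \<Rightarrow> real \<times> real \<Rightarrow> real^3 \<Rightarrow> bool" where
  "is_unit_normal g p n \<longleftrightarrow> norm n = 1 \<and> n \<bullet> partial1 g p = 0 \<and> n \<bullet> partial2 g p = 0"

definition first_form :: "(real \<times> real \<Rightarrow> real^3) \<Rightarrow> real \<times> real \<Rightarrow> real^2^2" where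
  "first_form g p = vector
     [vector [partial1 g p \<bullet> partial1 g p, partial1 g p \<bullet> partial2 g p],
      vector [partial1 g p \<bullet> partial2 g p, partial2 g p \<bullet> partial2 g p]]"

definition second_form ::
  "(real \<times> real \<Rightarrow> real^3) \<Rightarrow> real \<times> real \<Rightarrow> real^3 \<Rightarrow> real^2^2" where
  "second_form g p n = vector
     [vector [partial1 (partial1 g) p \<bullet> n, partial1 (partial2 g) p \<bullet> n],
      vector [partial1 (partial2 g) p \<bullet> n, partial2 (partial2 g) p \<bullet> n]]"

definition is_principal_curvature ::
  "(real \<times> real \<Rightarrow> real^3) \<Rightarrow> real \<times> real \<Rightarrow> real^3 \<Rightarrow> real \<Rightarrow> bool" where
  "is_principal_curvature g p n k \<longleftrightarrow> det (second_form g p n - k *\<^sub>R first_form g p) = 0"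

definition unit_normal :: "(real \<times> real \<Rightarrow> real^3) \<Rightarrow> real \<times> real \<Rightarrow> real^3" where
  "unit_normal g p = sgn (cross3 (partial1 g p) (partial2 g p))"

definition gauss_curvature :: "(real \<times> real \<Rightarrow> real^3) \<Rightarrow> real \<times> real \<Rightarrow> real" where
  "gauss_curvature g p =
     (let E = first_form g p $ 1 $ 1; F = first_form g p $ 1 $ 2; G = first_form g p $ 2 $ 2;
          II = second_form g p (unit_normal g p);
          L = II $ 1 $ 1; M = II $ 1 $ 2; N = II $ 2 $ 2
      in (L * N - M\<^sup>2) / (E * G - F\<^sup>2))"

definition mean_curvature :: "(real \<times> real \<Rightarrow> real^3) \<Rightarrow> real \<times> real \<Rightarrow> real" where
  "mean_curvature g p =
     (let E = first_form g p $ 1 $ 1; F = first_form g p $ 1 $ 2; G = first_form g p $ 2 $ 2;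
          II = second_form g p (unit_normal g p);
          L = II $ 1 $ 1; M = II $ 1 $ 2; N = II $ 2 $ 2
      in (E * N - 2 * F * M + G * L) / (2 * (E * G - F\<^sup>2)))"


section \<open>Whitney umbrellas, their normal form, and the jet space\<close>

definition whitney_umbrella :: "(real \<times> real \<Rightarrow> real^3) \<Rightarrow> bool" where
  "whitney_umbrella f \<longleftrightarrow> f 0 = 0 \<and> smooth_germ f 0 \<and>
     (\<exists>\<phi> \<phi>inv \<mu> \<mu>inv. diffeo_germ \<phi> \<phi>inv \<and> diffeo_germ \<mu> \<mu>inv \<and>
        (\<forall>\<^sub>F (u, v) in nhds 0. \<mu> (f (\<phi>inv (u, v))) = vector [u, v\<^sup>2, u * v]))"

definition normal_form ::
  "(real \<times> real \<Rightarrow> real^3) \<Rightarrow> (real \<Rightarrow> real) \<Rightarrow> (real \<Rightarrow> real) \<Rightarrow> (real \<Rightarrow> real) \<Rightarrow>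
   (real \<times> real \<Rightarrow> real) \<Rightarrow> (real \<Rightarrow> real) \<Rightarrow> bool" where
  "normal_form f f21 f31 f321 f322 f331 \<longleftrightarrow>
     smooth_germ f21 0 \<and> smooth_germ f31 0 \<and> smooth_germ f321 0 \<and> smooth_germ f322 0 \<and>
     smooth_germ f331 0 \<and> f331 0 > 0 \<and>
     (\<forall>\<^sub>F (u, v) in nhds 0. f (u, v) = vector
        [u,
         u\<^sup>2 * f21 u + v\<^sup>2,
         u\<^sup>2 * f31 u + v\<^sup>2 * (u * f321 u + v * f322 (u, v)) + u * v * f331 u])"

text \<open>A point of the ambient Euclidean space of dimension 14 lists the Taylor coefficients of
  \<open>j\<^sup>2f\<^sub>2\<^sub>1(0)\<close>, \<open>j\<^sup>2f\<^sub>3\<^sub>1(0)\<close>, \<open>j\<^sup>1f\<^sub>3\<^sub>2\<^sub>1(0)\<close>, \<open>j\<^sup>1f\<^sub>3\<^sub>2\<^sub>2(0,0)\<close>, \<open>j\<^sup>2f\<^sub>3\<^sub>3\<^sub>1(0)\<close>,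
  in this order.\<close>

type_synonym jet_space = "(real^3) \<times> (real^3) \<times> (real^2) \<times> (real^3) \<times> (real^3)"

definition jets ::
  "(real \<Rightarrow> real) \<Rightarrow> (real \<Rightarrow> real) \<Rightarrow> (real \<Rightarrow> real) \<Rightarrow>
   (real \<times> real \<Rightarrow> real) \<Rightarrow> (real \<Rightarrow> real) \<Rightarrow> jet_space" where
  "jets f21 f31 f321 f322 f331 =
     (vector [f21 0, deriv f21 0, deriv (deriv f21) 0 / 2],
      vector [f31 0, deriv f31 0, deriv (deriv f31) 0 / 2],
      vector [f321 0, deriv f321 0],
      vector [f322 0, partial1 f322 0, partial2 f322 0],
      vector [f331 0, deriv f331 0, deriv (deriv f331) 0 / 2])"

definition umbrella_jets :: "jet_space set" where
  "umbrella_jets = {(a21, a31, a321, a322, a331). a331 $ 1 > 0}"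

definition algebraic_subset :: "jet_space set \<Rightarrow> bool" where
  "algebraic_subset A \<longleftrightarrow>
     (\<exists>P. finite P \<and> (\<forall>p\<in>P. real_polynomial_function p) \<and>
          A = {x \<in> umbrella_jets. \<forall>p\<in>P. p x = 0})"

text \<open>\<open>f\<close> is a Whitney umbrella in normal form with jet tuple in \<open>S\<close>; the normal form functions are
  determined, as germs, by \<open>f\<close>.\<close>

definition umbrella_in :: "(real \<times> real \<Rightarrow> real^3) \<Rightarrow> jet_space set \<Rightarrow> bool" where
  "umbrella_in f S \<longleftrightarrow> whitney_umbrella f \<and>
     (\<exists>f21 f31 f321 f322 f331. normal_form f f21 f31 f321 f322 f331 \<and>
        jets f21 f31 f321 f322 f331 \<in> S)"


section \<open>The blow-up of the plane\<close>

text \<open>The relation generated by \<open>(r, \<theta>) \<sim> (r, \<theta> + 2\<pi>)\<close> and \<open>(r, \<theta>) \<sim> (- r, \<theta> + \<pi>)\<close>.\<close>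

definition blowup_rel :: "real \<times> real \<Rightarrow> real \<times> real \<Rightarrow> bool" where
  "blowup_rel = (\<lambda>(r, \<theta>) (r', \<theta>').
     \<exists>k::int. \<theta>' = \<theta> + of_int k * pi \<and> r' = (if even k then r else - r))"

lemma equivp_blowup_rel: "equivp blowup_rel"
proof (rule equivpI)
  show "reflp blowup_rel"
    by (rule reflpI) (auto simp: blowup_rel_def intro!: exI[of _ "0::int"])
  show "symp blowup_rel"
  proof (rule sympI)
    fix x y :: "real \<times> real"
    assume "blowup_rel x y"
    then obtain r \<theta> k where xy: "x = (r, \<theta>)"
        "y = (if even k then r else - r, \<theta> + of_int k * pi)"
      by (cases x; cases y) (auto simp: blowup_rel_def)
    show "blowup_rel y x"
      unfolding blowup_rel_def xy by (auto intro!: exI[of _ "- k"])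
  qed
  show "transp blowup_rel"
  proof (rule transpI)
    fix x y z :: "real \<times> real"
    assume "blowup_rel x y" "blowup_rel y z"
    then obtain r \<theta> k l where xyz: "x = (r, \<theta>)"
        "y = (if even k then r else - r, \<theta> + of_int k * pi)"
        "z = (if even l then fst y else - fst y, snd y + of_int l * pi)"
      by (cases x; cases y; cases z) (auto simp: blowup_rel_def)
    show "blowup_rel x z"
      unfolding blowup_rel_def xyz by (auto intro!: exI[of _ "k + l"] simp: algebra_simps)
  qed
qed

quotient_type blowup = "real \<times> real" / blowup_rel
  by (rule equivp_blowup_rel)

text \<open>The projection onto the quotient; it is a covering map, so it provides the local coordinates
  \<open>(r, \<theta>)\<close>, and openness, smoothness and singular points on the blow-up are tested on pullbacks
  along it.\<close>

abbreviation polar :: "real \<times> real \<Rightarrow> blowup" where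
  "polar \<equiv> abs_blowup"

lift_definition blow_down :: "blowup \<Rightarrow> real \<times> real" is
  "\<lambda>(r, \<theta>). (r * cos \<theta>, r * sin \<theta>)"
proof -
  fix x y :: "real \<times> real"
  assume "blowup_rel x y"
  then obtain r \<theta> k where xy: "x = (r, \<theta>)"
      "y = (if even k then r else - r, \<theta> + of_int k * pi)"
    by (cases x; cases y) (auto simp: blowup_rel_def)
  have "sin (of_int k * pi) = 0"
    by (simp add: sin_times_pi_eq_0)
  moreover have "cos (of_int k * pi) = (if even k then 1 else - 1)"
    using cos_int_times_real[of k pi] by (simp add: mult.commute)
  ultimately show "(case x of (r, \<theta>) \<Rightarrow> (r * cos \<theta>, r * sin \<theta>)) =
      (case y of (r, \<theta>) \<Rightarrow> (r * cos \<theta>, r * sin \<theta>))"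
    by (simp add: xy cos_add sin_add)
qed

definition open_blowup :: "blowup set \<Rightarrow> bool" where
  "open_blowup U \<longleftrightarrow> open (polar -` U)"

definition smooth_on_blowup :: "blowup set \<Rightarrow> (blowup \<Rightarrow> 'b::real_normed_vector) \<Rightarrow> bool" where
  "smooth_on_blowup U g \<longleftrightarrow> smooth_on (polar -` U) (g \<circ> polar)"

definition exceptional :: "blowup set" where
  "exceptional = {polar (0, \<theta>) |\<theta>. True}"

definition exceptional0 :: "blowup set" where
  "exceptional0 = {polar (0, \<theta>) |\<theta>. cos \<theta> \<noteq> 0}"

definition blowup0 :: "(real \<times> real \<Rightarrow> real^3) \<Rightarrow> blowup set" where
  "blowup0 f = {polar (r, \<theta>) |r \<theta>.
     r = 0 \<longrightarrow> frechet_derivative f (at 0) (cos \<theta>, sin \<theta>) \<noteq> 0}"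


section \<open>Principal curvature surfaces\<close>

text \<open>\<open>h\<close> represents the germ along \<^const>\<open>exceptional0\<close> of \<open>f + \<kappa>\<^sub>1\<nu>\<close>. The smooth extension of a
  principal curvature \<open>\<kappa>\<close> across \<^const>\<open>exceptional0\<close> makes it locally bounded there, which singles
  out \<open>\<kappa>\<^sub>1\<close>. As a germ, \<open>h\<close> is unique: the pair \<open>(\<nu>, \<kappa>)\<close> is determined up to a common sign. No global
  choice of sign obstructs a smooth \<open>\<nu>\<close>, as \<^const>\<open>exceptional0\<close> is an interval.\<close>

definition principal_curvature_surface ::
  "(real \<times> real \<Rightarrow> real^3) \<Rightarrow> (blowup \<Rightarrow> real^3) \<Rightarrow> bool" where
  "principal_curvature_surface f h \<longleftrightarrow>
     (\<exists>U \<nu> \<kappa>. open_blowup U \<and> exceptional0 \<subseteq> U \<and> U \<subseteq> blowup0 f \<and>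
        smooth_on_blowup U \<nu> \<and> smooth_on_blowup U \<kappa> \<and>
        (\<forall>p\<in>U - exceptional.
           is_unit_normal f (blow_down p) (\<nu> p) \<and>
           is_principal_curvature f (blow_down p) (\<nu> p) (\<kappa> p)) \<and>
        (\<forall>p\<in>U. h p = f (blow_down p) + \<kappa> p *\<^sub>R \<nu> p))"

definition singular_points :: "(blowup \<Rightarrow> real^3) \<Rightarrow> blowup set" where
  "singular_points h = {polar x |x. \<not> inj (frechet_derivative (h \<circ> polar) (at x))}"

text \<open>Zeros on \<^const>\<open>exceptional0\<close> of a curvature of \<open>h\<close>, computed in the coordinates \<open>(r, \<theta>)\<close>.
  A change of the representative \<open>x\<close> of \<open>p\<close> preserves \<^const>\<open>gauss_curvature\<close> and changes
  \<^const>\<open>mean_curvature\<close> at most by a sign, so the zero set does not depend on it.\<close>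

definition curvature_zeros ::
  "((real \<times> real \<Rightarrow> real^3) \<Rightarrow> real \<times> real \<Rightarrow> real) \<Rightarrow> (blowup \<Rightarrow> real^3) \<Rightarrow> blowup set" where
  "curvature_zeros curv h =
     {p \<in> exceptional0 - singular_points h. \<exists>x. polar x = p \<and> curv (h \<circ> polar) x = 0}"

end

(* In the chart u = r cos th, t = tan th of the blow-up, f_v is divisible by u and
   W = f_u x f_v / u is a normal vector field that does not vanish on u = 0. Since the bounded principal
   curvature is a root of a quadratic equation, its expansion k0 + k1 u + k2 u^2 (for the normal W,
   suitably scaled) is determined by the four-jet of f, and so is h = A0 + A1 u + A2 u^2 + o(u^2).
   Hence the first and second fundamental forms of h on u = 0 are rational functions of t; up to nonzero
   factors the numerators of K and H are polynomials PK of degree 21 (if b0 <> 0) and PH of degree 18 in t.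
   The decisive cancellations of leading coefficients become visible when the forms are written in a frame
   adapted to W. A jet is generic if b0 and the discriminants of PK and PH do not vanish. Then all
   real roots are simple, so their number has the parity of the degree, and h is immersed along
   the exceptional set because a singular point would be a multiple root of PK. *)

theory Submission
  imports Defs "HOL-Computational_Algebra.Field_as_Ring" "Subresultants.Subresultant_Gcd"
begin

no_notation vec_index (infixl "$" 100)
no_notation scalar_prod (infix "\<bullet>" 70)
hide_const (open) Matrix.vec Module.smult Determinant.det

section \<open>Leading terms of polynomials\<close>

text \<open>Only expansions along single rays t = const are computed, without any uniformity in t: h
  is smooth on the blow-up by definition, so uniqueness of Taylor coefficients turns each ray
  expansion into values of h, h_r and h_rr on the divisor, and derivatives in \<theta> come from
  differentiating the coefficients in t. The two-jet of the root k follows from mere convergence of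
  k: in (L - k E)(N - k G) = (M - k F)^2 (forms of f) every k outside the term E N k is multiplied
  by F or G, which are of order u^2. The product \<kappa>\<nu> = k W / (W . W) does not see the sign
  of \<nu>. Counted term by term, \<open>PK\<close> has degree 22; the coefficients of
  \<open>N1\<close> at t^4 and of \<open>M\<close> at t^11 vanish identically, leaving -2^19 e0^9 b0
  at t^21, whence the factor b0 in genericity. One hypersurface serves both statements, because
  immersedness is read off from \<open>PK\<close> also when zeros of H are counted. That it is
  proper needs one jet with nonzero discriminants; evaluating a Sylvester determinant of size 41 is
  replaced by a coprimality certificate modulo 5.\<close>

definition top_coeff :: "nat \<Rightarrow> 'a::comm_ring_1 poly \<Rightarrow> 'a \<Rightarrow> bool" where
  "top_coeff n p c \<longleftrightarrow> degree p \<le> n \<and> coeff p n = c"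

lemma top_coeff_mult:
  assumes "top_coeff m p a" "top_coeff n q b"
  shows "top_coeff (m + n) (p * q) (a * b)"
proof -
  have d: "degree p \<le> m" "degree q \<le> n" using assms by (auto simp: top_coeff_def)
  have "coeff (p * q) (m + n) = (\<Sum>i\<le>m+n. coeff p i * coeff q (m + n - i))"
    by (rule coeff_mult)
  also have "\<dots> = (\<Sum>i\<in>{m}. coeff p i * coeff q (m + n - i))"
  proof (rule sum.mono_neutral_right)
    show "\<forall>i\<in>{..m+n} - {m}. coeff p i * coeff q (m + n - i) = 0"
    proof
      fix i assume "i \<in> {..m+n} - {m}"
      then have "i < m \<and> degree q < m + n - i \<or> degree p < i" using d by auto
      then show "coeff p i * coeff q (m + n - i) = 0" by (auto simp: coeff_eq_0)
    qed
  qed auto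
  finally have "coeff (p * q) (m + n) = a * b" using assms by (simp add: top_coeff_def)
  moreover have "degree (p * q) \<le> m + n"
    using degree_mult_le[of p q] d by linarith
  ultimately show ?thesis by (simp add: top_coeff_def)
qed

lemma top_coeff_add:
  assumes "top_coeff m p a" "top_coeff n q b" "m = n"
  shows "top_coeff n (p + q) (a + b)"
  using assms by (auto simp: top_coeff_def degree_add_le)

lemma top_coeff_diff:
  assumes "top_coeff m p a" "top_coeff n q b" "m = n"
  shows "top_coeff n (p - q) (a - b)"
  using assms by (auto simp: top_coeff_def degree_diff_le)

lemma top_coeff_uminus: "top_coeff n p a \<Longrightarrow> top_coeff n (- p) (- a)"
  by (simp add: top_coeff_def)

lemma top_coeff_smult: "top_coeff n p a \<Longrightarrow> top_coeff n (smult c p) (c * a)"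
  unfolding top_coeff_def using degree_smult_le[of c p] by (auto intro: order_trans)

lemma top_coeff_less: "top_coeff m p a \<Longrightarrow> m < n \<Longrightarrow> top_coeff n p 0"
  by (auto simp: top_coeff_def coeff_eq_0)

text \<open>Since \<open>top_coeff\<close> admits the value 0, a cancellation at the expected degree
  requires no case distinction; it simply lowers the bound by one. \<open>top_N1\<close> and
  \<open>top_M\<close> gain their degree this way.\<close>

lemma top_coeff_drop: "top_coeff (Suc n) p 0 \<Longrightarrow> top_coeff n p (coeff p n)"
  unfolding top_coeff_def using le_degree le_SucE
  by (metis coeff_0 le_0_eq leading_coeff_0_iff degree_0 zero_le)

lemma top_coeff_pderiv:
  assumes "top_coeff (Suc n) p a"
  shows "top_coeff n (pderiv p) (of_nat (Suc n) * a)"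
proof -
  have "degree (pderiv p) \<le> degree p - 1" for p :: "'a poly"
    by (rule degree_le) (auto simp: coeff_pderiv coeff_eq_0)
  from this[of p] show ?thesis
    using assms by (auto simp: top_coeff_def coeff_pderiv)
qed

text \<open>Degrees and coefficients of composite expressions are assembled as one nested theorem;
  this rule leaves the two arithmetical identities for simplification.\<close>

lemma top_coeff_cong:
  "top_coeff m p a \<Longrightarrow> m = n \<Longrightarrow> a = c \<Longrightarrow> top_coeff n p c"
  by simp

section \<open>The polynomials attached to a jet\<close>

text \<open>The scaled fundamental forms \<open>E, F, G, L, M, N\<close> below are those of the principal curvature
  surface along the exceptional divisor, with respect to the coordinates \<open>u\<close> and
  \<open>t = v / u = tan \<theta>\<close>, up to powers of \<open>w = e\<^sub>0\<^sup>2 + 4 t\<^sup>2\<close>; \<open>k\<^sub>0 + k\<^sub>1 u + k\<^sub>2 u\<^sup>2 + \<dots>\<close> is the bounded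
  principal curvature computed with the normal \<open>W = f\<^sub>u \<times> f\<^sub>v / u\<close> and multiplied by the length of \<open>W\<close>,
  and \<open>g\<^sub>0 + g\<^sub>1 u + g\<^sub>2 u\<^sup>2 + \<dots>\<close> is the third coordinate of \<open>f\<^sub>v / u\<close>.\<close>

locale umbrella_jet =
  fixes x :: jet_space
begin

text \<open>The letters a, b, c, d, e stand for the functions f21, f31, f321, f322, f331. The index
  is the order of the Taylor coefficient, except that d1 and d2 are the two first partial
  derivatives of f322.\<close>

definition "a0 = fst x $ 1"
definition "a1 = fst x $ 2"
definition "a2 = fst x $ 3"
definition "b0 = fst (snd x) $ 1"
definition "b1 = fst (snd x) $ 2"
definition "b2 = fst (snd x) $ 3"
definition "c0 = fst (snd (snd x)) $ 1"
definition "c1 = fst (snd (snd x)) $ 2"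
definition "d0 = fst (snd (snd (snd x))) $ 1"
definition "d1 = fst (snd (snd (snd x))) $ 2"
definition "d2 = fst (snd (snd (snd x))) $ 3"
definition "e0 = snd (snd (snd (snd x))) $ 1"
definition "e1 = snd (snd (snd (snd x))) $ 2"
definition "e2 = snd (snd (snd (snd x))) $ 3"

definition "w = [:e0 * e0, 0, 4:]"
definition "g1 = [:e1, 2 * c0, 3 * d0:]"
definition "g2 = [:e2, 2 * c1, 3 * d1, 4 * d2:]"
text \<open>The first coordinate of W along a ray is - k0 u + x2 u^2 + ...; see
  \<open>jet2_ray_W\<close>.\<close>

definition "x2 = [:2 * a0 * e1 + 3 * a1 * e0, 4 * a0 * c0 - 6 * b1, 6 * a0 * d0 - 4 * e1, - 2 * c0:]"
definition "k0 = [:- 2 * a0 * e0, 4 * b0, 2 * e0:]"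
definition "k1 = [:- 6 * e0 * a1 - 2 * a0 * e1, 12 * b1 - 4 * a0 * c0, 10 * e1 - 6 * a0 * d0,
   8 * c0, 6 * d0:]"
text \<open>This is e0 k2. Solving for the root divides by the second form coefficient N0 = -2 e0 of
  f, and in k2 the single term 2 t^2 g1^2 / e0 keeps a denominator; multiplying by e0 gives a
  polynomial in the jet as well.\<close>

definition "ek2 = smult e0
   ([:- 12 * e0 * a2 - 6 * e1 * a1 - 2 * a0 * e2, 24 * b2 - 12 * c0 * a1 - 4 * a0 * c1,
      22 * e2 - 18 * d0 * a1 - 6 * a0 * d1, 20 * c1 - 8 * a0 * d2, 18 * d1, 16 * d2:]
    - k0 * [:4 * a0 * a0 + 4 * b0 * b0, 8 * b0 * e0, 8 * a0 + 4 * e0 * e0, 0, 4:])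
   + [:0, 0, 2:] * (g1 * g1)"
definition "k0' = pderiv k0"
definition "k0'' = pderiv k0'"
text \<open>In the frame adapted to W, \<open>del\<close> and \<open>eps\<close> are the numerators
  of the derivative \<open>A0'\<close>, and \<open>v\<close>, \<open>bet\<close>, \<open>gam\<close>
  those of \<open>A1\<close>. The remaining ones arise in pairings with the normal
  \<open>nh\<close>: \<open>tau\<close> is a quotient by w, \<open>- v * zeta\<close> is the second
  coordinate of \<open>nh\<close>, and \<open>v * phi\<close> its product with the u^2 coefficient
  of f.\<close>

definition "v = w - k0 * k0"
definition "eps = smult (2 * e0) k0"
definition "del = k0' * w - [:0, 4:] * k0"
definition "bet = k1 * w - smult e0 (k0 * g1)"
definition "gam = - ([:0, 2:] * (k0 * g1))"
definition "tau = smult e0 k1 + [:0, 1:] * (k0' * g1) - k0 * g1"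
definition "zeta = smult e0 eps + [:0, 2:] * del"
definition "phi = [:b0, e0:] * ([:0, 2:] * eps - smult e0 del) - [:a0, 0, 1:] * zeta"

text \<open>The raw products of frame components all contain an extra factor w. \<open>E\<close>,
  \<open>F\<close>, \<open>G\<close>, \<open>N1\<close> and \<open>Y\<close> are what remains after
  dividing it out, which keeps the degrees sharp.\<close>

definition "E = v * v + k1 * k1 * w - smult (2 * e0) (k0 * k1 * g1) + k0 * k0 * g1 * g1"
definition "F = k1 * (k0' * w - [:0, 4:] * k0) - smult e0 (k0 * k0' * g1)"
definition "G = k0' * k0' * w - [:0, 8:] * (k0 * k0') + smult 4 (k0 * k0)"
definition "N1 = k0 * k0'' * w - smult 8 (k0 * k0) + [:0, 16:] * (k0 * k0') - smult 2 (k0' * k0' * w)"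
definition "N = smult (2 * e0) (v * N1)"
definition "Y = eps * pderiv bet - del * pderiv gam - [:0, 24:] * (k0 * tau) - smult (2 * e0) F"
definition "M = v * Y + smult 4 (k0 * k0 * (tau * del))"
definition "L = smult 2
   (w * v * phi + smult 2 (w * v * (k0 * ek2))
    + k1 * (smult 2 (w * (k0 * k0) * tau) + g1 * (v * zeta))
    + k0 * (g2 * (v * zeta) - smult 2 (w * x2 * (k0 * tau)))
    - smult (2 * e0) (g1 * k1 * (v * eps))
    - smult (4 * e0) (g1 * (k0 * k0 * k0) * tau)
    + smult (4 * e0) (g1 * g1 * (k0 * v) * (k0 - [:0, 1:] * k0'))
    - k0 * (v * eps) * (k0 * k0 + g1 * g1 + smult (2 * e0) g2))"

definition "PK = L * N - M * M"
definition "PH = E * N - smult 2 (F * M) + G * L"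

section \<open>Degrees and leading coefficients of the fundamental forms, of \<open>PK\<close> and
  of \<open>PH\<close>\<close>

lemma top_w: "top_coeff 2 w 4"
  and top_g1: "top_coeff 2 g1 (3 * d0)"
  and top_g2: "top_coeff 3 g2 (4 * d2)"
  and top_x2: "top_coeff 3 x2 (- 2 * c0)"
  and top_k0: "top_coeff 2 k0 (2 * e0)"
  and top_k1: "top_coeff 4 k1 (6 * d0)"
  and top_k0': "top_coeff 1 k0' (4 * e0)"
  and top_k0'': "top_coeff 0 k0'' (4 * e0)"
  by (simp_all add: top_coeff_def w_def g1_def g2_def x2_def k0_def k1_def k0'_def k0''_def
      pderiv_pCons eval_nat_numeral)

lemma top_monom: "top_coeff 1 [:0, c::'a::comm_ring_1:] c"
  by (simp add: top_coeff_def)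


lemma top_ek2: "top_coeff 6 ek2 (18 * d0 * d0 - 8 * e0 * e0)"
proof -
  have 1: "top_coeff 4 [:4 * a0 * a0 + 4 * b0 * b0, 8 * b0 * e0, 8 * a0 + 4 * e0 * e0, 0, 4:] 4"
    by (simp add: top_coeff_def eval_nat_numeral)
  have 2: "top_coeff 2 [:0, 0, 2::real:] 2"
    by (simp add: top_coeff_def eval_nat_numeral)
  have 3: "top_coeff 6 [:- 12 * e0 * a2 - 6 * e1 * a1 - 2 * a0 * e2, 24 * b2 - 12 * c0 * a1 - 4 * a0 * c1,
      22 * e2 - 18 * d0 * a1 - 6 * a0 * d1, 20 * c1 - 8 * a0 * d2, 18 * d1, 16 * d2:] 0"
    by (simp add: top_coeff_def eval_nat_numeral)
  show ?thesis unfolding ek2_def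
    by (rule top_coeff_cong[OF top_coeff_add[OF top_coeff_smult[OF
       top_coeff_diff[OF 3 top_coeff_mult[OF top_k0 1]]] 
       top_coeff_mult[OF 2 top_coeff_mult[OF top_g1 top_g1]]]]) (simp_all add: algebra_simps)
qed

lemma top_v: "top_coeff 4 v (- 4 * e0 * e0)"
  unfolding v_def
  by (rule top_coeff_cong[OF top_coeff_diff[OF top_coeff_less[OF top_w, of 4] top_coeff_mult[OF top_k0 top_k0]]])
    (simp_all add: algebra_simps)

lemma top_eps: "top_coeff 2 eps (4 * e0 * e0)"
  unfolding eps_def
  by (rule top_coeff_cong[OF top_coeff_smult[OF top_k0]]) (simp_all add: algebra_simps)

lemma top_del: "top_coeff 3 del (8 * e0)"
  unfolding del_def
  by (rule top_coeff_cong[OF top_coeff_diff[OF top_coeff_mult[OF top_k0' top_w] 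
     top_coeff_mult[OF top_monom top_k0]]]) (simp_all add: algebra_simps)

lemma top_bet: "top_coeff 6 bet (24 * d0)"
  unfolding bet_def
  by (rule top_coeff_cong[OF top_coeff_diff[OF top_coeff_mult[OF top_k1 top_w]
      top_coeff_less[OF top_coeff_smult[OF top_coeff_mult[OF top_k0 top_g1]], of 6]]])
    (simp_all add: algebra_simps)

lemma top_gam: "top_coeff 5 gam (- 12 * e0 * d0)"
  unfolding gam_def
  by (rule top_coeff_cong[OF top_coeff_uminus[OF 
     top_coeff_mult[OF top_monom top_coeff_mult[OF top_k0 top_g1]]]]) (simp_all add: algebra_simps)

lemma top_tau: "top_coeff 4 tau (12 * e0 * d0)"
  unfolding tau_def
  by (rule top_coeff_cong[OF top_coeff_diff[OF top_coeff_add[OF top_coeff_smult[OF top_k1]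
     top_coeff_mult[OF top_monom top_coeff_mult[OF top_k0' top_g1]]] top_coeff_mult[OF top_k0 top_g1]]])
    (simp_all add: algebra_simps)

lemma top_zeta: "top_coeff 4 zeta (16 * e0)"
  unfolding zeta_def
  by (rule top_coeff_cong[OF top_coeff_add[OF top_coeff_smult[OF top_coeff_less[OF top_eps, of 4]]
     top_coeff_mult[OF top_monom top_del]]])
    (simp_all add: algebra_simps)

lemma top_phi: "top_coeff 6 phi (- 16 * e0)"
proof -
  have 1: "top_coeff 1 [:b0, e0:] e0" "top_coeff 2 [:a0, 0, 1:] 1"
    by (simp_all add: top_coeff_def eval_nat_numeral)
  show ?thesis unfolding phi_def
    by (rule top_coeff_cong[OF top_coeff_diff[OF top_coeff_less[OF top_coeff_mult[OF 1(1)
      top_coeff_diff[OF top_coeff_mult[OF top_monom top_eps] top_coeff_smult[OF top_del]]], of 6]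
      top_coeff_mult[OF 1(2) top_zeta]]]) (simp_all add: algebra_simps)
qed

lemma top_E: "top_coeff 10 E (144 * d0 * d0)"
  unfolding E_def
  by (rule top_coeff_cong[OF top_coeff_add[OF top_coeff_diff[OF top_coeff_add[OF
      top_coeff_less[OF top_coeff_mult[OF top_v top_v], of 10]
      top_coeff_mult[OF top_coeff_mult[OF top_k1 top_k1] top_w]]
      top_coeff_less[OF top_coeff_smult[OF top_coeff_mult[OF top_coeff_mult[OF top_k0 top_k1] top_g1]], of 10]]
      top_coeff_less[OF top_coeff_mult[OF top_coeff_mult[OF top_coeff_mult[OF top_k0 top_k0] top_g1] top_g1], of 10]]])
    (simp_all add: algebra_simps)

lemma top_F: "top_coeff 7 F (48 * e0 * d0)"
  unfolding F_def del_def[symmetric]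
  by (rule top_coeff_cong[OF top_coeff_diff[OF top_coeff_mult[OF top_k1 top_del]
    top_coeff_less[OF top_coeff_smult[OF top_coeff_mult[OF top_coeff_mult[OF top_k0 top_k0'] top_g1]], of 7]]])
    (simp_all add: algebra_simps)

lemma top_G: "top_coeff 4 G (16 * e0 * e0)"
  unfolding G_def
  by (rule top_coeff_cong[OF top_coeff_add[OF top_coeff_diff[OF 
     top_coeff_mult[OF top_coeff_mult[OF top_k0' top_k0'] top_w]
     top_coeff_mult[OF top_monom top_coeff_mult[OF top_k0 top_k0']]]
     top_coeff_smult[OF top_coeff_mult[OF top_k0 top_k0]]]])
    (simp_all add: algebra_simps)

text \<open>At t^4 the four terms contribute 32, -32, 128 and -128 times e0^2. The next coefficient,
  64 e0 b0, is the origin of b0 in the leading coefficient of \<open>PK\<close>.\<close>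

lemma top_N1: "top_coeff 3 N1 (64 * e0 * b0)"
proof -
  have "top_coeff 4 N1 0" unfolding N1_def
    by (rule top_coeff_cong[OF top_coeff_diff[OF top_coeff_add[OF top_coeff_diff[OF
       top_coeff_mult[OF top_coeff_mult[OF top_k0 top_k0''] top_w]
       top_coeff_smult[OF top_coeff_mult[OF top_k0 top_k0]]]
       top_coeff_mult[OF top_monom top_coeff_mult[OF top_k0 top_k0']]]
       top_coeff_smult[OF top_coeff_mult[OF top_coeff_mult[OF top_k0' top_k0'] top_w]]]])
      (simp_all add: algebra_simps)
  moreover have "coeff N1 3 = 64 * e0 * b0"
    by (simp add: N1_def w_def k0_def k0'_def k0''_def pderiv_pCons algebra_simps eval_nat_numeral)
  ultimately show ?thesis using top_coeff_drop[of 3 N1] by (simp add: eval_nat_numeral)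
qed

lemma top_N: "top_coeff 7 N (- 512 * e0 ^ 4 * b0)"
  unfolding N_def
  by (rule top_coeff_cong[OF top_coeff_smult[OF top_coeff_mult[OF top_v top_N1]]])
    (simp_all add: algebra_simps eval_nat_numeral)

lemma top_Y: "top_coeff 7 Y (384 * e0 * e0 * d0)"
proof -
  have 1: "top_coeff 5 (pderiv bet) (144 * d0)" "top_coeff 4 (pderiv gam) (- (60 * (e0 * d0)))"
    using top_coeff_pderiv[of 5 bet "24 * d0"] top_bet top_coeff_pderiv[of 4 gam "- 12 * e0 * d0"] top_gam
    by simp_all
  show ?thesis unfolding Y_def
    by (rule top_coeff_cong[OF top_coeff_diff[OF top_coeff_diff[OF top_coeff_diff[OF
       top_coeff_mult[OF top_eps 1(1)] top_coeff_mult[OF top_del 1(2)]]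
       top_coeff_mult[OF top_monom top_coeff_mult[OF top_k0 top_tau]]] top_coeff_smult[OF top_F]]])
      (simp_all add: algebra_simps)
qed

text \<open>Both summands of \<open>M\<close> have expected degree 11. Substituting v = w - k0^2
  regroups them as w Y - k0^2 (Y - 4 tau del), and Y and 4 tau del share the coefficient 384 e0^2 d0
  at t^7. The coefficient at t^10 stays unnamed, since M * M only reaches degree 20 in
  \<open>PK\<close> and F * M degree 17 in \<open>PH\<close>.\<close>

lemma top_M: "\<exists>c. top_coeff 10 M c"
proof -
  have "top_coeff 7 (Y - smult 4 (tau * del)) 0"
    by (rule top_coeff_cong[OF top_coeff_diff[OF top_Y top_coeff_smult[OF top_coeff_mult[OF top_tau top_del]]]])
      (simp_all add: algebra_simps)
  then obtain c where c: "top_coeff 6 (Y - smult 4 (tau * del)) c"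
    using top_coeff_drop[of 6 "Y - smult 4 (tau * del)"] by auto
  have "top_coeff 10 (w * Y - k0 * k0 * (Y - smult 4 (tau * del))) (0 - 2 * e0 * (2 * e0) * c)"
    by (rule top_coeff_cong[OF top_coeff_diff[OF top_coeff_less[OF top_coeff_mult[OF top_w top_Y], of 10]
       top_coeff_mult[OF top_coeff_mult[OF top_k0 top_k0] c]]]) simp_all
  moreover have "w * Y - k0 * k0 * (Y - smult 4 (tau * del)) = M"
    by (simp add: M_def v_def algebra_simps)
  ultimately show ?thesis by auto
qed

text \<open>Inside the outer factor 2, the d0^2 contributions at t^14 are -1152 from
  \<open>ek2\<close>, 2304 from \<open>tau\<close> and -1152 from \<open>g1 * (v * zeta)\<close>,
  each times e0^3, and cancel. Only the part -8 e0^2 of \<open>ek2\<close> survives, so the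
  coefficient is a multiple of e0^5 alone.\<close>

lemma top_L: "top_coeff 14 L (1024 * e0 ^ 5)"
  unfolding L_def
  apply (rule top_coeff_cong[OF top_coeff_smult[OF 
     top_coeff_diff[OF top_coeff_add[OF top_coeff_diff[OF top_coeff_diff[OF
       top_coeff_add[OF top_coeff_add[OF top_coeff_add[OF
     top_coeff_less[OF top_coeff_mult[OF top_coeff_mult[OF top_w top_v] top_phi], of 14]
     top_coeff_smult[OF top_coeff_mult[OF top_coeff_mult[OF top_w top_v] top_coeff_mult[OF top_k0 top_ek2]]]]
     top_coeff_mult[OF top_k1 top_coeff_add[OF
       top_coeff_smult[OF top_coeff_mult[OF top_coeff_mult[OF top_w top_coeff_mult[OF top_k0 top_k0]] top_tau]]
       top_coeff_mult[OF top_g1 top_coeff_mult[OF top_v top_zeta]]]]]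
     top_coeff_less[OF top_coeff_mult[OF top_k0 top_coeff_diff[OF 
       top_coeff_mult[OF top_g2 top_coeff_mult[OF top_v top_zeta]]
       top_coeff_smult[OF top_coeff_mult[OF top_coeff_mult[OF top_w top_x2] top_coeff_mult[OF top_k0 top_tau]]]]], of 14]]
     top_coeff_less[OF top_coeff_smult[OF top_coeff_mult[OF top_coeff_mult[OF top_g1 top_k1] 
       top_coeff_mult[OF top_v top_eps]]], of 14]]
     top_coeff_less[OF top_coeff_smult[OF top_coeff_mult[OF top_coeff_mult[OF top_g1 
       top_coeff_mult[OF top_coeff_mult[OF top_k0 top_k0] top_k0]] top_tau]], of 14]]
     top_coeff_less[OF top_coeff_smult[OF top_coeff_mult[OF top_coeff_mult[OF top_coeff_mult[OF top_g1 top_g1] 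
       top_coeff_mult[OF top_k0 top_v]]
       top_coeff_diff[OF top_k0 top_coeff_mult[OF top_monom top_k0']]]], of 14]]
     top_coeff_less[OF top_coeff_mult[OF top_coeff_mult[OF top_k0 top_coeff_mult[OF top_v top_eps]]
      top_coeff_add[OF top_coeff_add[OF top_coeff_mult[OF top_k0 top_k0] top_coeff_mult[OF top_g1 top_g1]]
        top_coeff_smult[OF top_coeff_less[OF top_g2, of 4]]]], of 14]]]])
  by (simp_all add: algebra_simps eval_nat_numeral)

lemma top_PK: "top_coeff 21 PK (- 524288 * e0 ^ 9 * b0)"
proof -
  obtain c where M: "top_coeff 10 M c" using top_M ..
  show ?thesis unfolding PK_def
    by (rule top_coeff_cong[OF top_coeff_diff[OF top_coeff_mult[OF top_L top_N] 
       top_coeff_less[OF top_coeff_mult[OF M M], of 21]]]) (simp_all add: algebra_simps eval_nat_numeral)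
qed

text \<open>E N and F M end at degree 17, so G L alone decides. Its leading coefficient 2^14 e0^7
  involves only e0 > 0, hence the degree of \<open>PH\<close> never drops.\<close>

lemma top_PH: "top_coeff 18 PH (16384 * e0 ^ 7)"
proof -
  obtain c where M: "top_coeff 10 M c" using top_M ..
  show ?thesis unfolding PH_def
    by (rule top_coeff_cong[OF top_coeff_add[OF top_coeff_diff[OF
       top_coeff_less[OF top_coeff_mult[OF top_E top_N], of 18]
       top_coeff_less[OF top_coeff_smult[OF top_coeff_mult[OF top_F M]], of 18]]
       top_coeff_mult[OF top_G top_L]]]) (simp_all add: algebra_simps eval_nat_numeral)
qed

end

section \<open>Simple roots and resultants\<close>

text \<open>For odd degree, p(x) and - p(-x) have the same leading coefficient. If it is positive,
  both are positive far to the right, which is a sign change of p.\<close>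

lemma odd_degree_root:
  fixes p :: "real poly"
  assumes "odd (degree p)"
  shows "\<exists>x. poly p x = 0"
proof -
  have *: "\<exists>x. poly p x = 0" if od: "odd (degree p)" and pos: "lead_coeff p > 0" for p :: "real poly"
  proof -
    obtain b where b: "\<And>x. x \<ge> b \<Longrightarrow> poly p x \<ge> lead_coeff p"
      using poly_pinfty_gt_lc[of p] pos by blast
    define q where "q = - (p \<circ>\<^sub>p [:0, -1:])"
    have "lead_coeff (p \<circ>\<^sub>p [:0, -1:]) = - lead_coeff p"
      using od lead_coeff_comp[of "[:0, -1::real:]" p] by simp
    then have "lead_coeff q > 0" using pos by (simp add: q_def)
    then obtain c where c: "\<And>x. x \<ge> c \<Longrightarrow> poly q x \<ge> lead_coeff q"
      using poly_pinfty_gt_lc by blast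
    define y where "y = max 1 (max b c)"
    have "poly p y > 0" using order_less_le_trans[OF pos b[of y]] by (simp add: y_def)
    moreover have "poly q y > 0" using order_less_le_trans[OF \<open>lead_coeff q > 0\<close> c[of y]] by (simp add: y_def)
    then have "poly p (- y) < 0" by (simp add: q_def poly_pcompose)
    moreover have "- y < y" by (simp add: y_def)
    ultimately show ?thesis using poly_IVT_pos[of "- y" y p] by blast
  qed
  have "p \<noteq> 0" using assms by auto
  then consider "lead_coeff p > 0" | "lead_coeff (- p) > 0"
    using leading_coeff_neq_0[of p] by fastforce
  then show ?thesis
    using *[of p] *[of "- p"] assms by cases auto
qed

text \<open>Splitting off x - a lowers the degree by one and, the root being simple, also the number
  of roots by exactly one. A real polynomial without roots has even degree, which starts the
  induction.\<close>

lemma card_simple_roots: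
  fixes p :: "real poly"
  assumes "p \<noteq> 0" and "\<And>x. poly p x = 0 \<Longrightarrow> poly (pderiv p) x \<noteq> 0"
  shows "card {x. poly p x = 0} \<le> degree p \<and> even (degree p - card {x. poly p x = 0})"
  using assms
proof (induction "degree p" arbitrary: p rule: less_induct)
  case less
  show ?case
  proof (cases "\<exists>x. poly p x = 0")
    case False
    then have "{x. poly p x = 0} = {}" by auto
    then show ?thesis using odd_degree_root[of p] False by auto
  next
    case True
    then obtain a where a: "poly p a = 0" by auto
    then obtain q where q: "p = [:- a, 1:] * q" by (auto simp: poly_eq_0_iff_dvd)
    have q0: "q \<noteq> 0" using q less.prems(1) by auto
    have d: "pderiv p = [:- a, 1:] * pderiv q + q"
      unfolding q by (subst pderiv_mult) (simp add: pderiv_pCons)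
    have qa: "poly q a \<noteq> 0" using less.prems(2)[OF a] by (simp add: d)
    have deg: "degree p = Suc (degree q)"
      unfolding q using q0 by (subst degree_mult_eq) auto
    have "poly (pderiv q) x \<noteq> 0" if "poly q x = 0" for x
      using less.prems(2)[of x] that qa unfolding d by (auto simp: q)
    then have IH: "card {x. poly q x = 0} \<le> degree q \<and> even (degree q - card {x. poly q x = 0})"
      using less.hyps[of q] q0 deg by auto
    have "{x. poly p x = 0} = insert a {x. poly q x = 0}" by (auto simp: q)
    then have "card {x. poly p x = 0} = Suc (card {x. poly q x = 0})"
      using qa poly_roots_finite[OF q0] by simp
    then show ?thesis using IH by (simp only: deg Suc_le_mono diff_Suc_Suc)
  qed
qed

lemma resultant_pderiv_simple_roots:
  fixes p :: "real poly"
  assumes "resultant p (pderiv p) \<noteq> 0" "poly p x = 0" "p \<noteq> 0"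
  shows "poly (pderiv p) x \<noteq> 0"
proof
  assume x: "poly (pderiv p) x = 0"
  have "degree (gcd p (pderiv p)) = 0"
    using assms(1) resultant_0_gcd[of p "pderiv p"] by blast
  then obtain c where c: "gcd p (pderiv p) = [:c:]" using degree_eq_zeroE by blast
  have "[:- x, 1:] dvd gcd p (pderiv p)"
    using x assms(2) by (simp add: poly_eq_0_iff_dvd)
  moreover have "gcd p (pderiv p) \<noteq> 0" using assms(3) by simp
  ultimately have "degree [:- x, 1:] \<le> degree (gcd p (pderiv p))" by (rule dvd_imp_degree_le)
  then show False by (simp add: c)
qed

text \<open>A nonconstant common factor would stay nonconstant modulo \<open>p\<close>, where it would divide 1.\<close>

lemma resultant_neq_0_mod_prime:
  fixes P Q s r T :: "int poly" and p :: int
  assumes p: "prime p" and lc: "\<not> p dvd lead_coeff P"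
    and bezout: "P * s + Q * r = 1 + Polynomial.smult p T"
  shows "resultant P Q \<noteq> 0"
proof
  assume "resultant P Q = 0"
  define g where "g = gcd P Q"
  have dg: "degree g > 0" using \<open>resultant P Q = 0\<close> by (simp add: resultant_0_gcd g_def)
  have "g dvd P" "g dvd Q" by (simp_all add: g_def)
  then have "g dvd 1 + Polynomial.smult p T" unfolding bezout[symmetric] by simp
  then obtain h where h: "1 + Polynomial.smult p T = g * h" ..
  obtain k where k: "P = g * k" using \<open>g dvd P\<close> ..
  have lg: "\<not> p dvd lead_coeff g" using lc by (auto simp: k lead_coeff_mult)
  \<comment> \<open>The coefficients of h that survive modulo p; the largest such index m is the
    degree of h modulo p.\<close>
  define S where "S = {i. \<not> p dvd coeff h i}"
  have "\<not> p dvd coeff (g * h) 0"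
    using not_prime_unit[of p] p by (auto simp: h[symmetric] dvd_add_left_iff)
  then have "\<not> p dvd coeff g 0 * coeff h 0" by (simp add: coeff_mult)
  then have "\<not> p dvd coeff h 0" using dvd_mult by blast
  then have "0 \<in> S" by (simp add: S_def)
  moreover have fin: "finite S"
    by (rule finite_subset[of _ "{..degree h}"]) (auto simp: S_def coeff_eq_0 intro: leI)
  ultimately have mS: "Max S \<in> S" by (intro Max_in) auto
  define m where "m = Max S"
  have m: "\<not> p dvd coeff h m" using mS by (simp add: m_def S_def)
  have gt: "p dvd coeff h i" if "i > m" for i
    using that Max_ge[OF fin, of i] by (force simp: m_def S_def)
  \<comment> \<open>Modulo p, this coefficient is the product of the leading coefficients of g and
    h, hence nonzero; but g h is congruent to 1 and the index is positive.\<close>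
  have "coeff (g * h) (degree g + m) = (\<Sum>i\<le>degree g + m. coeff g i * coeff h (degree g + m - i))"
    by (rule coeff_mult)
  also have "\<dots> = coeff g (degree g) * coeff h m + (\<Sum>i\<in>{..degree g + m} - {degree g}. coeff g i * coeff h (degree g + m - i))"
    by (subst sum.remove[of _ "degree g"]) auto
  finally have "coeff g (degree g) * coeff h m = coeff (g * h) (degree g + m) - 
      (\<Sum>i\<in>{..degree g + m} - {degree g}. coeff g i * coeff h (degree g + m - i))" by simp
  moreover have "p dvd coeff (g * h) (degree g + m)"
    using dg by (simp add: h[symmetric])
  moreover have "p dvd (\<Sum>i\<in>{..degree g + m} - {degree g}. coeff g i * coeff h (degree g + m - i))"
  proof (rule dvd_sum)
    fix i assume "i \<in> {..degree g + m} - {degree g}"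
    then consider "i < degree g" | "i > degree g" by fastforce
    then show "p dvd coeff g i * coeff h (degree g + m - i)"
    proof cases
      case 1 then show ?thesis using gt[of "degree g + m - i"] by auto
    next
      case 2 then show ?thesis by (simp add: coeff_eq_0)
    qed
  qed
  ultimately have "p dvd coeff g (degree g) * coeff h m" by (simp only: dvd_diff)
  then show False using prime_dvd_multD[OF p] lg m by blast
qed

section \<open>Polynomial families of polynomials\<close>

text \<open>All coefficients are listed instead of those up to a degree, because the degree of
  \<open>P x\<close> may jump with the jet.\<close>

definition poly_family :: "(jet_space \<Rightarrow> real poly) \<Rightarrow> bool" where
  "poly_family P \<longleftrightarrow> (\<forall>n. real_polynomial_function (\<lambda>x. coeff (P x) n))"

lemmas real_polynomial_function_intros = real_polynomial_function.intros(2-4)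

lemma poly_family_add: "poly_family P \<Longrightarrow> poly_family Q \<Longrightarrow> poly_family (\<lambda>x. P x + Q x)"
  by (auto simp: poly_family_def intro: real_polynomial_function_intros)

lemma poly_family_uminus: "poly_family P \<Longrightarrow> poly_family (\<lambda>x. - P x)"
  by (auto simp: poly_family_def intro: real_polynomial_function_minus)

lemma poly_family_diff: "poly_family P \<Longrightarrow> poly_family Q \<Longrightarrow> poly_family (\<lambda>x. P x - Q x)"
  by (auto simp: poly_family_def intro: real_polynomial_function_diff)

lemma poly_family_mult: "poly_family P \<Longrightarrow> poly_family Q \<Longrightarrow> poly_family (\<lambda>x. P x * Q x)"
  by (auto simp: poly_family_def coeff_mult intro!: real_polynomial_function_sum real_polynomial_function_intros)

lemma poly_family_smult:
  "real_polynomial_function c \<Longrightarrow> poly_family P \<Longrightarrow> poly_family (\<lambda>x. Polynomial.smult (c x) (P x))"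
  by (auto simp: poly_family_def intro!: real_polynomial_function_intros)

lemma poly_family_pCons:
  "real_polynomial_function c \<Longrightarrow> poly_family P \<Longrightarrow> poly_family (\<lambda>x. pCons (c x) (P x))"
  unfolding poly_family_def
proof
  fix n assume "real_polynomial_function c" "\<forall>n. real_polynomial_function (\<lambda>x. coeff (P x) n)"
  then show "real_polynomial_function (\<lambda>x. coeff (pCons (c x) (P x)) n)" by (cases n) auto
qed

lemma poly_family_0: "poly_family (\<lambda>x. 0)"
  by (auto simp: poly_family_def intro: real_polynomial_function_intros)

lemma poly_family_pderiv: "poly_family P \<Longrightarrow> poly_family (\<lambda>x. pderiv (P x))"
  by (auto simp: poly_family_def coeff_pderiv intro!: real_polynomial_function_intros simp del: of_nat_Suc)

lemma real_polynomial_function_prod: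
  "finite I \<Longrightarrow> (\<And>i. i \<in> I \<Longrightarrow> real_polynomial_function (f i)) \<Longrightarrow>
     real_polynomial_function (\<lambda>x. \<Prod>i\<in>I. f i x)"
  by (induction I rule: finite_induct) (auto intro: real_polynomial_function_intros)

text \<open>With the formal degrees m and n fixed, the Sylvester matrix has constant size, and the
  Leibniz formula is a polynomial in its entries.\<close>

lemma real_polynomial_function_resultant_sub:
  assumes "poly_family P" "poly_family Q"
  shows "real_polynomial_function (\<lambda>x. resultant_sub m n (P x) (Q x))"
proof -
  have e: "real_polynomial_function (\<lambda>x. sylvester_mat_sub m n (P x) (Q x) $$ (i, j))"
    if "i < m + n" "j < m + n" for i j
  proof -
    \<comment> \<open>A and B depend on the position only, so a given entry is the same coefficient,
      or constantly 0, for all jets.\<close>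
    define A B where "A = (i < n)" and "B = (if A then i \<le> j \<and> j - i \<le> m else i - n \<le> j \<and> j \<le> i)"
    have "sylvester_mat_sub m n (P x) (Q x) $$ (i, j) =
        (if A then if B then coeff (P x) (m + i - j) else 0 else if B then coeff (Q x) (i - j) else 0)" for x
      using that by (simp add: sylvester_mat_sub_index A_def B_def)
    then show ?thesis
      using assms by (cases A; cases B) (auto simp: poly_family_def intro: real_polynomial_function_intros)
  qed
  have "(\<lambda>x. resultant_sub m n (P x) (Q x)) = (\<lambda>x. \<Sum>q\<in>{q. q permutes {0..<m+n}}.
      signof q * (\<Prod>i = 0..<m+n. sylvester_mat_sub m n (P x) (Q x) $$ (i, q i)))"
    by (simp add: resultant_sub_def Determinant.det_def)
  moreover have "real_polynomial_function \<dots>"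
  proof (intro real_polynomial_function_sum real_polynomial_function_intros
        real_polynomial_function_prod e finite_permutations finite_atLeastLessThan)
    fix q i assume *: "q \<in> {q. q permutes {0..<m + n}}" "i \<in> {0..<m + n}"
    show "i < m + n" using * by simp
    have "q i \<in> {0..<m + n}" using * permutes_in_image[of q "{0..<m + n}" i] by simp
    then show "q i < m + n" by simp
  qed
  ultimately show ?thesis by simp
qed

section \<open>The generic jet\<close>

context umbrella_jet
begin

text \<open>The factor \<open>b0\<close> keeps the degree of \<open>PK\<close> from dropping; the resultants are taken at the generic degrees, so
  that \<open>generic_poly\<close> is a polynomial in the jet.\<close>

definition "generic_poly =
  b0 * resultant_sub 21 20 PK (pderiv PK) * resultant_sub 18 17 PH (pderiv PH)"

text \<open>The leading coefficients -2^19 e0^9 b0 and 2^14 e0^7 do not vanish. The generic degrees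
  are therefore the actual ones, and the formal resultants are true resultants of a polynomial and
  its derivative.\<close>

lemma generic_poly_simple_roots:
  assumes "e0 > 0" "generic_poly \<noteq> 0"
  shows "degree PK = 21" "\<And>t. poly PK t = 0 \<Longrightarrow> poly (pderiv PK) t \<noteq> 0"
    and "degree PH = 18" "\<And>t. poly PH t = 0 \<Longrightarrow> poly (pderiv PH) t \<noteq> 0"
proof -
  have "b0 \<noteq> 0" using assms by (auto simp: generic_poly_def)
  then have "coeff PK 21 \<noteq> 0" "coeff PH 18 \<noteq> 0"
    using top_PK top_PH assms(1) unfolding top_coeff_def by simp_all
  then show K: "degree PK = 21" and H: "degree PH = 18"
    using top_PK top_PH le_degree[of PK 21] le_degree[of PH 18] unfolding top_coeff_def by linarith+
  have "resultant PK (pderiv PK) \<noteq> 0" "resultant PH (pderiv PH) \<noteq> 0"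
    using assms(2) K H by (auto simp: generic_poly_def resultant_sub degree_pderiv)
  moreover have "PK \<noteq> 0" "PH \<noteq> 0" using K H by auto
  ultimately show "\<And>t. poly PK t = 0 \<Longrightarrow> poly (pderiv PK) t \<noteq> 0"
    "\<And>t. poly PH t = 0 \<Longrightarrow> poly (pderiv PH) t \<noteq> 0"
    using resultant_pderiv_simple_roots by blast+
qed

end

section \<open>Polynomial dependence of all attached polynomials on the jet\<close>

lemma real_polynomial_function_jet_coord:
  "real_polynomial_function umbrella_jet.a0" "real_polynomial_function umbrella_jet.a1"
  "real_polynomial_function umbrella_jet.a2" "real_polynomial_function umbrella_jet.b0"
  "real_polynomial_function umbrella_jet.b1" "real_polynomial_function umbrella_jet.b2"
  "real_polynomial_function umbrella_jet.c0" "real_polynomial_function umbrella_jet.c1"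
  "real_polynomial_function umbrella_jet.d0" "real_polynomial_function umbrella_jet.d1"
  "real_polynomial_function umbrella_jet.d2" "real_polynomial_function umbrella_jet.e0"
  "real_polynomial_function umbrella_jet.e1" "real_polynomial_function umbrella_jet.e2"
  unfolding umbrella_jet.a0_def[abs_def] umbrella_jet.a1_def[abs_def] umbrella_jet.a2_def[abs_def]
    umbrella_jet.b0_def[abs_def] umbrella_jet.b1_def[abs_def] umbrella_jet.b2_def[abs_def]
    umbrella_jet.c0_def[abs_def] umbrella_jet.c1_def[abs_def] umbrella_jet.d0_def[abs_def]
    umbrella_jet.d1_def[abs_def] umbrella_jet.d2_def[abs_def] umbrella_jet.e0_def[abs_def]
    umbrella_jet.e1_def[abs_def] umbrella_jet.e2_def[abs_def]
  by (rule real_polynomial_function.intros(1), rule bounded_linear_compose[OF bounded_linear_vec_nth],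
      intro bounded_linear_fst bounded_linear_snd bounded_linear_compose[OF bounded_linear_fst]
        bounded_linear_compose[OF bounded_linear_snd])+

lemmas poly_family_intros =
  poly_family_add poly_family_diff poly_family_uminus poly_family_mult poly_family_smult
  poly_family_pCons poly_family_0 poly_family_pderiv
  real_polynomial_function_intros real_polynomial_function_diff real_polynomial_function_minus
  real_polynomial_function_jet_coord

lemma poly_family_w: "poly_family umbrella_jet.w"
  unfolding umbrella_jet.w_def[abs_def]
  by (intro poly_family_intros)

lemma poly_family_g1: "poly_family umbrella_jet.g1"
  unfolding umbrella_jet.g1_def[abs_def]
  by (intro poly_family_intros)

lemma poly_family_g2: "poly_family umbrella_jet.g2"
  unfolding umbrella_jet.g2_def[abs_def]
  by (intro poly_family_intros)

lemma poly_family_x2: "poly_family umbrella_jet.x2"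
  unfolding umbrella_jet.x2_def[abs_def]
  by (intro poly_family_intros)

lemma poly_family_k0: "poly_family umbrella_jet.k0"
  unfolding umbrella_jet.k0_def[abs_def]
  by (intro poly_family_intros)

lemma poly_family_k1: "poly_family umbrella_jet.k1"
  unfolding umbrella_jet.k1_def[abs_def]
  by (intro poly_family_intros)

lemma poly_family_ek2: "poly_family umbrella_jet.ek2"
  unfolding umbrella_jet.ek2_def[abs_def]
  by (intro poly_family_intros poly_family_g1 poly_family_k0)

lemma poly_family_k0': "poly_family umbrella_jet.k0'"
  unfolding umbrella_jet.k0'_def[abs_def]
  by (intro poly_family_intros poly_family_k0)

lemma poly_family_k0'': "poly_family umbrella_jet.k0''"
  unfolding umbrella_jet.k0''_def[abs_def]
  by (intro poly_family_intros poly_family_k0')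

lemma poly_family_v: "poly_family umbrella_jet.v"
  unfolding umbrella_jet.v_def[abs_def]
  by (intro poly_family_intros poly_family_w poly_family_k0)

lemma poly_family_eps: "poly_family umbrella_jet.eps"
  unfolding umbrella_jet.eps_def[abs_def]
  by (intro poly_family_intros poly_family_k0)

lemma poly_family_del: "poly_family umbrella_jet.del"
  unfolding umbrella_jet.del_def[abs_def]
  by (intro poly_family_intros poly_family_w poly_family_k0 poly_family_k0')

lemma poly_family_bet: "poly_family umbrella_jet.bet"
  unfolding umbrella_jet.bet_def[abs_def]
  by (intro poly_family_intros poly_family_w poly_family_g1 poly_family_k0 poly_family_k1)

lemma poly_family_gam: "poly_family umbrella_jet.gam"
  unfolding umbrella_jet.gam_def[abs_def]
  by (intro poly_family_intros poly_family_g1 poly_family_k0)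

lemma poly_family_tau: "poly_family umbrella_jet.tau"
  unfolding umbrella_jet.tau_def[abs_def]
  by (intro poly_family_intros poly_family_g1 poly_family_k0 poly_family_k1 poly_family_k0')

lemma poly_family_zeta: "poly_family umbrella_jet.zeta"
  unfolding umbrella_jet.zeta_def[abs_def]
  by (intro poly_family_intros poly_family_eps poly_family_del)

lemma poly_family_phi: "poly_family umbrella_jet.phi"
  unfolding umbrella_jet.phi_def[abs_def]
  by (intro poly_family_intros poly_family_eps poly_family_del poly_family_zeta)

lemma poly_family_E: "poly_family umbrella_jet.E"
  unfolding umbrella_jet.E_def[abs_def]
  by (intro poly_family_intros poly_family_w poly_family_g1 poly_family_k0 poly_family_k1 poly_family_v)

lemma poly_family_F: "poly_family umbrella_jet.F"
  unfolding umbrella_jet.F_def[abs_def]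
  by (intro poly_family_intros poly_family_w poly_family_g1 poly_family_k0 poly_family_k1 poly_family_k0')

lemma poly_family_G: "poly_family umbrella_jet.G"
  unfolding umbrella_jet.G_def[abs_def]
  by (intro poly_family_intros poly_family_w poly_family_k0 poly_family_k0')

lemma poly_family_N1: "poly_family umbrella_jet.N1"
  unfolding umbrella_jet.N1_def[abs_def]
  by (intro poly_family_intros poly_family_w poly_family_k0 poly_family_k0' poly_family_k0'')

lemma poly_family_N: "poly_family umbrella_jet.N"
  unfolding umbrella_jet.N_def[abs_def]
  by (intro poly_family_intros poly_family_v poly_family_N1)

lemma poly_family_Y: "poly_family umbrella_jet.Y"
  unfolding umbrella_jet.Y_def[abs_def]
  by (intro poly_family_intros poly_family_k0 poly_family_eps poly_family_del poly_family_bet poly_family_gam poly_family_tau poly_family_F)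

lemma poly_family_M: "poly_family umbrella_jet.M"
  unfolding umbrella_jet.M_def[abs_def]
  by (intro poly_family_intros poly_family_k0 poly_family_v poly_family_del poly_family_tau poly_family_Y)

lemma poly_family_L: "poly_family umbrella_jet.L"
  unfolding umbrella_jet.L_def[abs_def]
  by (intro poly_family_intros poly_family_w poly_family_g1 poly_family_g2 poly_family_x2 poly_family_k0 poly_family_k1 poly_family_ek2 poly_family_k0' poly_family_v poly_family_eps poly_family_tau poly_family_zeta poly_family_phi)

lemma poly_family_PK: "poly_family umbrella_jet.PK"
  unfolding umbrella_jet.PK_def[abs_def]
  by (intro poly_family_intros poly_family_N poly_family_M poly_family_L)

lemma poly_family_PH: "poly_family umbrella_jet.PH"
  unfolding umbrella_jet.PH_def[abs_def]
  by (intro poly_family_intros poly_family_E poly_family_F poly_family_G poly_family_N poly_family_M poly_family_L)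

lemma real_polynomial_function_generic_poly:
  "real_polynomial_function umbrella_jet.generic_poly"
  unfolding umbrella_jet.generic_poly_def[abs_def]
  by (intro real_polynomial_function_intros real_polynomial_function_resultant_sub
      poly_family_PK poly_family_PH poly_family_pderiv real_polynomial_function_jet_coord)

text \<open>A jet for which \<open>PK\<close> and \<open>PH\<close> stay squarefree and keep their degrees modulo 5, found by search.\<close>

definition sample_jet :: jet_space where
  "sample_jet = (0, vector [1, 0, 0], 0, 0, vector [1, 1, 0])"

section \<open>The attached polynomials and their resultants at the sample jet\<close>

lemma sample_jet_coord:
  "umbrella_jet.a0 sample_jet = 0" "umbrella_jet.a1 sample_jet = 0" "umbrella_jet.a2 sample_jet = 0"
  "umbrella_jet.b0 sample_jet = 1" "umbrella_jet.b1 sample_jet = 0" "umbrella_jet.b2 sample_jet = 0"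
  "umbrella_jet.c0 sample_jet = 0" "umbrella_jet.c1 sample_jet = 0"
  "umbrella_jet.d0 sample_jet = 0" "umbrella_jet.d1 sample_jet = 0" "umbrella_jet.d2 sample_jet = 0"
  "umbrella_jet.e0 sample_jet = 1" "umbrella_jet.e1 sample_jet = 1" "umbrella_jet.e2 sample_jet = 0"
  by (simp_all add: sample_jet_def umbrella_jet.a0_def umbrella_jet.a1_def umbrella_jet.a2_def
      umbrella_jet.b0_def umbrella_jet.b1_def umbrella_jet.b2_def umbrella_jet.c0_def
      umbrella_jet.c1_def umbrella_jet.d0_def umbrella_jet.d1_def umbrella_jet.d2_def
      umbrella_jet.e0_def umbrella_jet.e1_def umbrella_jet.e2_def)

lemma sample_w: "umbrella_jet.w sample_jet = [:1, 0, 4:]"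
  by (simp add: umbrella_jet.w_def sample_jet_coord 
      pderiv_pCons one_pCons del: pCons_one)

lemma sample_g1: "umbrella_jet.g1 sample_jet = [:1:]"
  by (simp add: umbrella_jet.g1_def sample_jet_coord 
      pderiv_pCons one_pCons del: pCons_one)

lemma sample_g2: "umbrella_jet.g2 sample_jet = 0"
  by (simp add: umbrella_jet.g2_def sample_jet_coord 
      pderiv_pCons one_pCons del: pCons_one)

lemma sample_x2: "umbrella_jet.x2 sample_jet = [:0, 0, -4:]"
  by (simp add: umbrella_jet.x2_def sample_jet_coord 
      pderiv_pCons one_pCons del: pCons_one)

lemma sample_k0: "umbrella_jet.k0 sample_jet = [:0, 4, 2:]"
  by (simp add: umbrella_jet.k0_def sample_jet_coord 
      pderiv_pCons one_pCons del: pCons_one)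

lemma sample_k1: "umbrella_jet.k1 sample_jet = [:0, 0, 10:]"
  by (simp add: umbrella_jet.k1_def sample_jet_coord 
      pderiv_pCons one_pCons del: pCons_one)

lemma sample_ek2: "umbrella_jet.ek2 sample_jet = [:0, -16, -38, -32, -8, -16, -8:]"
  by (simp add: umbrella_jet.ek2_def sample_jet_coord sample_g1 sample_k0 
      pderiv_pCons one_pCons del: pCons_one)

lemma sample_k0': "umbrella_jet.k0' sample_jet = [:4, 4:]"
  by (simp add: umbrella_jet.k0'_def sample_jet_coord sample_k0 
      pderiv_pCons one_pCons del: pCons_one)

lemma sample_k0'': "umbrella_jet.k0'' sample_jet = [:4:]"
  by (simp add: umbrella_jet.k0''_def sample_jet_coord sample_k0' 
      pderiv_pCons one_pCons del: pCons_one)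

lemma sample_v: "umbrella_jet.v sample_jet = [:1, 0, -12, -16, -4:]"
  by (simp add: umbrella_jet.v_def sample_jet_coord sample_w sample_k0 
      pderiv_pCons one_pCons del: pCons_one)

lemma sample_eps: "umbrella_jet.eps sample_jet = [:0, 8, 4:]"
  by (simp add: umbrella_jet.eps_def sample_jet_coord sample_k0 
      pderiv_pCons one_pCons del: pCons_one)

lemma sample_del: "umbrella_jet.del sample_jet = [:4, 4, 0, 8:]"
  by (simp add: umbrella_jet.del_def sample_jet_coord sample_w sample_k0 sample_k0' 
      pderiv_pCons one_pCons del: pCons_one)

lemma sample_bet: "umbrella_jet.bet sample_jet = [:0, -4, 8, 0, 40:]"
  by (simp add: umbrella_jet.bet_def sample_jet_coord sample_w sample_g1 sample_k0 sample_k1 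
      pderiv_pCons one_pCons del: pCons_one)

lemma sample_gam: "umbrella_jet.gam sample_jet = [:0, 0, -8, -4:]"
  by (simp add: umbrella_jet.gam_def sample_jet_coord sample_g1 sample_k0 
      pderiv_pCons one_pCons del: pCons_one)

lemma sample_tau: "umbrella_jet.tau sample_jet = [:0, 0, 12:]"
  by (simp add: umbrella_jet.tau_def sample_jet_coord sample_g1 sample_k0 sample_k1 sample_k0' 
      pderiv_pCons one_pCons del: pCons_one)

lemma sample_zeta: "umbrella_jet.zeta sample_jet = [:0, 16, 12, 0, 16:]"
  by (simp add: umbrella_jet.zeta_def sample_jet_coord sample_eps sample_del 
      pderiv_pCons one_pCons del: pCons_one)

lemma sample_phi: "umbrella_jet.phi sample_jet = [:-4, -8, 12, 0, -12, 0, -16:]"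
  by (simp add: umbrella_jet.phi_def sample_jet_coord sample_eps sample_del sample_zeta 
      pderiv_pCons one_pCons del: pCons_one)

lemma sample_E: "umbrella_jet.E sample_jet = [:1, 0, -8, -96, 200, 384, 752, 128, 16:]"
  by (simp add: umbrella_jet.E_def sample_jet_coord sample_w sample_g1 sample_k0 sample_k1 sample_v 
      pderiv_pCons one_pCons del: pCons_one)

lemma sample_F: "umbrella_jet.F sample_jet = [:0, -16, 16, 32, 0, 80:]"
  by (simp add: umbrella_jet.F_def sample_jet_coord sample_w sample_g1 sample_k0 sample_k1 sample_k0' 
      pderiv_pCons one_pCons del: pCons_one)

lemma sample_G: "umbrella_jet.G sample_jet = [:16, 32, 16, 0, 16:]"
  by (simp add: umbrella_jet.G_def sample_jet_coord sample_w sample_k0 sample_k0' 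
      pderiv_pCons one_pCons del: pCons_one)

lemma sample_N1: "umbrella_jet.N1 sample_jet = [:-32, -48, -24, 64:]"
  by (simp add: umbrella_jet.N1_def sample_jet_coord sample_w sample_k0 sample_k0' sample_k0'' 
      pderiv_pCons one_pCons del: pCons_one)

lemma sample_N: "umbrella_jet.N sample_jet = [:-64, -96, 720, 2304, 2368, -384, -1856, -512:]"
  by (simp add: umbrella_jet.N_def sample_jet_coord sample_v sample_N1 
      pderiv_pCons one_pCons del: pCons_one)

lemma sample_Y: "umbrella_jet.Y sample_jet = [:0, 64, 192, 48, 256:]"
  by (simp add: umbrella_jet.Y_def sample_jet_coord sample_k0 sample_eps sample_del sample_bet sample_gam sample_tau sample_F 
      pderiv_pCons one_pCons del: pCons_one)

lemma sample_M: "umbrella_jet.M sample_jet = [:0, 64, 192, -720, 0, 2240, -768, 2624, 5120, 1536:]"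
  by (simp add: umbrella_jet.M_def sample_jet_coord sample_k0 sample_v sample_del sample_tau sample_Y 
      pderiv_pCons one_pCons del: pCons_one)

lemma sample_L: "umbrella_jet.L sample_jet = [:-8, -16, -232, -608, 1464, 4928, 45888, 116224, 199584, 169984, 85504, 46080, 25600,
      8192, 1024:]"
  by (simp add: umbrella_jet.L_def sample_jet_coord sample_w sample_g1 sample_g2 sample_x2 sample_k0 sample_k1 sample_ek2 sample_k0' sample_v sample_eps sample_tau sample_zeta sample_phi 
      pderiv_pCons one_pCons del: pCons_one)

lemma sample_PK: "umbrella_jet.PK sample_jet = [:512, 1792, 6528, 6656, -202880, -1186560, -5090176, -7001088, 27786240, 168953856,
      490652672, 828997632, 777304064, 294965248, -174888960, -301121536, -217464832,
      -133103616, -74186752, -28704768, -6094848, -524288:]"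
  by (simp add: umbrella_jet.PK_def sample_jet_coord sample_N sample_M sample_L 
      pderiv_pCons one_pCons del: pCons_one)

lemma sample_PH: "umbrella_jet.PH sample_jet = [:-192, -608, -1072, -4096, -40128, -5248, 836160, 3702272, 9688704, 14011904, 11711744,
      7034880, 4323840, 2959360, 1715200, 892928, 425984, 131072, 16384:]"
  by (simp add: umbrella_jet.PH_def sample_jet_coord sample_E sample_F sample_G sample_N sample_M sample_L 
      pderiv_pCons one_pCons del: pCons_one)

lemma sample_resultant_PK:
  "resultant_sub 21 20 (umbrella_jet.PK sample_jet) (pderiv (umbrella_jet.PK sample_jet)) \<noteq> 0"
proof -
  define P :: "int poly" where
    "P = [:512, 1792, 6528, 6656, -202880, -1186560, -5090176, -7001088, 27786240, 168953856,
      490652672, 828997632, 777304064, 294965248, -174888960, -301121536, -217464832,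
      -133103616, -74186752, -28704768, -6094848, -524288:]"
  have P: "umbrella_jet.PK sample_jet = of_int_poly P" by (simp add: sample_PK P_def)
  have deg: "degree P = 21" by (simp add: P_def)
  \<comment> \<open>A Bezout identity over the field with five elements, its cofactors lifted to
    residues between -2 and 2. The right-hand side records the integral error divided by 5. The
    leading coefficient -2^19 is prime to 5.\<close>
  have bezout: "P * [:-1, 0, -2, -1, 0, -2, -2, -1, 2, -1, -2, -1, -2, -1, 1, 0, 1, -2, -1, -2:]
      + pderiv P * [:-1, -1, -2, 1, -1, -2, -2, 2, -2, 1, 1, 1, 0, -2, 2, 1, 2, -1, 2, -2, 2:]
      = 1 + Polynomial.smult 5 [:-461, -3328, -8832, 151296, 1380736, 7853184, 19207552, -21564800, -336861696,
      -1405225216, -3452102912, -5598884864, -6062676992, -4368130176, -3089578752, -4111864192,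
      -4789143936, -2033589760, 2079657984, 4677790592, 5762537856, 5321174016, 2138563072,
      -1283372288, -313669760, 4186078464, 6649776128, 4401041408, 490818560, -1776052224,
      -1579057152, -400347136, 48175104, -613216256, -1098694656, -825262080, -490799104,
      -324796416, -160890880, -41811968, -4194304:]"
    by (simp add: P_def pderiv_pCons one_pCons del: pCons_one)
  have "\<not> 5 dvd lead_coeff P" unfolding deg by (simp add: P_def eval_nat_numeral)
  from resultant_neq_0_mod_prime[OF _ this bezout]
  have "resultant P (pderiv P) \<noteq> 0" by simp
  then have "of_int (resultant P (pderiv P)) \<noteq> (0::real)" by simp
  then have "resultant (of_int_poly P :: real poly) (of_int_poly (pderiv P)) \<noteq> 0"
    by (subst of_int_hom.resultant_hom)
  then show ?thesis
    by (simp add: P resultant_sub deg degree_pderiv of_int_hom.map_poly_pderiv)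
qed

lemma sample_resultant_PH:
  "resultant_sub 18 17 (umbrella_jet.PH sample_jet) (pderiv (umbrella_jet.PH sample_jet)) \<noteq> 0"
proof -
  define P :: "int poly" where
    "P = [:-192, -608, -1072, -4096, -40128, -5248, 836160, 3702272, 9688704, 14011904, 11711744,
      7034880, 4323840, 2959360, 1715200, 892928, 425984, 131072, 16384:]"
  have P: "umbrella_jet.PH sample_jet = of_int_poly P" by (simp add: sample_PH P_def)
  have deg: "degree P = 18" by (simp add: P_def)
  \<comment> \<open>Again a Bezout identity modulo 5 with cofactors lifted to residues between -2
    and 2; here the leading coefficient is 2^14.\<close>
  have bezout: "P * [:-2, 2, -2, 1, -1, 1, 0, 0, -2, 0, 0, 2, -2, 0, 2, -1, -1:]
      + pderiv P * [:1, 1, 0, -1, -2, -1, -2, -2, 1, 0, 2, 2, -1, 1, 2, 2, -1, 2:]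
      = 1 + Polynomial.smult 5 [:-45, -384, -2624, -33024, -21920, 989136, 5903024, 19606352, 37045408, 38479200,
      9717728, -39951936, -85660064, -116272416, -133309888, -120196864, -72225056, -12358160,
      41812784, 68318400, 71269696, 89290432, 121796288, 124089728, 100784512, 86881024,
      70899456, 46620160, 28169728, 18433024, 10245120, 4792320, 2293760, 802816, 114688:]"
    by (simp add: P_def pderiv_pCons one_pCons del: pCons_one)
  have "\<not> 5 dvd lead_coeff P" unfolding deg by (simp add: P_def eval_nat_numeral)
  from resultant_neq_0_mod_prime[OF _ this bezout]
  have "resultant P (pderiv P) \<noteq> 0" by simp
  then have "of_int (resultant P (pderiv P)) \<noteq> (0::real)" by simp
  then have "resultant (of_int_poly P :: real poly) (of_int_poly (pderiv P)) \<noteq> 0"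
    by (subst of_int_hom.resultant_hom)
  then show ?thesis
    by (simp add: P resultant_sub deg degree_pderiv of_int_hom.map_poly_pderiv)
qed

lemma generic_poly_sample_jet: "umbrella_jet.generic_poly sample_jet \<noteq> 0"
  using sample_resultant_PK sample_resultant_PH
  by (simp add: umbrella_jet.generic_poly_def sample_jet_coord)

section \<open>The principal curvature surface along the exceptional divisor\<close>

lemma real_vec3_eqI:
  fixes a b :: "real^3"
  shows "a $ 1 = b $ 1 \<Longrightarrow> a $ 2 = b $ 2 \<Longrightarrow> a $ 3 = b $ 3 \<Longrightarrow> a = b"
  by (simp add: Finite_Cartesian_Product.vec_eq_iff forall_3)

lemma inner_real3: "(a :: real^3) \<bullet> b = a $ 1 * b $ 1 + a $ 2 * b $ 2 + a $ 3 * b $ 3"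
  by (simp add: inner_vec_def sum_3)

lemma has_vector_derivative_real3:
  fixes F :: "real \<Rightarrow> real^3"
  assumes "((\<lambda>s. F s $ 1) has_real_derivative a) (at t)"
    and "((\<lambda>s. F s $ 2) has_real_derivative b) (at t)"
    and "((\<lambda>s. F s $ 3) has_real_derivative c) (at t)"
    and "D = vector [a, b, c]"
  shows "(F has_vector_derivative D) (at t)"
proof -
  have "((\<lambda>s. F s $ i) has_vector_derivative D $ i) (at t)" for i :: 3
    using exhaust_3[of i] assms(1-3) unfolding assms(4)
    by (auto simp: has_real_derivative_iff_has_vector_derivative)
  then show ?thesis
    by (simp add: has_vector_derivative_def has_derivative_componentwise_within[of F]
        Basis_vec_def inner_axis scaleR_vec_def)
qed

context umbrella_jet
begin

text \<open>Coordinates in an orthogonal frame containing the direction of the normal at the exceptional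
  divisor; its second and third vectors have square length \<open>w\<close>.\<close>

definition frame :: "real \<Rightarrow> real \<Rightarrow> real \<Rightarrow> real \<Rightarrow> real^3" where
  "frame t a b c = vector [a, - e0 * b + 2 * t * c, 2 * t * b + e0 * c]"

lemma poly_w: "poly w t = e0 * e0 + 4 * t * t"
  by (simp add: w_def)

lemma inner_frame:
  "frame t a b c \<bullet> frame t a' b' c' = a * a' + poly w t * (b * b' + c * c')"
  by (simp add: frame_def inner_real3 poly_w algebra_simps)

text \<open>The frame is negatively oriented: the first vector times the second is minus the third,
  and the second times the third is - w times the first. This accounts for the signs and for the
  position of w.\<close>

lemma cross_frame:
  "cross3 (frame t a b c) (frame t a' b' c') =
     frame t (- poly w t * (b * c' - c * b')) (a * c' - c * a') (- (a * b' - b * a'))"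
  by (intro real_vec3_eqI) (simp_all add: frame_def cross3_def poly_w algebra_simps)

lemma frame_cong: "a = a' \<Longrightarrow> b = b' \<Longrightarrow> c = c' \<Longrightarrow> frame t a b c = frame t a' b' c'"
  by simp

text \<open>The frame turns with t. The derivatives (0, 0, 2) and (0, 2, 0) of its second and third
  vectors have frame coordinates (4 t, 2 e0) / w and (- 2 e0, 4 t) / w in the plane they span, which
  gives the correction terms.\<close>

lemma has_vector_derivative_frame:
  assumes "e0 > 0"
    and "(a has_real_derivative a') (at t)" "(b has_real_derivative b') (at t)"
    and "(c has_real_derivative c') (at t)"
  shows "((\<lambda>t. frame t (a t) (b t) (c t)) has_vector_derivative
     frame t a' (b' + (4 * t * b t - 2 * e0 * c t) / poly w t)
       (c' + (2 * e0 * b t + 4 * t * c t) / poly w t)) (at t)"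
proof (rule has_vector_derivative_real3)
  have w: "poly w t \<noteq> 0" using assms(1) by (simp add: poly_w add_pos_nonneg less_imp_neq[symmetric])
  show "((\<lambda>s. frame s (a s) (b s) (c s) $ 1) has_real_derivative a') (at t)"
    using assms(2) by (simp add: frame_def)
  show "((\<lambda>s. frame s (a s) (b s) (c s) $ 2) has_real_derivative - e0 * b' + (2 * c t + 2 * t * c')) (at t)"
    unfolding frame_def vector_3
    by (auto intro!: derivative_eq_intros assms simp: algebra_simps)
  show "((\<lambda>s. frame s (a s) (b s) (c s) $ 3) has_real_derivative (2 * b t + 2 * t * b') + e0 * c') (at t)"
    unfolding frame_def vector_3
    by (auto intro!: derivative_eq_intros assms simp: algebra_simps)
  show "frame t a' (b' + (4 * t * b t - 2 * e0 * c t) / poly w t)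
       (c' + (2 * e0 * b t + 4 * t * c t) / poly w t) =
    vector [a', - e0 * b' + (2 * c t + 2 * t * c'), (2 * b t + 2 * t * b') + e0 * c']"
  proof -
    define A B where "A = (4 * t * b t - 2 * e0 * c t) / poly w t" and "B = (2 * e0 * b t + 4 * t * c t) / poly w t"
    have "- e0 * A + 2 * t * B = (2 * c t * poly w t) / poly w t" "2 * t * A + e0 * B = (2 * b t * poly w t) / poly w t"
      unfolding A_def B_def times_divide_eq_right add_divide_distrib[symmetric]
      by (simp_all add: poly_w algebra_simps)
    then have "- e0 * A + 2 * t * B = 2 * c t" "2 * t * A + e0 * B = 2 * b t" using w by simp_all
    then show ?thesis unfolding A_def[symmetric] B_def[symmetric]
      by (intro real_vec3_eqI) (simp_all add: frame_def algebra_simps)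
  qed
qed

text \<open>The surface is \<open>h(u, t) = A0 t + u A1 t + u\<^sup>2 A2 t + o(u\<^sup>2)\<close>.\<close>

definition "A0 t = frame t 0 (poly k0 t / poly w t) 0"
definition "A1 t = frame t (poly v t / poly w t) (poly bet t / (poly w t)\<^sup>2) (poly gam t / (poly w t)\<^sup>2)"
text \<open>The u^2 coefficient of f + q W with q = k / (W . W) = q0 + q1 u + q2 u^2 + ..., that is,
  the one of f plus q2 W0 + q1 W1 + q0 W2. Unlike \<open>A0\<close> and \<open>A1\<close> it is
  never differentiated in t, so Cartesian coordinates suffice.\<close>

definition "A2 t = vector [0, a0 + t\<^sup>2, b0 + t * e0]
  + (poly ek2 t / e0 / poly w t - 2 * e0 * poly g1 t * poly k1 t / (poly w t)\<^sup>2
     + poly k0 t * (4 * e0\<^sup>2 * (poly g1 t)\<^sup>2 / poly w t ^ 3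
       - ((poly k0 t)\<^sup>2 + (poly g1 t)\<^sup>2 + 2 * e0 * poly g2 t) / (poly w t)\<^sup>2)) *\<^sub>R vector [0, - e0, 2 * t]
  + (poly k1 t / poly w t - 2 * e0 * poly g1 t * poly k0 t / (poly w t)\<^sup>2) *\<^sub>R vector [- poly k0 t, - poly g1 t, 0]
  + (poly k0 t / poly w t) *\<^sub>R vector [poly x2 t, - poly g2 t, 0]"

text \<open>Derivatives in t, the turning of the frame included. The -12 t in the later formulas is
  -16 t from differentiating 1 / w^2 plus 4 t from the frame.\<close>

definition "A0' t = frame t 0 (poly del t / (poly w t)\<^sup>2) (poly eps t / (poly w t)\<^sup>2)"
definition "A0'' t = frame t 0
   ((poly w t * poly (pderiv del) t - 12 * t * poly del t - 2 * e0 * poly eps t) / poly w t ^ 3)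
   ((poly w t * poly (pderiv eps) t - 12 * t * poly eps t + 2 * e0 * poly del t) / poly w t ^ 3)"
definition "A1' t = frame t (- 2 * poly k0 t * poly del t / (poly w t)\<^sup>2)
   ((poly w t * poly (pderiv bet) t - 12 * t * poly bet t - 2 * e0 * poly gam t) / poly w t ^ 3)
   ((poly w t * poly (pderiv gam) t - 12 * t * poly gam t + 2 * e0 * poly bet t) / poly w t ^ 3)"

lemma poly_pderiv_w: "poly (pderiv w) t = 8 * t"
  by (simp add: w_def pderiv_pCons)

lemma poly_v: "poly v t = poly w t - poly k0 t * poly k0 t"
  and poly_eps: "poly eps t = 2 * e0 * poly k0 t"
  and poly_del: "poly del t = poly k0' t * poly w t - 4 * t * poly k0 t"
  and poly_bet: "poly bet t = poly k1 t * poly w t - e0 * poly k0 t * poly g1 t"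
  and poly_gam: "poly gam t = - 2 * t * poly k0 t * poly g1 t"
  and poly_tau: "poly tau t = e0 * poly k1 t + t * poly k0' t * poly g1 t - poly k0 t * poly g1 t"
  and poly_zeta: "poly zeta t = e0 * poly eps t + 2 * t * poly del t"
  and poly_phi: "poly phi t = (b0 + t * e0) * (2 * t * poly eps t - e0 * poly del t)
     - (a0 + t\<^sup>2) * poly zeta t"
  by (simp_all add: v_def eps_def del_def bet_def gam_def tau_def zeta_def phi_def power2_eq_square algebra_simps)

lemma poly_pderiv_eps: "poly (pderiv eps) t = 2 * e0 * poly k0' t"
  and poly_pderiv_v: "poly (pderiv v) t = 8 * t - 2 * poly k0 t * poly k0' t"
  and poly_pderiv_del: "poly (pderiv del) t = poly k0'' t * poly w t + 4 * t * poly k0' t - 4 * poly k0 t"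
proof -
  show "poly (pderiv eps) t = 2 * e0 * poly k0' t"
    by (simp add: eps_def pderiv_smult k0'_def)
  show "poly (pderiv v) t = 8 * t - 2 * poly k0 t * poly k0' t"
    unfolding v_def by (simp add: pderiv_mult pderiv_diff poly_pderiv_w k0'_def)
  show "poly (pderiv del) t = poly k0'' t * poly w t + 4 * t * poly k0' t - 4 * poly k0 t"
    unfolding del_def pderiv_diff pderiv_mult poly_diff poly_add poly_mult poly_pderiv_w
      k0'_def[symmetric] k0''_def[symmetric]
    by (simp add: pderiv_pCons algebra_simps)
qed

lemma has_real_derivative_over_w:
  assumes "poly w t \<noteq> 0"
  shows "((\<lambda>t. poly p t / poly w t) has_real_derivative
      (poly (pderiv p) t * poly w t - 8 * t * poly p t) / (poly w t)\<^sup>2) (at t)"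
    and "((\<lambda>t. poly p t / (poly w t)\<^sup>2) has_real_derivative
      (poly (pderiv p) t * poly w t - 16 * t * poly p t) / poly w t ^ 3) (at t)"
proof -
  have 1: "(p' * W - p * (8 * t)) / (W * W) = (p' * W - 8 * t * p) / W\<^sup>2"
    "(p' * (W * W) - p * (8 * t * W + 8 * t * W)) / ((W * W) * (W * W)) = (p' * W - 16 * t * p) / W ^ 3"
    if "W \<noteq> 0" for W p p' :: real
    using that by (simp_all add: divide_simps power2_eq_square power3_eq_cube)
  have w: "(poly w has_real_derivative 8 * t) (at t)"
    using poly_DERIV[of w t] by (simp add: poly_pderiv_w)
  show "((\<lambda>t. poly p t / poly w t) has_real_derivative
      (poly (pderiv p) t * poly w t - 8 * t * poly p t) / (poly w t)\<^sup>2) (at t)"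
    by (rule DERIV_cong[OF DERIV_divide[OF poly_DERIV w assms] 1(1)[OF assms]])
  show "((\<lambda>t. poly p t / (poly w t)\<^sup>2) has_real_derivative
      (poly (pderiv p) t * poly w t - 16 * t * poly p t) / poly w t ^ 3) (at t)"
    unfolding power2_eq_square[of "poly w _"]
    by (rule DERIV_cong[OF DERIV_divide[OF poly_DERIV DERIV_mult[OF w w]] 1(2)[OF assms]]) (use assms in simp)
qed

lemma
  assumes "e0 > 0"
  shows poly_w_pos: "poly w t > 0"
    and has_vector_derivative_A0: "(A0 has_vector_derivative A0' t) (at t)"
    and has_vector_derivative_A0': "(A0' has_vector_derivative A0'' t) (at t)"
    and has_vector_derivative_A1: "(A1 has_vector_derivative A1' t) (at t)"
proof -
  show w: "poly w t > 0" using assms by (simp add: poly_w add_pos_nonneg)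
  note D = has_real_derivative_over_w[of t] less_imp_neq[OF w, symmetric]
  have 1: "(p' * W - 8 * t * p) / W\<^sup>2 + (4 * t * (p / W) - 2 * e0 * 0) / W = (p' * W - 4 * t * p) / W\<^sup>2"
    "0 + (2 * e0 * (p / W) + 4 * t * 0) / W = 2 * e0 * p / W\<^sup>2"
    "(p' * W - 16 * t * p) / W ^ 3 + (4 * t * (p / W\<^sup>2) - 2 * e0 * (q / W\<^sup>2)) / W
      = (W * p' - 12 * t * p - 2 * e0 * q) / W ^ 3"
    "(q' * W - 16 * t * q) / W ^ 3 + (2 * e0 * (p / W\<^sup>2) + 4 * t * (q / W\<^sup>2)) / W
      = (W * q' - 12 * t * q + 2 * e0 * p) / W ^ 3"
    "((8 * t - 2 * p * p') * W - 8 * t * (W - p * p)) / W\<^sup>2 = - 2 * p * (p' * W - 4 * t * p) / W\<^sup>2"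
    if "W \<noteq> 0" for W p p' q q' :: real
    using that by (simp_all add: divide_simps power2_eq_square power3_eq_cube) (simp_all add: algebra_simps)
  note 1 = 1[OF D(3)]
  show "(A0 has_vector_derivative A0' t) (at t)"
    unfolding A0_def[abs_def] A0'_def poly_del poly_eps k0'_def
    by (rule has_vector_derivative_eq_rhs[OF
          has_vector_derivative_frame[OF assms DERIV_const D(1)[OF D(3)] DERIV_const]],
        rule frame_cong[OF refl 1(1) 1(2)])
  show "(A0' has_vector_derivative A0'' t) (at t)"
    unfolding A0'_def[abs_def] A0''_def
    by (rule has_vector_derivative_eq_rhs[OF
          has_vector_derivative_frame[OF assms DERIV_const D(2)[OF D(3)] D(2)[OF D(3)]]],
        rule frame_cong[OF refl 1(3) 1(4)])
  have 2: "(poly (pderiv v) t * poly w t - 8 * t * poly v t) / (poly w t)\<^sup>2 =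
      - 2 * poly k0 t * poly del t / (poly w t)\<^sup>2"
    unfolding poly_pderiv_v poly_v poly_del by (rule 1(5))
  show "(A1 has_vector_derivative A1' t) (at t)"
    unfolding A1_def[abs_def] A1'_def
    by (rule has_vector_derivative_eq_rhs[OF
          has_vector_derivative_frame[OF assms D(1)[OF D(3)] D(2)[OF D(3)] D(2)[OF D(3)]]],
        rule frame_cong[OF 2 1(3) 1(4)])
qed

text \<open>A polynomial normal of h on the divisor, namely w^3 times the cross product of
  \<open>A1\<close> and \<open>A0'\<close>; it vanishes exactly where h is not immersed.\<close>

definition "nh t = frame t (- 2 * poly k0 t * poly tau t * poly w t)
  (poly v t * poly eps t) (- poly v t * poly del t)"

text \<open>Both combinations of the components of \<open>A0'\<close> and \<open>A1\<close> contain
  the factor e0^2 + 4 t^2. Extracting it produces \<open>tau\<close>, for the normal, and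
  \<open>F\<close>, for the first fundamental form.\<close>

lemma eps_bet_gam:
  "poly eps t * poly bet t - poly del t * poly gam t = 2 * poly k0 t * poly w t * poly tau t"
  "poly eps t * poly gam t + poly del t * poly bet t = poly w t * poly F t"
  by (simp_all add: poly_eps poly_bet poly_del poly_gam poly_tau F_def poly_w algebra_simps)

section \<open>Normal and fundamental forms of the expansion on the divisor\<close>

lemma cross3_A1_A0':
  assumes "e0 > 0"
  shows "cross3 (A1 t) (A0' t) = (1 / poly w t ^ 3) *\<^sub>R nh t"
proof -
  have scale: "c *\<^sub>R frame t x y z = frame t (c * x) (c * y) (c * z)" for c x y z
    by (intro real_vec3_eqI) (simp_all add: frame_def algebra_simps)
  have w: "poly w t \<noteq> 0" using poly_w_pos[OF assms, of t] by simp
  have "- poly w t * (poly bet t / (poly w t)\<^sup>2 * (poly eps t / (poly w t)\<^sup>2) -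
           poly gam t / (poly w t)\<^sup>2 * (poly del t / (poly w t)\<^sup>2)) =
        - (poly eps t * poly bet t - poly del t * poly gam t) / poly w t ^ 3"
    using w by (simp add: field_simps eval_nat_numeral)
  then show ?thesis unfolding A1_def A0'_def cross_frame nh_def scale eps_bet_gam(1)
    using w by (intro frame_cong) (simp_all add: field_simps eval_nat_numeral)
qed

lemma inner_A1_A0':
  assumes "e0 > 0"
  shows "A1 t \<bullet> A1 t = poly E t / (poly w t)\<^sup>2"
    and "A1 t \<bullet> A0' t = poly F t / (poly w t)\<^sup>2"
    and "A0' t \<bullet> A0' t = poly G t / (poly w t)\<^sup>2"
proof -
  have w: "poly w t \<noteq> 0" using poly_w_pos[OF assms, of t] by simp
  have 1: "poly bet t * poly bet t + poly gam t * poly gam t + poly v t * poly v t * poly w t = poly w t * poly E t"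
    by (simp add: poly_bet poly_gam E_def poly_w algebra_simps)
  have 3: "poly del t * poly del t + poly eps t * poly eps t = poly w t * poly G t"
    by (simp add: poly_del poly_eps G_def poly_w algebra_simps)
  have "A1 t \<bullet> A1 t = (poly bet t * poly bet t + poly gam t * poly gam t + poly v t * poly v t * poly w t) / poly w t ^ 3"
    using w by (simp add: A1_def inner_frame field_simps eval_nat_numeral)
  then show "A1 t \<bullet> A1 t = poly E t / (poly w t)\<^sup>2"
    unfolding 1 using w by (simp add: field_simps eval_nat_numeral)
  have "A1 t \<bullet> A0' t = (poly eps t * poly gam t + poly del t * poly bet t) / poly w t ^ 3"
    using w by (simp add: A1_def A0'_def inner_frame field_simps eval_nat_numeral)
  then show "A1 t \<bullet> A0' t = poly F t / (poly w t)\<^sup>2"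
    unfolding eps_bet_gam(2) using w by (simp add: field_simps eval_nat_numeral)
  have "A0' t \<bullet> A0' t = (poly del t * poly del t + poly eps t * poly eps t) / poly w t ^ 3"
    using w by (simp add: A0'_def inner_frame field_simps eval_nat_numeral)
  then show "A0' t \<bullet> A0' t = poly G t / (poly w t)\<^sup>2"
    unfolding 3 using w by (simp add: field_simps eval_nat_numeral)
qed

text \<open>The -12 t terms of \<open>A0''\<close> point along \<open>A0'\<close>, to which
  \<open>nh\<close> is orthogonal, and drop out; in what remains a factor w splits off.\<close>

lemma inner_nh_A0'':
  assumes "e0 > 0"
  shows "nh t \<bullet> A0'' t = poly N t / poly w t"
proof -
  have w: "poly w t \<noteq> 0" using poly_w_pos[OF assms, of t] by simp
  let ?X = "poly w t * poly (pderiv del) t - 12 * t * poly del t - 2 * e0 * poly eps t"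
  let ?Y = "poly w t * poly (pderiv eps) t - 12 * t * poly eps t + 2 * e0 * poly del t"
  have "poly eps t * ?X - poly del t * ?Y = poly w t * (2 * e0 * poly N1 t)"
    by (simp add: poly_pderiv_del poly_pderiv_eps poly_eps poly_del N1_def poly_w algebra_simps)
  moreover have "nh t \<bullet> A0'' t = poly v t * (poly eps t * ?X - poly del t * ?Y) / (poly w t)\<^sup>2"
    using w unfolding nh_def A0''_def inner_frame by (simp add: field_simps eval_nat_numeral)
  ultimately show ?thesis using w by (simp add: N_def field_simps power2_eq_square)
qed

text \<open>In contrast to \<open>A0''\<close>, the -12 t terms survive here and become the term -24
  t k0 tau of \<open>Y\<close>, while the turning of the frame becomes -2 e0 F.\<close>

lemma inner_nh_A1':
  assumes "e0 > 0"
  shows "nh t \<bullet> A1' t = poly M t / poly w t"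
proof -
  have w: "poly w t \<noteq> 0" using poly_w_pos[OF assms, of t] by simp
  let ?X = "poly w t * poly (pderiv bet) t - 12 * t * poly bet t - 2 * e0 * poly gam t"
  let ?Y = "poly w t * poly (pderiv gam) t - 12 * t * poly gam t + 2 * e0 * poly bet t"
  have "poly eps t * ?X - poly del t * ?Y = poly w t * (poly eps t * poly (pderiv bet) t - poly del t * poly (pderiv gam) t)
     - 12 * t * (poly eps t * poly bet t - poly del t * poly gam t)
     - 2 * e0 * (poly eps t * poly gam t + poly del t * poly bet t)"
    by (simp add: algebra_simps)
  also have "\<dots> = poly w t * poly Y t"
    unfolding eps_bet_gam by (simp add: Y_def algebra_simps)
  finally have 1: "poly eps t * ?X - poly del t * ?Y = poly w t * poly Y t" .
  have "nh t \<bullet> A1' t = 4 * poly k0 t * poly k0 t * poly tau t * poly del t / poly w t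
      + poly v t * (poly eps t * ?X - poly del t * ?Y) / (poly w t)\<^sup>2"
    using w unfolding nh_def A1'_def inner_frame by (simp add: field_simps eval_nat_numeral)
  then show ?thesis unfolding 1 using w by (simp add: M_def field_simps power2_eq_square)
qed

text \<open>The factor 2 is the one between a second derivative and a Taylor coefficient. The
  product is taken with the four vectors of \<open>A2\<close> separately.\<close>

lemma inner_nh_A2:
  assumes "e0 > 0"
  shows "2 * (nh t \<bullet> A2 t) = poly L t / poly w t"
proof -
  define K0 K0' K1 W V T Z D g1' g2' x2' e where
    defs: "K0 = poly k0 t" "K0' = poly k0' t" "K1 = poly k1 t" "W = poly w t" "V = poly v t" "T = poly tau t"
    "Z = poly zeta t" "D = poly del t" "g1' = poly g1 t" "g2' = poly g2 t" "x2' = poly x2 t" "e = poly eps t"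
  have w: "W \<noteq> 0" using poly_w_pos[OF assms, of t] by (simp add: defs)
  have W: "W = e0 * e0 + 4 * t * t" by (simp add: defs poly_w)
  have e: "e = 2 * e0 * K0" by (simp add: defs poly_eps)
  have D: "D = K0' * W - 4 * t * K0" by (simp add: defs poly_del)
  have Z: "Z = e0 * e + 2 * t * D" by (simp add: defs poly_zeta)
  have nh: "nh t = vector [- 2 * K0 * T * W, - e0 * (V * e) - 2 * t * (V * D), 2 * t * (V * e) - e0 * (V * D)]"
    by (intro real_vec3_eqI) (simp_all add: nh_def frame_def defs)
  have 0: "nh t \<bullet> vector [0, a0 + t\<^sup>2, b0 + t * e0] = V * poly phi t"
    by (simp add: nh inner_real3 poly_phi defs[symmetric] Z algebra_simps)
  have 1: "nh t \<bullet> vector [0, - e0, 2 * t] = V * e * W"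
    by (simp add: nh inner_real3 W algebra_simps)
  have 2: "nh t \<bullet> vector [- K0, - g1', 0] = 2 * K0 * K0 * W * T + g1' * V * Z"
    by (simp add: nh inner_real3 Z algebra_simps)
  have 3: "nh t \<bullet> vector [x2', - g2', 0] = - 2 * x2' * K0 * W * T + g2' * V * Z"
    by (simp add: nh inner_real3 Z algebra_simps)
  define k2 where "k2 = poly ek2 t / e0"
  have k2: "poly ek2 t = e0 * k2" using assms by (simp add: k2_def)
  \<comment> \<open>The terms quadratic in g1' have one power of W too many in the denominator; this
    identity supplies the missing factor, so that \<open>L\<close> is a polynomial.\<close>
  have key: "2 * e0 * e - Z = 2 * W * (K0 - t * K0')" by (simp add: Z e D W algebra_simps)
  have "nh t \<bullet> A2 t = V * poly phi t
      + (k2 / W - 2 * e0 * g1' * K1 / W\<^sup>2 + K0 * (4 * e0\<^sup>2 * g1'\<^sup>2 / W ^ 3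
          - (K0\<^sup>2 + g1'\<^sup>2 + 2 * e0 * g2') / W\<^sup>2)) * (V * e * W)
      + (K1 / W - 2 * e0 * g1' * K0 / W\<^sup>2) * (2 * K0 * K0 * W * T + g1' * V * Z)
      + (K0 / W) * (- 2 * x2' * K0 * W * T + g2' * V * Z)"
    unfolding A2_def inner_add_right inner_scaleR_right defs[symmetric] 0 1 2 3 k2_def[symmetric] ..
  also have "\<dots> = (W * V * poly phi t + W * V * k2 * e
      + K1 * (2 * W * K0 * K0 * T + g1' * V * Z) + K0 * (g2' * V * Z - 2 * W * x2' * K0 * T)
      - 2 * e0 * g1' * K1 * V * e - 4 * e0 * g1' * K0 * K0 * K0 * T
      + 2 * e0 * g1' * g1' * K0 * V * (2 * e0 * e - Z) / W
      - K0 * V * e * (K0 * K0 + g1' * g1' + 2 * e0 * g2')) / W"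
    using w by (simp add: field_simps eval_nat_numeral)
  also have "2 * e0 * g1' * g1' * K0 * V * (2 * e0 * e - Z) / W = 4 * e0 * g1' * g1' * K0 * V * (K0 - t * K0')"
    unfolding key using w by simp
  finally show ?thesis
    by (simp add: L_def defs[symmetric] k2 e algebra_simps)
qed

text \<open>Where \<open>nh\<close> vanishes, so do \<open>L\<close>, \<open>M\<close> and \<open>N\<close>, and \<open>PK = L N - M\<^sup>2\<close> has a multiple root.\<close>

lemma nh_neq_0:
  assumes "e0 > 0" and "\<And>t. poly PK t = 0 \<Longrightarrow> poly (pderiv PK) t \<noteq> 0"
  shows "nh t \<noteq> 0"
proof
  assume "nh t = 0"
  then have "poly N t = 0" "poly M t = 0" "poly L t = 0"
    using inner_nh_A0''[OF assms(1), of t] inner_nh_A1'[OF assms(1), of t] inner_nh_A2[OF assms(1), of t]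
      poly_w_pos[OF assms(1), of t] by auto
  then have "poly PK t = 0" "poly (pderiv PK) t = 0"
    by (simp_all add: PK_def pderiv_diff pderiv_mult)
  then show False using assms(2) by blast
qed

end

section \<open>Smooth maps\<close>

lemma frechet_derivative_apply_eq:
  "(f has_derivative f') (at x) \<Longrightarrow> frechet_derivative f (at x) v = f' v"
  using frechet_derivative_at by metis

lemma Ck_on_subset: "Ck_on k T f \<Longrightarrow> S \<subseteq> T \<Longrightarrow> Ck_on k S f"
  by (induction k arbitrary: f) (auto intro: continuous_on_subset)

lemma Ck_on_Suc_imp: "Ck_on (Suc k) S f \<Longrightarrow> Ck_on k S f"
proof (induction k arbitrary: f)
  case 0
  then show ?case
    by (auto intro!: continuous_at_imp_continuous_on differentiable_imp_continuous_within)
next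
  case (Suc k)
  then show ?case by auto
qed

lemma Ck_on_imp_continuous_on: "Ck_on k S f \<Longrightarrow> continuous_on S f"
  by (induction k) (simp, blast dest: Ck_on_Suc_imp)

lemma Ck_on_cong:
  assumes "open S" "Ck_on k S f" "\<And>x. x \<in> S \<Longrightarrow> f x = g x"
  shows "Ck_on k S g"
  using assms(2,3)
proof (induction k arbitrary: f g)
  case 0
  then show ?case by (simp cong: continuous_on_cong)
next
  case (Suc k)
  have D: "(g has_derivative frechet_derivative f (at x)) (at x)" if "x \<in> S" for x
  proof -
    have "(f has_derivative frechet_derivative f (at x)) (at x)"
      using Suc.prems(1) that frechet_derivative_works by auto
    then show ?thesis
      by (rule has_derivative_transform_within_open[OF _ assms(1) that]) (use Suc.prems in auto)
  qed
  have "Ck_on k S (\<lambda>x. frechet_derivative g (at x) v)" for v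
    by (rule Suc.IH[of "\<lambda>x. frechet_derivative f (at x) v"])
      (use Suc.prems(1) in \<open>auto simp: frechet_derivative_apply_eq[OF D]\<close>)
  then show ?case using D by (auto simp: differentiable_def)
qed

text \<open>Replaces the abstractly chosen \<open>frechet_derivative\<close> by any explicit
  derivative on an open set, so that closure properties follow from the usual differentiation
  rules.\<close>

lemma Ck_on_SucI:
  assumes "open S" "\<And>x. x \<in> S \<Longrightarrow> (f has_derivative f' x) (at x)"
    and "\<And>v. Ck_on k S (\<lambda>x. f' x v)"
  shows "Ck_on (Suc k) S f"
proof -
  have "Ck_on k S (\<lambda>x. frechet_derivative f (at x) v)" for v
    by (rule Ck_on_cong[OF assms(1) assms(3)[of v]]) (simp add: frechet_derivative_apply_eq[OF assms(2)])
  then show ?thesis using assms(2) by (auto simp: differentiable_def)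
qed

lemma Ck_on_SucD:
  assumes "Ck_on (Suc k) S f" "x \<in> S"
  shows "(f has_derivative frechet_derivative f (at x)) (at x)"
  using assms frechet_derivative_works by auto

lemma Ck_on_const: "open S \<Longrightarrow> Ck_on k S (\<lambda>x. c)"
  by (induction k arbitrary: c) (auto simp del: Ck_on.simps(2) intro!: Ck_on_SucI[where f'="\<lambda>x v. 0"])

lemma Ck_on_bounded_linear: "open S \<Longrightarrow> bounded_linear f \<Longrightarrow> Ck_on k S f"
  by (cases k) (auto simp del: Ck_on.simps(2) intro!: Ck_on_SucI[where f'="\<lambda>x. f"] Ck_on_const
      linear_continuous_on bounded_linear_imp_has_derivative)

lemma Ck_on_add:
  assumes "open S" "Ck_on k S f" "Ck_on k S g"
  shows "Ck_on k S (\<lambda>x. f x + g x)"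
  using assms(2,3)
proof (induction k arbitrary: f g)
  case 0
  then show ?case by (auto intro: continuous_on_add)
next
  case (Suc k)
  show ?case
    by (rule Ck_on_SucI[OF assms(1) has_derivative_add[OF Ck_on_SucD[OF Suc.prems(1)] Ck_on_SucD[OF Suc.prems(2)]]])
      (use Suc in auto)
qed

lemma Ck_on_bilinear:
  assumes "open S" "bounded_bilinear B" "Ck_on k S f" "Ck_on k S g"
  shows "Ck_on k S (\<lambda>x. B (f x) (g x))"
  using assms(3,4)
proof (induction k arbitrary: f g)
  case 0
  then show ?case by (auto intro: bounded_bilinear.continuous_on[OF assms(2)])
next
  case (Suc k)
  show ?case
  proof (rule Ck_on_SucI[OF assms(1) bounded_bilinear.FDERIV[OF assms(2)
        Ck_on_SucD[OF Suc.prems(1)] Ck_on_SucD[OF Suc.prems(2)]]])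
    show "Ck_on k S (\<lambda>x. B (f x) (frechet_derivative g (at x) v) + B (frechet_derivative f (at x) v) (g x))" for v
      using Suc.prems Suc.prems[THEN Ck_on_Suc_imp]
      by (intro Ck_on_add[OF assms(1)] Suc.IH) auto
  qed
qed

lemma Ck_on_sum:
  "finite I \<Longrightarrow> open S \<Longrightarrow> (\<And>i. i \<in> I \<Longrightarrow> Ck_on k S (f i)) \<Longrightarrow> Ck_on k S (\<lambda>x. \<Sum>i\<in>I. f i x)"
  by (induction I rule: finite_induct) (auto intro: Ck_on_add Ck_on_const)

lemma Ck_on_bounded_linear_compose:
  assumes "open S" "bounded_linear L" "Ck_on k S f"
  shows "Ck_on k S (\<lambda>x. L (f x))"
  using assms(3)
proof (induction k arbitrary: f)
  case 0
  then show ?case by (auto intro: bounded_linear.continuous_on[OF assms(2)])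
next
  case (Suc k)
  show ?case
    by (rule Ck_on_SucI[OF assms(1) bounded_linear.has_derivative[OF assms(2) Ck_on_SucD[OF Suc.prems]]])
      (use Suc in auto)
qed

lemma Ck_on_compose:
  assumes "open S" "Ck_on k T f" "Ck_on k S g" "g ` S \<subseteq> T"
  shows "Ck_on k S (\<lambda>x. f (g x))"
  using assms(2,3)
proof (induction k arbitrary: f)
  case 0
  then show ?case using assms(4) by (auto intro: continuous_on_compose2)
next
  case (Suc k)
  have D: "((\<lambda>x. f (g x)) has_derivative (\<lambda>v. frechet_derivative f (at (g x)) (frechet_derivative g (at x) v))) (at x)"
    if "x \<in> S" for x
    using has_derivative_compose[OF Ck_on_SucD[OF Suc.prems(2) that] Ck_on_SucD[OF Suc.prems(1)]] assms(4) that
    by auto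
  \<comment> \<open>The direction in which f is differentiated varies with x, whereas the induction
    hypothesis concerns fixed directions. Expanding in a basis separates the two
    dependences.\<close>
  have lin: "frechet_derivative f (at (g x)) y =
      (\<Sum>b\<in>Basis. (y \<bullet> b) *\<^sub>R frechet_derivative f (at (g x)) b)" if "x \<in> S" for x y
  proof -
    have "linear (frechet_derivative f (at (g x)))"
      using Ck_on_SucD[OF Suc.prems(1), of "g x"] assms(4) that by (auto dest: has_derivative_linear)
    from linear_sum[OF this, of "\<lambda>b. (y \<bullet> b) *\<^sub>R b" Basis] show ?thesis
      by (simp add: euclidean_representation linear_cmul[OF \<open>linear _\<close>])
  qed
  have "Ck_on k S (\<lambda>x. \<Sum>b\<in>Basis. (frechet_derivative g (at x) v \<bullet> b) *\<^sub>R frechet_derivative f (at (g x)) b)" for v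
  proof (intro Ck_on_sum[OF finite_Basis assms(1)] Ck_on_bilinear[OF assms(1) bounded_bilinear_scaleR]
      Ck_on_bounded_linear_compose[OF assms(1) bounded_linear_inner_left])
    show "Ck_on k S (\<lambda>x. frechet_derivative g (at x) v)" using Suc.prems by auto
    show "Ck_on k S (\<lambda>x. frechet_derivative f (at (g x)) b)" for b
      by (rule Suc.IH[of "\<lambda>y. frechet_derivative f (at y) b"])
        (use Suc.prems Suc.prems(2)[THEN Ck_on_Suc_imp] in auto)
  qed
  then have "Ck_on k S (\<lambda>x. frechet_derivative f (at (g x)) (frechet_derivative g (at x) v))" for v
    by (rule Ck_on_cong[OF assms(1)]) (simp add: lin[symmetric])
  then show ?case
    by (intro Ck_on_SucI[OF assms(1), where f'="\<lambda>x v. frechet_derivative f (at (g x)) (frechet_derivative g (at x) v)"] D)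
qed

lemma Ck_on_sin_cos: "Ck_on k UNIV (sin :: real \<Rightarrow> real) \<and> Ck_on k UNIV (cos :: real \<Rightarrow> real)"
proof (induction k)
  case 0
  then show ?case by (auto intro: continuous_intros)
next
  case (Suc k)
  have "Ck_on (Suc k) UNIV (sin :: real \<Rightarrow> real)"
  proof (rule Ck_on_SucI)
    show "(sin has_derivative (\<lambda>v. cos x * v)) (at x)" for x :: real
      by (auto intro!: derivative_eq_intros)
    show "Ck_on k UNIV (\<lambda>x. cos x * v)" for v :: real
      using Suc by (intro Ck_on_bilinear[OF open_UNIV bounded_bilinear_mult] Ck_on_const) auto
  qed simp
  moreover have "Ck_on (Suc k) UNIV (cos :: real \<Rightarrow> real)"
  proof (rule Ck_on_SucI)
    show "(cos has_derivative (\<lambda>v. sin x * (- v))) (at x)" for x :: real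
      by (auto intro!: derivative_eq_intros)
    show "Ck_on k UNIV (\<lambda>x. sin x * (- v))" for v :: real
      using Suc by (intro Ck_on_bilinear[OF open_UNIV bounded_bilinear_mult] Ck_on_const) auto
  qed simp
  ultimately show ?case ..
qed

lemma Ck_on_polar: "Ck_on k UNIV (\<lambda>p :: real \<times> real. (fst p * cos (snd p), fst p * sin (snd p)))"
proof -
  note snd = Ck_on_bounded_linear[OF open_UNIV bounded_linear_snd, where k=k]
    and fst = Ck_on_bounded_linear[OF open_UNIV bounded_linear_fst, where k=k]
  have sc: "Ck_on k UNIV (\<lambda>p :: real \<times> real. cos (snd p))" "Ck_on k UNIV (\<lambda>p :: real \<times> real. sin (snd p))"
    using Ck_on_compose[OF open_UNIV conjunct2[OF Ck_on_sin_cos] snd]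
      Ck_on_compose[OF open_UNIV conjunct1[OF Ck_on_sin_cos] snd] by simp_all
  note fsc = Ck_on_bilinear[OF open_UNIV bounded_bilinear_mult fst sc(1)]
    Ck_on_bilinear[OF open_UNIV bounded_bilinear_mult fst sc(2)]
  have "Ck_on k UNIV (\<lambda>p :: real \<times> real. (fst p * cos (snd p)) *\<^sub>R (1, 0) + (fst p * sin (snd p)) *\<^sub>R (0, 1))"
    by (rule Ck_on_add[OF open_UNIV
        Ck_on_bilinear[OF open_UNIV bounded_bilinear_scaleR fsc(1) Ck_on_const[OF open_UNIV]]
        Ck_on_bilinear[OF open_UNIV bounded_bilinear_scaleR fsc(2) Ck_on_const[OF open_UNIV]]])
  then show ?thesis by (rule Ck_on_cong[OF open_UNIV]) simp
qed

section \<open>Partial derivatives\<close>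

lemma
  assumes "g differentiable (at (a, b))"
  shows has_vector_derivative_partial1: "((\<lambda>s. g (s, b)) has_vector_derivative partial1 g (a, b)) (at a)"
    and has_vector_derivative_partial2: "((\<lambda>s. g (a, s)) has_vector_derivative partial2 g (a, b)) (at b)"
proof -
  have D: "(g has_derivative frechet_derivative g (at (a, b))) (at (a, b))"
    using assms frechet_derivative_works by blast
  have lin: "linear (frechet_derivative g (at (a, b)))" using D has_derivative_linear by blast
  have "((\<lambda>s. g (s, b)) has_derivative (\<lambda>s. frechet_derivative g (at (a, b)) (s, 0))) (at a)"
    by (rule has_derivative_compose[of "\<lambda>s. (s, b)", OF _ D]) (auto intro!: derivative_eq_intros)
  moreover have "frechet_derivative g (at (a, b)) (s, 0) = s *\<^sub>R partial1 g (a, b)" for s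
    using linear_cmul[OF lin, of s "(1, 0)"] by (simp add: partial1_def)
  ultimately show "((\<lambda>s. g (s, b)) has_vector_derivative partial1 g (a, b)) (at a)"
    by (simp add: has_vector_derivative_def)
  have "((\<lambda>s. g (a, s)) has_derivative (\<lambda>s. frechet_derivative g (at (a, b)) (0, s))) (at b)"
    by (rule has_derivative_compose[of "\<lambda>s. (a, s)", OF _ D]) (auto intro!: derivative_eq_intros)
  moreover have "frechet_derivative g (at (a, b)) (0, s) = s *\<^sub>R partial2 g (a, b)" for s
    using linear_cmul[OF lin, of s "(0, 1)"] by (simp add: partial2_def)
  ultimately show "((\<lambda>s. g (a, s)) has_vector_derivative partial2 g (a, b)) (at b)"
    by (simp add: has_vector_derivative_def)
qed

lemma frechet_derivative_partials:
  assumes "g differentiable (at p)"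
  shows "frechet_derivative g (at p) (x, y) = x *\<^sub>R partial1 g p + y *\<^sub>R partial2 g p"
proof -
  have lin: "linear (frechet_derivative g (at p))"
    using assms frechet_derivative_works has_derivative_linear by blast
  have "(x, y) = x *\<^sub>R (1, 0) + y *\<^sub>R (0, 1 :: real)" by simp
  then show ?thesis
    by (simp only: linear_add[OF lin] linear_cmul[OF lin] partial1_def partial2_def)
qed

lemma
  assumes "Ck_on (Suc k) S g"
  shows Ck_on_partial1: "Ck_on k S (partial1 g)" and Ck_on_partial2: "Ck_on k S (partial2 g)"
  using assms by (auto simp: partial1_def[abs_def] partial2_def[abs_def])

text \<open>The second difference D over a small square, taken in either order, equals h^2 times a
  mixed derivative at some point of the square, by the mean value theorem used twice. Different
  values at (a, b) would contradict continuity.\<close>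

lemma mixed_derivatives_eq:
  fixes \<phi> \<phi>1 \<phi>2 \<phi>12 \<phi>21 :: "real \<times> real \<Rightarrow> real"
  assumes S: "open S" "(a, b) \<in> S"
    and d1: "\<And>x y. (x, y) \<in> S \<Longrightarrow> ((\<lambda>s. \<phi> (s, y)) has_real_derivative \<phi>1 (x, y)) (at x)"
    and d2: "\<And>x y. (x, y) \<in> S \<Longrightarrow> ((\<lambda>s. \<phi> (x, s)) has_real_derivative \<phi>2 (x, y)) (at y)"
    and d12: "\<And>x y. (x, y) \<in> S \<Longrightarrow> ((\<lambda>s. \<phi>1 (x, s)) has_real_derivative \<phi>12 (x, y)) (at y)"
    and d21: "\<And>x y. (x, y) \<in> S \<Longrightarrow> ((\<lambda>s. \<phi>2 (s, y)) has_real_derivative \<phi>21 (x, y)) (at x)"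
    and c: "continuous_on S \<phi>12" "continuous_on S \<phi>21"
  shows "\<phi>12 (a, b) = \<phi>21 (a, b)"
proof (rule ccontr)
  assume ne: "\<phi>12 (a, b) \<noteq> \<phi>21 (a, b)"
  \<comment> \<open>Half the gap: no number is closer than this to both values.\<close>
  define \<epsilon> where "\<epsilon> = \<bar>\<phi>12 (a, b) - \<phi>21 (a, b)\<bar> / 2"
  have "\<epsilon> > 0" using ne by (simp add: \<epsilon>_def)
  have "((\<lambda>p. \<phi>12 p) \<longlongrightarrow> \<phi>12 (a, b)) (nhds (a, b))" "((\<lambda>p. \<phi>21 p) \<longlongrightarrow> \<phi>21 (a, b)) (nhds (a, b))"
    using c S continuous_on_eq_continuous_at[OF S(1)] by (auto simp: continuous_at tendsto_at_iff_tendsto_nhds)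
  then have "\<forall>\<^sub>F p in nhds (a, b). p \<in> S \<and> dist (\<phi>12 p) (\<phi>12 (a, b)) < \<epsilon> \<and> dist (\<phi>21 p) (\<phi>21 (a, b)) < \<epsilon>"
    using S \<open>\<epsilon> > 0\<close> by (intro eventually_conj) (auto simp: tendsto_iff eventually_nhds_in_open)
  then obtain \<delta> where "\<delta> > 0" and \<delta>: "\<And>p. dist p (a, b) < \<delta> \<Longrightarrow>
      p \<in> S \<and> dist (\<phi>12 p) (\<phi>12 (a, b)) < \<epsilon> \<and> dist (\<phi>21 p) (\<phi>21 (a, b)) < \<epsilon>"
    unfolding eventually_nhds_metric by blast
  \<comment> \<open>Points of the square are at distance at most 2 h from its corner, which is below
    \<delta>.\<close>
  define h where "h = \<delta> / 3"
  have h: "h > 0" using \<open>\<delta> > 0\<close> by (simp add: h_def)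
  have near: "dist (x, y) (a, b) < \<delta>" if "a \<le> x" "x \<le> a + h" "b \<le> y" "y \<le> b + h" for x y
  proof -
    have "dist (x, y) (a, b) \<le> \<bar>x - a\<bar> + \<bar>y - b\<bar>"
      unfolding dist_Pair_Pair dist_real_def using sqrt_sum_squares_le_sum_abs by simp
    also have "\<dots> \<le> 2 * h" using that by simp
    finally show ?thesis using h by (simp add: h_def)
  qed
  define D where "D = \<phi> (a + h, b + h) - \<phi> (a + h, b) - (\<phi> (a, b + h) - \<phi> (a, b))"
  have "\<exists>\<xi>. a < \<xi> \<and> \<xi> < a + h \<and> (\<phi> (a + h, b + h) - \<phi> (a + h, b)) - (\<phi> (a, b + h) - \<phi> (a, b))
      = (a + h - a) * (\<phi>1 (\<xi>, b + h) - \<phi>1 (\<xi>, b))"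
    using h \<delta> near by (intro MVT2[where f="\<lambda>x. \<phi> (x, b + h) - \<phi> (x, b)"] DERIV_diff d1) auto
  then obtain \<xi> where \<xi>: "a < \<xi>" "\<xi> < a + h" "D = h * (\<phi>1 (\<xi>, b + h) - \<phi>1 (\<xi>, b))" by (auto simp: D_def)
  have "\<exists>\<eta>. b < \<eta> \<and> \<eta> < b + h \<and> \<phi>1 (\<xi>, b + h) - \<phi>1 (\<xi>, b) = (b + h - b) * \<phi>12 (\<xi>, \<eta>)"
    using h \<delta> near \<xi> by (intro MVT2[where f="\<lambda>y. \<phi>1 (\<xi>, y)"] d12) auto
  then obtain \<eta> where \<eta>: "b < \<eta>" "\<eta> < b + h" "D = h * (h * \<phi>12 (\<xi>, \<eta>))" using \<xi> by auto
  have "\<exists>y. b < y \<and> y < b + h \<and> (\<phi> (a + h, b + h) - \<phi> (a, b + h)) - (\<phi> (a + h, b) - \<phi> (a, b))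
      = (b + h - b) * (\<phi>2 (a + h, y) - \<phi>2 (a, y))"
    using h \<delta> near by (intro MVT2[where f="\<lambda>y. \<phi> (a + h, y) - \<phi> (a, y)"] DERIV_diff d2) auto
  then obtain y where y: "b < y" "y < b + h" "D = h * (\<phi>2 (a + h, y) - \<phi>2 (a, y))" by (auto simp: D_def)
  have "\<exists>x. a < x \<and> x < a + h \<and> \<phi>2 (a + h, y) - \<phi>2 (a, y) = (a + h - a) * \<phi>21 (x, y)"
    using h \<delta> near y by (intro MVT2[where f="\<lambda>x. \<phi>2 (x, y)"] d21) auto
  then obtain x where x: "a < x" "x < a + h" "D = h * (h * \<phi>21 (x, y))" using y by auto
  have "\<phi>12 (\<xi>, \<eta>) = \<phi>21 (x, y)" using h \<eta>(3) x(3) by simp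
  moreover have "dist (\<phi>12 (\<xi>, \<eta>)) (\<phi>12 (a, b)) < \<epsilon>" "dist (\<phi>21 (x, y)) (\<phi>21 (a, b)) < \<epsilon>"
    using \<delta>[OF near[of \<xi> \<eta>]] \<delta>[OF near[of x y]] \<xi> \<eta> x y by auto
  moreover have "\<bar>\<phi>12 (a, b) - \<phi>21 (a, b)\<bar> \<le> \<bar>z - \<phi>12 (a, b)\<bar> + \<bar>z - \<phi>21 (a, b)\<bar>" for z by arith
  from this[of "\<phi>21 (x, y)"] calculation show False unfolding \<epsilon>_def dist_real_def by simp
qed

lemma partial12_eq_partial21:
  fixes g :: "real \<times> real \<Rightarrow> 'b::real_inner"
  assumes S: "open S" "p \<in> S" and g: "Ck_on 2 S g"
  shows "partial1 (partial2 g) p = partial2 (partial1 g) p"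
proof -
  have g': "Ck_on (Suc (Suc 0)) S g" using g by (simp add: numeral_2_eq_2)
  note g1 = Ck_on_partial1[OF g'] and g2 = Ck_on_partial2[OF g']
  obtain a b where p: "p = (a, b)" by (cases p)
  have *: "((\<lambda>s. G s \<bullet> e) has_real_derivative D \<bullet> e) (at x)"
    if "(G has_vector_derivative D) (at x)" for G :: "real \<Rightarrow> 'b" and D e x
    using bounded_linear.has_vector_derivative[OF bounded_linear_inner_left that]
    by (simp add: has_real_derivative_iff_has_vector_derivative)
  have "partial2 (partial1 g) p \<bullet> e = partial1 (partial2 g) p \<bullet> e" for e
    unfolding p
  proof (rule mixed_derivatives_eq[of S a b "\<lambda>p. g p \<bullet> e" "\<lambda>p. partial1 g p \<bullet> e" "\<lambda>p. partial2 g p \<bullet> e"])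
    show "continuous_on S (\<lambda>p. partial2 (partial1 g) p \<bullet> e)" "continuous_on S (\<lambda>p. partial1 (partial2 g) p \<bullet> e)"
      using Ck_on_partial2[OF g1] Ck_on_partial1[OF g2] by (auto intro!: continuous_intros)
    have d: "g differentiable (at q)" "partial1 g differentiable (at q)" "partial2 g differentiable (at q)"
      if "q \<in> S" for q using that g' g1 g2 by (simp_all only: Ck_on.simps)
    show "((\<lambda>s. g (s, y) \<bullet> e) has_real_derivative partial1 g (x, y) \<bullet> e) (at x)"
      "((\<lambda>s. g (x, s) \<bullet> e) has_real_derivative partial2 g (x, y) \<bullet> e) (at y)"
      "((\<lambda>s. partial1 g (x, s) \<bullet> e) has_real_derivative partial2 (partial1 g) (x, y) \<bullet> e) (at y)"
      "((\<lambda>s. partial2 g (s, y) \<bullet> e) has_real_derivative partial1 (partial2 g) (x, y) \<bullet> e) (at x)"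
      if "(x, y) \<in> S" for x y
      using d[OF that] by (intro * has_vector_derivative_partial1 has_vector_derivative_partial2; simp)+
  qed (use S p in auto)
  then have "(partial1 (partial2 g) p - partial2 (partial1 g) p) \<bullet> (partial1 (partial2 g) p - partial2 (partial1 g) p) = 0"
    by (simp add: inner_diff_left)
  then show ?thesis by simp
qed

section \<open>Second order expansions\<close>

text \<open>An expansion up to o(u^2) on punctured neighbourhoods: F 0 is unconstrained, which suits
  the root k, whose equation is available only off the divisor.\<close>

definition jet2 :: "(real \<Rightarrow> real) \<Rightarrow> real \<Rightarrow> real \<Rightarrow> real \<Rightarrow> bool" where
  "jet2 F a b c \<longleftrightarrow> ((\<lambda>u. (F u - (a + b * u + c * u\<^sup>2)) / u\<^sup>2) \<longlongrightarrow> 0) (at 0)"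

lemma eventually_at_0_neq: "\<forall>\<^sub>F u in at (0::real). u \<noteq> 0"
  by (simp add: eventually_at_filter)

lemma jet2_cong:
  assumes "jet2 F a b c" "\<forall>\<^sub>F u in at 0. F u = G u"
  shows "jet2 G a b c"
  unfolding jet2_def
  by (rule Lim_transform_eventually[OF assms(1)[unfolded jet2_def]])
    (use assms(2) in \<open>auto elim: eventually_mono\<close>)

lemma jet2_coeff_cong: "jet2 F a b c \<Longrightarrow> a = a' \<Longrightarrow> b = b' \<Longrightarrow> c = c' \<Longrightarrow> jet2 F a' b' c'"
  by simp

lemma jet2_const: "jet2 (\<lambda>u. a) a 0 0"
  by (simp add: jet2_def)

lemma jet2_ident: "jet2 (\<lambda>u. u) 0 1 0"
  by (simp add: jet2_def)

lemma jet2_add: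
  assumes "jet2 F a b c" "jet2 G a' b' c'"
  shows "jet2 (\<lambda>u. F u + G u) (a + a') (b + b') (c + c')"
  using tendsto_add[OF assms[unfolded jet2_def]]
  by (simp add: jet2_def add_divide_distrib[symmetric] algebra_simps)

lemma tendsto_jet2:
  assumes "jet2 F a b c"
  shows "(F \<longlongrightarrow> a) (at 0)"
proof -
  have "((\<lambda>u. (F u - (a + b * u + c * u\<^sup>2)) / u\<^sup>2 * u\<^sup>2 + (a + b * u + c * u\<^sup>2)) \<longlongrightarrow>
      0 * 0\<^sup>2 + (a + b * 0 + c * 0\<^sup>2)) (at 0)"
    using assms unfolding jet2_def by (intro tendsto_intros)
  then have "((\<lambda>u. (F u - (a + b * u + c * u\<^sup>2)) / u\<^sup>2 * u\<^sup>2 + (a + b * u + c * u\<^sup>2)) \<longlongrightarrow> a) (at 0)"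
    by simp
  then show ?thesis
    by (rule Lim_transform_eventually) (rule eventually_mono[OF eventually_at_0_neq], simp)
qed

lemma jet2_mult:
  assumes F: "jet2 F a b c" and G: "jet2 G a' b' c'"
  shows "jet2 (\<lambda>u. F u * G u) (a * a') (a * b' + b * a') (a * c' + b * b' + c * a')"
proof -
  have "((\<lambda>u. (F u - (a + b * u + c * u\<^sup>2)) / u\<^sup>2 * G u
      + (a + b * u + c * u\<^sup>2) * ((G u - (a' + b' * u + c' * u\<^sup>2)) / u\<^sup>2)
      + u * (b * c' + c * b' + c * c' * u)) \<longlongrightarrow>
      0 * a' + (a + b * 0 + c * 0\<^sup>2) * 0 + 0 * (b * c' + c * b' + c * c' * 0)) (at 0)"
    using F G tendsto_jet2[OF G] unfolding jet2_def by (intro tendsto_intros)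
  then have *: "((\<lambda>u. (F u - (a + b * u + c * u\<^sup>2)) / u\<^sup>2 * G u
      + (a + b * u + c * u\<^sup>2) * ((G u - (a' + b' * u + c' * u\<^sup>2)) / u\<^sup>2)
      + u * (b * c' + c * b' + c * c' * u)) \<longlongrightarrow> 0) (at 0)" by simp
  show ?thesis unfolding jet2_def
    by (rule Lim_transform_eventually[OF *], rule eventually_mono[OF eventually_at_0_neq])
      (simp add: field_simps power2_eq_square)
qed

lemma jet2_cmult: "jet2 F a b c \<Longrightarrow> jet2 (\<lambda>u. k * F u) (k * a) (k * b) (k * c)"
  using jet2_mult[OF jet2_const[of k]] by simp

lemma jet2_uminus: "jet2 F a b c \<Longrightarrow> jet2 (\<lambda>u. - F u) (- a) (- b) (- c)"
  using jet2_cmult[of F a b c "-1"] by simp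

lemma jet2_diff:
  "jet2 F a b c \<Longrightarrow> jet2 G a' b' c' \<Longrightarrow> jet2 (\<lambda>u. F u - G u) (a - a') (b - b') (c - c')"
  using jet2_add[OF _ jet2_uminus] by fastforce

lemma jet2_power2:
  "jet2 F a b c \<Longrightarrow> jet2 (\<lambda>u. (F u)\<^sup>2) (a\<^sup>2) (2 * a * b) (2 * a * c + b\<^sup>2)"
  using jet2_mult[of F a b c F a b c] by (simp add: power2_eq_square algebra_simps)

lemma jet2_limit: "(F \<longlongrightarrow> a) (at 0) \<Longrightarrow> jet2 (\<lambda>u. u\<^sup>2 * F u) 0 0 a"
  unfolding jet2_def
  by (rule Lim_transform_eventually[of "\<lambda>u. F u - a"],
      use LIM_zero in blast, rule eventually_mono[OF eventually_at_0_neq])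
    (simp add: field_simps)

text \<open>The coefficients of the quotient are characterised by multiplying back, so explicit
  quotient formulas only have to be verified, not produced.\<close>

lemma jet2_divide:
  assumes F: "jet2 F a b c" and G: "jet2 G a' b' c'" and "a' \<noteq> 0"
    and "x * a' = a" "x * b' + y * a' = b" "x * c' + y * b' + z * a' = c"
  shows "jet2 (\<lambda>u. F u / G u) x y z"
proof -
  have "jet2 (\<lambda>u. x + y * u + z * u\<^sup>2) x y z" by (simp add: jet2_def)
  from jet2_diff[OF F jet2_mult[OF this G]]
  have "((\<lambda>u. (F u - (x + y * u + z * u\<^sup>2) * G u) / u\<^sup>2) \<longlongrightarrow> 0) (at 0)"
    by (simp add: jet2_def assms(4-6)[symmetric] algebra_simps)
  from tendsto_divide[OF this tendsto_jet2[OF G] \<open>a' \<noteq> 0\<close>]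
  have *: "((\<lambda>u. (F u - (x + y * u + z * u\<^sup>2) * G u) / u\<^sup>2 / G u) \<longlongrightarrow> 0) (at 0)" by simp
  have "\<forall>\<^sub>F u in at 0. G u \<noteq> 0"
    by (rule tendsto_imp_eventually_ne[OF tendsto_jet2[OF G] \<open>a' \<noteq> 0\<close>])
  with eventually_at_0_neq
  have "\<forall>\<^sub>F u in at 0. (F u - (x + y * u + z * u\<^sup>2) * G u) / u\<^sup>2 / G u =
      (F u / G u - (x + y * u + z * u\<^sup>2)) / u\<^sup>2"
    by eventually_elim (simp add: diff_divide_distrib)
  then show ?thesis unfolding jet2_def by (rule Lim_transform_eventually[OF *])
qed

lemma jet2_unique:
  assumes "jet2 F a b c" "jet2 F a' b' c'"
  shows "a = a' \<and> b = b' \<and> c = c'"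
proof -
  define A B C where "A = a - a'" "B = b - b'" "C = c - c'"
  have J: "jet2 (\<lambda>u. 0) A B C" using jet2_diff[OF assms] by (simp add: A_B_C_def)
  have A: "A = 0" using tendsto_unique[OF _ tendsto_jet2[OF J] tendsto_const] by simp
  have "((\<lambda>u. (0 - (A + B * u + C * u\<^sup>2)) / u\<^sup>2 * u) \<longlongrightarrow> 0 * 0) (at 0)"
    by (intro tendsto_intros J[unfolded jet2_def])
  moreover have "(0 - (A + B * u + C * u\<^sup>2)) / u\<^sup>2 * u = - ((B * u + C * u\<^sup>2) / u\<^sup>2) * u" for u
    by (simp add: A minus_divide_left)
  ultimately have *: "((\<lambda>u. - ((B * u + C * u\<^sup>2) / u\<^sup>2) * u) \<longlongrightarrow> 0 * 0) (at 0)" by simp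
  have "((\<lambda>u. - (B + C * u)) \<longlongrightarrow> 0) (at 0)"
    by (rule Lim_transform_eventually[of "\<lambda>u. - ((B * u + C * u\<^sup>2) / u\<^sup>2) * u"],
      use * in simp, rule eventually_mono[OF eventually_at_0_neq]) (simp add: field_simps power2_eq_square)
  moreover have "((\<lambda>u. - (B + C * u)) \<longlongrightarrow> - (B + C * 0)) (at 0)" by (intro tendsto_intros)
  ultimately have "- (B + C * 0) = 0" by (rule tendsto_unique[OF at_neq_bot, rotated])
  then have B: "B = 0" by simp
  have "((\<lambda>u. - C) \<longlongrightarrow> 0) (at (0::real))"
    by (rule Lim_transform_eventually[OF J[unfolded jet2_def]], rule eventually_mono[OF eventually_at_0_neq])
      (simp add: A B)
  from tendsto_unique[OF at_neq_bot this tendsto_const[of "- C"]] have "C = 0" by simp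
  with A B show ?thesis by (simp add: A_B_C_def)
qed

text \<open>The Peano form of the remainder, with a second derivative at 0 alone. The derivative of
  the remainder G is o(s), and the mean value theorem multiplies this by s.\<close>

lemma jet2_Taylor:
  assumes S: "open S" "0 \<in> S"
    and F: "\<And>s. s \<in> S \<Longrightarrow> (F has_real_derivative F' s) (at s)"
    and F': "(F' has_real_derivative F'') (at 0)"
  shows "jet2 F (F 0) (F' 0) (F'' / 2)"
  unfolding jet2_def
proof (rule tendstoI)
  fix \<epsilon> :: real assume "\<epsilon> > 0"
  define G where "G s = F s - (F 0 + F' 0 * s + F'' / 2 * s\<^sup>2)" for s
  define G' where "G' s = F' s - F' 0 - F'' * s" for s
  have G: "(G has_real_derivative G' s) (at s)" if "s \<in> S" for s
    unfolding G_def G'_def by (auto intro!: derivative_eq_intros F that)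
  have "((\<lambda>s. (F' s - F' 0) / s - F'') \<longlongrightarrow> F'' - F'') (at 0)"
    using F' by (intro tendsto_intros) (simp add: has_field_derivative_iff)
  then have "\<forall>\<^sub>F s in at 0. \<bar>(F' s - F' 0) / s - F''\<bar> < \<epsilon> / 2"
    using tendstoD[of _ 0 "at 0" "\<epsilon> / 2"] \<open>\<epsilon> > 0\<close> by fastforce
  moreover have "\<forall>\<^sub>F s in at 0. s \<in> S" using S by (rule eventually_at_in_open')
  ultimately have "\<forall>\<^sub>F s in at 0. s \<in> S \<and> \<bar>(F' s - F' 0) / s - F''\<bar> < \<epsilon> / 2"
    by (rule eventually_conj[rotated])
  then obtain d where d: "d > 0" and 1: "\<And>s. s \<noteq> 0 \<Longrightarrow> \<bar>s\<bar> < d \<Longrightarrow> s \<in> S \<and> \<bar>(F' s - F' 0) / s - F''\<bar> < \<epsilon> / 2"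
    unfolding eventually_at by (auto simp: dist_real_def)
  have 2: "s \<in> S \<and> \<bar>G' s\<bar> \<le> \<epsilon> / 2 * \<bar>s\<bar>" if "\<bar>s\<bar> < d" for s
  proof (cases "s = 0")
    case False
    have "G' s = ((F' s - F' 0) / s - F'') * s" using False by (simp add: G'_def field_simps)
    then have "\<bar>G' s\<bar> = \<bar>(F' s - F' 0) / s - F''\<bar> * \<bar>s\<bar>" by (simp only: abs_mult)
    also have "\<dots> \<le> \<epsilon> / 2 * \<bar>s\<bar>" using 1[OF False that] by (intro mult_right_mono) auto
    finally show ?thesis using 1[OF False that] by blast
  qed (use S in \<open>simp add: G'_def\<close>)
  have G0: "G 0 = 0" by (simp add: G_def)
  have "\<bar>G s\<bar> < \<epsilon> * s\<^sup>2" if s: "s \<noteq> 0" "\<bar>s\<bar> < d" for s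
  proof -
    have "\<exists>z. \<bar>z\<bar> \<le> \<bar>s\<bar> \<and> G s = s * G' z"
    proof (cases "s > 0")
      case True
      have "\<exists>z>0. z < s \<and> G s - G 0 = (s - 0) * G' z"
        by (rule MVT2) (use True s 2 G in auto)
      then obtain z where "0 < z" "z < s" "G s = s * G' z" using G0 by auto
      then show ?thesis by (intro exI[of _ z]) auto
    next
      case False
      have "\<exists>z>s. z < 0 \<and> G 0 - G s = (0 - s) * G' z"
        by (rule MVT2) (use False s 2 G in auto)
      then obtain z where "s < z" "z < 0" "G s = s * G' z" using G0 by auto
      then show ?thesis by (intro exI[of _ z]) auto
    qed
    then obtain z where z: "\<bar>z\<bar> \<le> \<bar>s\<bar>" "G s = s * G' z" by blast
    have "\<bar>G' z\<bar> \<le> \<epsilon> / 2 * \<bar>z\<bar>" using 2[of z] z s by auto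
    also have "\<dots> \<le> \<epsilon> / 2 * \<bar>s\<bar>" using z \<open>\<epsilon> > 0\<close> by simp
    finally have "\<bar>G s\<bar> \<le> \<bar>s\<bar> * (\<epsilon> / 2 * \<bar>s\<bar>)"
      unfolding z(2) abs_mult by (rule mult_left_mono) simp
    also have "\<dots> = \<epsilon> / 2 * s\<^sup>2" by (simp add: power2_eq_square)
    also have "\<dots> < \<epsilon> * s\<^sup>2" using s \<open>\<epsilon> > 0\<close> by simp
    finally show ?thesis .
  qed
  then have "\<forall>s. s \<noteq> 0 \<and> \<bar>s\<bar> < d \<longrightarrow> \<bar>G s\<bar> / s\<^sup>2 < \<epsilon>" by (simp add: pos_divide_less_eq)
  then show "\<forall>\<^sub>F s in at 0. dist ((F s - (F 0 + F' 0 * s + F'' / 2 * s\<^sup>2)) / s\<^sup>2) 0 < \<epsilon>"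
    unfolding eventually_at using d by (auto simp: dist_real_def G_def intro!: exI[of _ d])
qed

lemma smooth_on_deriv:
  fixes f :: "real \<Rightarrow> real"
  assumes "open S" "smooth_on S f"
  shows "smooth_on S (deriv f)" and "\<And>s. s \<in> S \<Longrightarrow> (f has_real_derivative deriv f s) (at s)"
proof -
  have d: "f differentiable (at s)" if "s \<in> S" for s
    using assms(2) that unfolding smooth_on_def by (metis Ck_on.simps(2))
  then show D: "(f has_real_derivative deriv f s) (at s)" if "s \<in> S" for s
    using that by (simp add: DERIV_deriv_iff_real_differentiable)
  have "frechet_derivative f (at s) 1 = deriv f s" if "s \<in> S" for s
    using frechet_derivative_apply_eq[OF D[OF that, unfolded has_field_derivative_def], of 1] by simp
  moreover have "Ck_on k S (\<lambda>s. frechet_derivative f (at s) 1)" for k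
    using assms(2) unfolding smooth_on_def by (metis Ck_on.simps(2))
  ultimately show "smooth_on S (deriv f)"
    unfolding smooth_on_def using Ck_on_cong[OF assms(1)] by blast
qed

lemma smooth_germ_deriv: "smooth_germ (f :: real \<Rightarrow> real) a \<Longrightarrow> smooth_germ (deriv f) a"
  unfolding smooth_germ_def using smooth_on_deriv by blast

lemma jet2_smooth_germ:
  assumes "smooth_germ f 0"
  shows "jet2 f (f 0) (deriv f 0) (deriv (deriv f) 0 / 2)"
proof -
  obtain S where "open S" "0 \<in> S" "smooth_on S f" using assms by (auto simp: smooth_germ_def)
  then show ?thesis
    using smooth_on_deriv[of S f] smooth_on_deriv(2)[of S "deriv f" 0] by (intro jet2_Taylor) auto
qed

lemma smooth_germ_has_real_derivative:
  "smooth_germ (f :: real \<Rightarrow> real) a \<Longrightarrow> \<forall>\<^sub>F s in nhds a. (f has_real_derivative deriv f s) (at s)"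
proof -
  assume "smooth_germ f a"
  then obtain S where S: "open S" "a \<in> S" "smooth_on S f" unfolding smooth_germ_def by blast
  then have "\<forall>s\<in>S. (f has_real_derivative deriv f s) (at s)" using smooth_on_deriv(2) by blast
  then show ?thesis using S unfolding eventually_nhds by blast
qed

lemma smooth_germ_partials:
  assumes "smooth_germ g p"
  shows "smooth_germ (partial1 g) p" "smooth_germ (partial2 g) p"
proof -
  obtain S where S: "open S" "p \<in> S" "\<And>k. Ck_on k S g"
    using assms unfolding smooth_germ_def smooth_on_def by blast
  have "Ck_on k S (partial1 g) \<and> Ck_on k S (partial2 g)" for k
    by (rule conjI[OF Ck_on_partial1[OF S(3)] Ck_on_partial2[OF S(3)]])
  then show "smooth_germ (partial1 g) p" "smooth_germ (partial2 g) p"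
    unfolding smooth_germ_def smooth_on_def using S(1,2) by (intro exI[of _ S]; simp)+
qed

lemma smooth_germ_differentiable:
  "smooth_germ g p \<Longrightarrow> \<forall>\<^sub>F q in nhds p. g differentiable (at q)"
proof -
  assume "smooth_germ g p"
  then obtain S where S: "open S" "p \<in> S" "Ck_on (Suc 0) S g" unfolding smooth_germ_def smooth_on_def by blast
  then have "\<forall>q\<in>S. g differentiable (at q)" by simp
  then show ?thesis using S unfolding eventually_nhds by blast
qed

lemma smooth_germ_ray:
  fixes g :: "real \<times> real \<Rightarrow> real"
  assumes "smooth_germ g 0"
  shows "smooth_germ (\<lambda>u. g (u, t * u)) 0"
    and "deriv (\<lambda>u. g (u, t * u)) 0 = partial1 g 0 + t * partial2 g 0"
proof -
  obtain S where S: "open S" "0 \<in> S" "\<And>k. Ck_on k S g"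
    using assms by (auto simp: smooth_germ_def smooth_on_def)
  define T where "T = (\<lambda>u. (u, t * u)) -` S"
  have bl: "bounded_linear (\<lambda>u::real. (u, t * u))"
    by (intro bounded_linear_Pair bounded_linear_ident bounded_linear_mult_right)
  have T: "open T" unfolding T_def
    by (rule open_vimage[OF S(1)]) (auto intro!: continuous_intros)
  have "0 \<in> T" using S(2) by (simp add: T_def zero_prod_def)
  moreover have "Ck_on k T (\<lambda>u. g (u, t * u))" for k
    by (rule Ck_on_compose[OF T S(3) Ck_on_bounded_linear[OF T bl]]) (auto simp: T_def)
  ultimately show "smooth_germ (\<lambda>u. g (u, t * u)) 0"
    using T by (auto simp: smooth_germ_def smooth_on_def)
  have "g differentiable (at (0, t * 0))"
    using S(2) S(3)[of 1] by (simp add: zero_prod_def numeral_eq_Suc del: One_nat_def) (simp add: zero_prod_def)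
  then have "(g has_derivative frechet_derivative g (at (0, t * 0))) (at (0, t * 0))" and d: "g differentiable (at (0, t * 0))"
    using frechet_derivative_works by auto
  from has_derivative_compose[OF bounded_linear_imp_has_derivative[OF bl, of "at 0"] this(1)]
  have "((\<lambda>u. g (u, t * u)) has_derivative (\<lambda>s. frechet_derivative g (at (0, t * 0)) (s, t * s))) (at 0)" .
  moreover have "frechet_derivative g (at (0, t * 0)) (s, t * s) = (partial1 g 0 + t * partial2 g 0) * s" for s
    unfolding frechet_derivative_partials[OF d] by (simp add: zero_prod_def algebra_simps)
  ultimately have "((\<lambda>u. g (u, t * u)) has_real_derivative partial1 g 0 + t * partial2 g 0) (at 0)"
    by (simp add: has_field_derivative_def)
  then show "deriv (\<lambda>u. g (u, t * u)) 0 = partial1 g 0 + t * partial2 g 0" by (rule DERIV_imp_deriv)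
qed

text \<open>The u^2 coefficient stays existential: in the ray formulas f322 always carries a factor
  u and its derivatives a factor u^2, so it never enters a two-jet.\<close>

lemma jet2_ray:
  assumes "smooth_germ g 0"
  shows "\<exists>c. jet2 (\<lambda>u. g (u, t * u)) (g 0) (partial1 g 0 + t * partial2 g 0) c"
  using jet2_smooth_germ[OF smooth_germ_ray(1)[OF assms, of t]] smooth_germ_ray(2)[OF assms, of t]
  by (auto simp: zero_prod_def)

text \<open>The equation is read as k E N = P, where P contains k only in products with F or G,
  functions of order u^2. The limit of k then determines the two-jet of P, and division by E N
  yields the one of k. Hypotheses 0, 1 and 2 compare coefficients of both sides.\<close>

lemma bounded_root_expansion:
  assumes E: "jet2 E 1 0 E2" and F: "jet2 F 0 0 F2" and G: "jet2 G 0 0 w"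
    and L: "jet2 L L0 L1 L2" and M: "jet2 M M0 M1 M2" and N: "jet2 N N0 N1 N2" and "N0 \<noteq> 0"
    and eq: "\<forall>\<^sub>F u in at 0. (L u - k u * E u) * (N u - k u * G u) = (M u - k u * F u)\<^sup>2"
    and k: "(k \<longlongrightarrow> l) (at 0)"
    and 0: "k0 * N0 = L0 * N0 - M0\<^sup>2"
    and 1: "k0 * N1 + k1 * N0 = L0 * N1 + L1 * N0 - 2 * M0 * M1"
    and 2: "k0 * (N2 + E2 * N0) + k1 * N1 + k2 * N0 = L0 * N2 + L1 * N1 + L2 * N0
       - 2 * M0 * M2 - M1\<^sup>2 - k0 * w * L0 + 2 * k0 * M0 * F2 + k0\<^sup>2 * w"
  shows "jet2 k k0 k1 k2"
proof -
  \<comment> \<open>A factor of order u^2 uses nothing about k except its limit.\<close>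
  have square: "jet2 (\<lambda>u. k u * H u) 0 0 (l * c)" if "jet2 H 0 0 c" for H c
  proof -
    have "((\<lambda>u. H u / u\<^sup>2 - c) \<longlongrightarrow> 0) (at 0)"
      by (rule Lim_transform_eventually[OF that[unfolded jet2_def]], rule eventually_mono[OF eventually_at_0_neq])
        (simp add: field_simps)
    then have "((\<lambda>u. H u / u\<^sup>2) \<longlongrightarrow> c) (at 0)" by (rule LIM_zero_cancel)
    from jet2_limit[OF tendsto_mult[OF k this]]
    show ?thesis
      by (rule jet2_cong) (rule eventually_mono[OF eventually_at_0_neq], simp)
  qed
  have kF: "jet2 (\<lambda>u. k u * F u) 0 0 (l * F2)" and kG: "jet2 (\<lambda>u. k u * G u) 0 0 (l * w)"
    using square F G by auto
  define P where "P u = L u * N u - (M u)\<^sup>2 - k u * G u * L u + 2 * (k u * F u * M u)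
      + (k u * (k u * (G u * E u)) - (k u * F u)\<^sup>2)" for u
  have P: "jet2 P (L0 * N0 - M0\<^sup>2) (L0 * N1 + L1 * N0 - 2 * M0 * M1)
     (L0 * N2 + L1 * N1 + L2 * N0 - 2 * M0 * M2 - M1\<^sup>2 - l * w * L0 + 2 * l * M0 * F2 + l\<^sup>2 * w)"
    unfolding P_def
    by (rule jet2_coeff_cong[OF jet2_add[OF jet2_add[OF jet2_diff[OF jet2_diff[OF jet2_mult[OF L N] jet2_power2[OF M]]
       jet2_mult[OF kG L]] jet2_cmult[OF jet2_mult[OF kF M]]]
       jet2_diff[OF square[OF square[OF jet2_coeff_cong[OF jet2_mult[OF G E], of 0 0 w]]] jet2_power2[OF kF]]]])
      (simp_all add: algebra_simps power2_eq_square)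
  have EN: "jet2 (\<lambda>u. E u * N u) N0 N1 (N2 + E2 * N0)"
    using jet2_mult[OF E N] by (simp add: algebra_simps)
  have "\<forall>\<^sub>F u in at 0. E u * N u \<noteq> 0"
    by (rule tendsto_imp_eventually_ne[OF tendsto_jet2[OF EN] \<open>N0 \<noteq> 0\<close>])
  with eq have kP: "\<forall>\<^sub>F u in at 0. P u / (E u * N u) = k u"
  proof eventually_elim
    case (elim u)
    then have "P u = k u * (E u * N u)" by (simp add: P_def power2_eq_square algebra_simps)
    then show ?case using elim by simp
  qed
  \<comment> \<open>At order zero l does not occur in P, so this limit identifies l with k0, and l
    can be eliminated from the u^2 coefficient.\<close>
  have "((\<lambda>u. P u / (E u * N u)) \<longlongrightarrow> (L0 * N0 - M0\<^sup>2) / N0) (at 0)"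
    by (intro tendsto_divide tendsto_jet2[OF P] tendsto_jet2[OF EN] \<open>N0 \<noteq> 0\<close>)
  then have "(k \<longlongrightarrow> (L0 * N0 - M0\<^sup>2) / N0) (at 0)" using kP by (rule Lim_transform_eventually)
  moreover have "(L0 * N0 - M0\<^sup>2) / N0 = k0" using 0[symmetric] \<open>N0 \<noteq> 0\<close> by simp
  ultimately have "l = k0" using tendsto_unique[OF _ k] by simp
  with P have "jet2 P (L0 * N0 - M0\<^sup>2) (L0 * N1 + L1 * N0 - 2 * M0 * M1)
     (L0 * N2 + L1 * N1 + L2 * N0 - 2 * M0 * M2 - M1\<^sup>2 - k0 * w * L0 + 2 * k0 * M0 * F2 + k0\<^sup>2 * w)" by simp
  from jet2_divide[OF this EN \<open>N0 \<noteq> 0\<close> 0 1 2] kP show ?thesis by (rule jet2_cong)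
qed

section \<open>Whitney umbrellas in normal form\<close>

text \<open>A formula for g is required only on the line through the point. Its companion can thus
  compute \<theta>-derivatives from formulas known only on r = 0.\<close>

lemma partial1_eqI:
  assumes "open S" "(u, v) \<in> S" "g differentiable (at (u, v))"
    and "\<And>s. (s, v) \<in> S \<Longrightarrow> g (s, v) = G s" "(G has_vector_derivative D) (at u)"
  shows "partial1 g (u, v) = D"
proof -
  have "open ((\<lambda>s. (s, v)) -` S)"
    by (rule open_vimage[OF assms(1)]) (intro continuous_intros)
  from has_vector_derivative_transform_within_open[OF assms(5) this]
  have "((\<lambda>s. g (s, v)) has_vector_derivative D) (at u)" using assms(2,4) by auto
  then show ?thesis
    using has_vector_derivative_partial1[OF assms(3)] vector_derivative_unique_at by blast
qed

lemma partial2_eqI: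
  assumes "open S" "(u, v) \<in> S" "g differentiable (at (u, v))"
    and "\<And>s. (u, s) \<in> S \<Longrightarrow> g (u, s) = G s" "(G has_vector_derivative D) (at v)"
  shows "partial2 g (u, v) = D"
proof -
  have "open ((\<lambda>s. (u, s)) -` S)"
    by (rule open_vimage[OF assms(1)]) (intro continuous_intros)
  from has_vector_derivative_transform_within_open[OF assms(5) this]
  have "((\<lambda>s. g (u, s)) has_vector_derivative D) (at v)" using assms(2,4) by auto
  then show ?thesis
    using has_vector_derivative_partial2[OF assms(3)] vector_derivative_unique_at by blast
qed

locale umbrella_germ = umbrella_jet x for x +
  fixes f :: "real \<times> real \<Rightarrow> real^3" and f21 f31 f321 :: "real \<Rightarrow> real"
    and f322 :: "real \<times> real \<Rightarrow> real" and f331 :: "real \<Rightarrow> real"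
  assumes normal_form: "normal_form f f21 f31 f321 f322 f331"
    and x_eq: "x = jets f21 f31 f321 f322 f331"
    and smooth_germ_f: "smooth_germ f 0"
begin

lemma smooth_germs:
  "smooth_germ f21 0" "smooth_germ f31 0" "smooth_germ f321 0" "smooth_germ f322 0" "smooth_germ f331 0"
  using normal_form by (auto simp: normal_form_def)

lemma jet_coords:
  "f21 0 = a0" "deriv f21 0 = a1" "deriv (deriv f21) 0 / 2 = a2"
  "f31 0 = b0" "deriv f31 0 = b1" "deriv (deriv f31) 0 / 2 = b2"
  "f321 0 = c0" "deriv f321 0 = c1"
  "f322 0 = d0" "partial1 f322 0 = d1" "partial2 f322 0 = d2"
  "f331 0 = e0" "deriv f331 0 = e1" "deriv (deriv f331) 0 / 2 = e2"
  unfolding a0_def a1_def a2_def b0_def b1_def b2_def c0_def c1_def d0_def d1_def d2_def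
    e0_def e1_def e2_def
  unfolding x_eq jets_def by simp_all

lemma e0_pos: "e0 > 0"
  using normal_form by (simp add: normal_form_def jet_coords)

text \<open>All formulas are established on one common neighbourhood, because the second derivatives
  are obtained by differentiating the formulas for the first ones.\<close>

lemma normal_form_partials:
  "\<forall>\<^sub>F p in nhds 0. case p of (u, y) \<Rightarrow>
     f (u, y) = vector [u, u\<^sup>2 * f21 u + y\<^sup>2,
       u\<^sup>2 * f31 u + y\<^sup>2 * (u * f321 u + y * f322 (u, y)) + u * y * f331 u] \<and>
     partial1 f (u, y) = vector [1, 2 * u * f21 u + u\<^sup>2 * deriv f21 u,
       2 * u * f31 u + u\<^sup>2 * deriv f31 u + y\<^sup>2 * (f321 u + u * deriv f321 u + y * partial1 f322 (u, y))
       + y * (f331 u + u * deriv f331 u)] \<and>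
     partial2 f (u, y) = vector [0, 2 * y,
       2 * y * (u * f321 u + y * f322 (u, y)) + y\<^sup>2 * (f322 (u, y) + y * partial2 f322 (u, y)) + u * f331 u] \<and>
     partial1 (partial1 f) (u, y) = vector [0, 2 * f21 u + 4 * u * deriv f21 u + u\<^sup>2 * deriv (deriv f21) u,
       2 * f31 u + 4 * u * deriv f31 u + u\<^sup>2 * deriv (deriv f31) u
       + y\<^sup>2 * (2 * deriv f321 u + u * deriv (deriv f321) u + y * partial1 (partial1 f322) (u, y))
       + y * (2 * deriv f331 u + u * deriv (deriv f331) u)] \<and>
     partial1 (partial2 f) (u, y) = vector [0, 0,
       2 * y * (f321 u + u * deriv f321 u + y * partial1 f322 (u, y))
       + y\<^sup>2 * (partial1 f322 (u, y) + y * partial1 (partial2 f322) (u, y)) + f331 u + u * deriv f331 u] \<and>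
     partial2 (partial2 f) (u, y) = vector [0, 2,
       2 * (u * f321 u + y * f322 (u, y)) + 4 * y * (f322 (u, y) + y * partial2 f322 (u, y))
       + y\<^sup>2 * (2 * partial2 f322 (u, y) + y * partial2 (partial2 f322) (u, y))]"
proof -
  have deriv1: "\<forall>\<^sub>F p in nhds (0 :: real \<times> real). (g has_real_derivative deriv g (fst p)) (at (fst p)) \<and>
      (deriv g has_real_derivative deriv (deriv g) (fst p)) (at (fst p))"
    if "smooth_germ g 0" for g
  proof -
    have "filterlim fst (nhds 0) (nhds (0 :: real \<times> real))"
      using tendsto_fst[OF tendsto_ident_at[of "0 :: real \<times> real" UNIV]]
        tendsto_at_iff_tendsto_nhds[of fst "0 :: real \<times> real"] by simp
    from eventually_compose_filterlim[OF eventually_conj[OF smooth_germ_has_real_derivative[OF that]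
       smooth_germ_has_real_derivative[OF smooth_germ_deriv[OF that]]] this]
    show ?thesis .
  qed
  have diff: "\<forall>\<^sub>F p in nhds (0 :: real \<times> real). g differentiable (at p) \<and>
      partial1 g differentiable (at p) \<and> partial2 g differentiable (at p)"
    if "smooth_germ g 0" for g :: "real \<times> real \<Rightarrow> 'b::real_normed_vector"
    by (intro eventually_conj smooth_germ_differentiable smooth_germ_partials that)
  have nf: "\<forall>\<^sub>F p in nhds 0. f p = vector [fst p, (fst p)\<^sup>2 * f21 (fst p) + (snd p)\<^sup>2,
       (fst p)\<^sup>2 * f31 (fst p) + (snd p)\<^sup>2 * (fst p * f321 (fst p) + snd p * f322 p) + fst p * snd p * f331 (fst p)]"
    using normal_form by (auto simp: normal_form_def case_prod_unfold)
  from eventually_conj[OF nf eventually_conj[OF diff[OF smooth_germ_f] eventually_conj[OF diff[OF smooth_germs(4)]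
    eventually_conj[OF deriv1[OF smooth_germs(1)] eventually_conj[OF deriv1[OF smooth_germs(2)]
    eventually_conj[OF deriv1[OF smooth_germs(3)] deriv1[OF smooth_germs(5)]]]]]]]
  obtain S where S: "open S" "0 \<in> S"
    and nf: "\<And>u y. (u, y) \<in> S \<Longrightarrow> f (u, y) = vector [u, u\<^sup>2 * f21 u + y\<^sup>2,
       u\<^sup>2 * f31 u + y\<^sup>2 * (u * f321 u + y * f322 (u, y)) + u * y * f331 u]"
    and df: "\<And>u y. (u, y) \<in> S \<Longrightarrow> f differentiable (at (u, y))"
      "\<And>u y. (u, y) \<in> S \<Longrightarrow> partial1 f differentiable (at (u, y))"
      "\<And>u y. (u, y) \<in> S \<Longrightarrow> partial2 f differentiable (at (u, y))"
    and dd: "\<And>u y. (u, y) \<in> S \<Longrightarrow> f322 differentiable (at (u, y))"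
      "\<And>u y. (u, y) \<in> S \<Longrightarrow> partial1 f322 differentiable (at (u, y))"
      "\<And>u y. (u, y) \<in> S \<Longrightarrow> partial2 f322 differentiable (at (u, y))"
    and d: "\<And>u y. (u, y) \<in> S \<Longrightarrow> (f21 has_real_derivative deriv f21 u) (at u)"
      "\<And>u y. (u, y) \<in> S \<Longrightarrow> (deriv f21 has_real_derivative deriv (deriv f21) u) (at u)"
      "\<And>u y. (u, y) \<in> S \<Longrightarrow> (f31 has_real_derivative deriv f31 u) (at u)"
      "\<And>u y. (u, y) \<in> S \<Longrightarrow> (deriv f31 has_real_derivative deriv (deriv f31) u) (at u)"
      "\<And>u y. (u, y) \<in> S \<Longrightarrow> (f321 has_real_derivative deriv f321 u) (at u)"
      "\<And>u y. (u, y) \<in> S \<Longrightarrow> (deriv f321 has_real_derivative deriv (deriv f321) u) (at u)"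
      "\<And>u y. (u, y) \<in> S \<Longrightarrow> (f331 has_real_derivative deriv f331 u) (at u)"
      "\<And>u y. (u, y) \<in> S \<Longrightarrow> (deriv f331 has_real_derivative deriv (deriv f331) u) (at u)"
    unfolding eventually_nhds by fastforce
  have p1: "((\<lambda>s. g (s, y)) has_real_derivative partial1 g (u, y)) (at u)"
    and p2: "((\<lambda>s. g (u, s)) has_real_derivative partial2 g (u, y)) (at y)"
    if "g differentiable (at (u, y))" for g :: "real \<times> real \<Rightarrow> real" and u y
    using has_vector_derivative_partial1[OF that] has_vector_derivative_partial2[OF that]
    by (simp_all add: has_real_derivative_iff_has_vector_derivative)
  have P1: "partial1 f (u, y) = vector [1, 2 * u * f21 u + u\<^sup>2 * deriv f21 u,
       2 * u * f31 u + u\<^sup>2 * deriv f31 u + y\<^sup>2 * (f321 u + u * deriv f321 u + y * partial1 f322 (u, y))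
       + y * (f331 u + u * deriv f331 u)]" if uv: "(u, y) \<in> S" for u y
    using S(1) uv df(1)[OF uv] nf
  proof (rule partial1_eqI)
    note D = d[OF uv] p1[OF dd(1)[OF uv]]
    show "((\<lambda>s. vector [s, s\<^sup>2 * f21 s + y\<^sup>2, s\<^sup>2 * f31 s + y\<^sup>2 * (s * f321 s + y * f322 (s, y)) + s * y * f331 s]
      :: real^3) has_vector_derivative vector [1, 2 * u * f21 u + u\<^sup>2 * deriv f21 u,
       2 * u * f31 u + u\<^sup>2 * deriv f31 u + y\<^sup>2 * (f321 u + u * deriv f321 u + y * partial1 f322 (u, y))
       + y * (f331 u + u * deriv f331 u)]) (at u)"
      by (rule has_vector_derivative_real3[OF _ _ _ refl], unfold vector_3)
        (auto intro!: derivative_eq_intros D simp: algebra_simps power2_eq_square)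
  qed
  have P2: "partial2 f (u, y) = vector [0, 2 * y,
       2 * y * (u * f321 u + y * f322 (u, y)) + y\<^sup>2 * (f322 (u, y) + y * partial2 f322 (u, y)) + u * f331 u]"
    if uv: "(u, y) \<in> S" for u y
    using S(1) uv df(1)[OF uv] nf
  proof (rule partial2_eqI)
    note D = p2[OF dd(1)[OF uv]]
    show "((\<lambda>s. vector [u, u\<^sup>2 * f21 u + s\<^sup>2, u\<^sup>2 * f31 u + s\<^sup>2 * (u * f321 u + s * f322 (u, s)) + u * s * f331 u]
      :: real^3) has_vector_derivative vector [0, 2 * y,
       2 * y * (u * f321 u + y * f322 (u, y)) + y\<^sup>2 * (f322 (u, y) + y * partial2 f322 (u, y)) + u * f331 u]) (at y)"
      by (rule has_vector_derivative_real3[OF _ _ _ refl], unfold vector_3)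
        (auto intro!: derivative_eq_intros D simp: algebra_simps power2_eq_square)
  qed
  have P11: "partial1 (partial1 f) (u, y) = vector [0, 2 * f21 u + 4 * u * deriv f21 u + u\<^sup>2 * deriv (deriv f21) u,
       2 * f31 u + 4 * u * deriv f31 u + u\<^sup>2 * deriv (deriv f31) u
       + y\<^sup>2 * (2 * deriv f321 u + u * deriv (deriv f321) u + y * partial1 (partial1 f322) (u, y))
       + y * (2 * deriv f331 u + u * deriv (deriv f331) u)]" if uv: "(u, y) \<in> S" for u y
    using S(1) uv df(2)[OF uv] P1
  proof (rule partial1_eqI)
    note D = d[OF uv] p1[OF dd(2)[OF uv]]
    show "((\<lambda>s. vector [1, 2 * s * f21 s + s\<^sup>2 * deriv f21 s,
       2 * s * f31 s + s\<^sup>2 * deriv f31 s + y\<^sup>2 * (f321 s + s * deriv f321 s + y * partial1 f322 (s, y))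
       + y * (f331 s + s * deriv f331 s)] :: real^3) has_vector_derivative
      vector [0, 2 * f21 u + 4 * u * deriv f21 u + u\<^sup>2 * deriv (deriv f21) u,
       2 * f31 u + 4 * u * deriv f31 u + u\<^sup>2 * deriv (deriv f31) u
       + y\<^sup>2 * (2 * deriv f321 u + u * deriv (deriv f321) u + y * partial1 (partial1 f322) (u, y))
       + y * (2 * deriv f331 u + u * deriv (deriv f331) u)]) (at u)"
      by (rule has_vector_derivative_real3[OF _ _ _ refl], unfold vector_3)
        (auto intro!: derivative_eq_intros D simp: algebra_simps power2_eq_square)
  qed
  have P12: "partial1 (partial2 f) (u, y) = vector [0, 0,
       2 * y * (f321 u + u * deriv f321 u + y * partial1 f322 (u, y))
       + y\<^sup>2 * (partial1 f322 (u, y) + y * partial1 (partial2 f322) (u, y)) + f331 u + u * deriv f331 u]"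
    if uv: "(u, y) \<in> S" for u y
    using S(1) uv df(3)[OF uv] P2
  proof (rule partial1_eqI)
    note D = d[OF uv] p1[OF dd(1)[OF uv]] p1[OF dd(3)[OF uv]]
    show "((\<lambda>s. vector [0, 2 * y, 2 * y * (s * f321 s + y * f322 (s, y))
       + y\<^sup>2 * (f322 (s, y) + y * partial2 f322 (s, y)) + s * f331 s] :: real^3) has_vector_derivative
      vector [0, 0, 2 * y * (f321 u + u * deriv f321 u + y * partial1 f322 (u, y))
       + y\<^sup>2 * (partial1 f322 (u, y) + y * partial1 (partial2 f322) (u, y)) + f331 u + u * deriv f331 u]) (at u)"
      by (rule has_vector_derivative_real3[OF _ _ _ refl], unfold vector_3)
        (auto intro!: derivative_eq_intros D simp: algebra_simps power2_eq_square)
  qed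
  have P22: "partial2 (partial2 f) (u, y) = vector [0, 2,
       2 * (u * f321 u + y * f322 (u, y)) + 4 * y * (f322 (u, y) + y * partial2 f322 (u, y))
       + y\<^sup>2 * (2 * partial2 f322 (u, y) + y * partial2 (partial2 f322) (u, y))]"
    if uv: "(u, y) \<in> S" for u y
    using S(1) uv df(3)[OF uv] P2
  proof (rule partial2_eqI)
    note D = p2[OF dd(1)[OF uv]] p2[OF dd(3)[OF uv]]
    show "((\<lambda>s. vector [0, 2 * s, 2 * s * (u * f321 u + s * f322 (u, s))
       + s\<^sup>2 * (f322 (u, s) + s * partial2 f322 (u, s)) + u * f331 u] :: real^3) has_vector_derivative
      vector [0, 2,
       2 * (u * f321 u + y * f322 (u, y)) + 4 * y * (f322 (u, y) + y * partial2 f322 (u, y))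
       + y\<^sup>2 * (2 * partial2 f322 (u, y) + y * partial2 (partial2 f322) (u, y))]) (at y)"
      by (rule has_vector_derivative_real3[OF _ _ _ refl], unfold vector_3)
        (auto intro!: derivative_eq_intros D simp: algebra_simps power2_eq_square)
  qed
  have "\<forall>\<^sub>F p in nhds 0. p \<in> S" using S by (rule eventually_nhds_in_open)
  then show ?thesis
    by (rule eventually_mono) (use nf P1 P2 P11 P12 P22 in blast)
qed

end

section \<open>Expansion along a ray\<close>

lemmas jet2_intros = jet2_const jet2_ident jet2_add jet2_diff jet2_mult jet2_power2 jet2_uminus

context umbrella_germ
begin

text \<open>Entries at (u, t u): f_u = (1, y, x), f_v = (0, 2 t u, u g), f_uu = (0, yy, xx), f_uv =
  (0, 0, m), f_vv = (0, 2, n), while f2 and f3 are coordinates of f. Writing f_v with the factor u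
  taken out makes the normal regular on the divisor.\<close>

definition "ray_f2 t u = u\<^sup>2 * f21 u + (t * u)\<^sup>2"
definition "ray_f3 t u = u\<^sup>2 * f31 u + (t * u)\<^sup>2 * (u * f321 u + t * u * f322 (u, t * u)) + u * (t * u) * f331 u"
definition "ray_y u = 2 * u * f21 u + u\<^sup>2 * deriv f21 u"
definition "ray_x t u = 2 * u * f31 u + u\<^sup>2 * deriv f31 u
  + (t * u)\<^sup>2 * (f321 u + u * deriv f321 u + t * u * partial1 f322 (u, t * u))
  + t * u * (f331 u + u * deriv f331 u)"
definition "ray_g t u = 2 * t * (u * f321 u + t * u * f322 (u, t * u))
  + t\<^sup>2 * u * (f322 (u, t * u) + t * u * partial2 f322 (u, t * u)) + f331 u"
definition "ray_yy u = 2 * f21 u + 4 * u * deriv f21 u + u\<^sup>2 * deriv (deriv f21) u"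
definition "ray_xx t u = 2 * f31 u + 4 * u * deriv f31 u + u\<^sup>2 * deriv (deriv f31) u
  + (t * u)\<^sup>2 * (2 * deriv f321 u + u * deriv (deriv f321) u + t * u * partial1 (partial1 f322) (u, t * u))
  + t * u * (2 * deriv f331 u + u * deriv (deriv f331) u)"
definition "ray_m t u = 2 * (t * u) * (f321 u + u * deriv f321 u + t * u * partial1 f322 (u, t * u))
  + (t * u)\<^sup>2 * (partial1 f322 (u, t * u) + t * u * partial1 (partial2 f322) (u, t * u))
  + f331 u + u * deriv f331 u"
definition "ray_n t u = 2 * (u * f321 u + t * u * f322 (u, t * u))
  + 4 * (t * u) * (f322 (u, t * u) + t * u * partial2 f322 (u, t * u))
  + (t * u)\<^sup>2 * (2 * partial2 f322 (u, t * u) + t * u * partial2 (partial2 f322) (u, t * u))"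

lemma ray_partials:
  "\<forall>\<^sub>F u in at 0.
     f (u, t * u) = vector [u, ray_f2 t u, ray_f3 t u] \<and>
     partial1 f (u, t * u) = vector [1, ray_y u, ray_x t u] \<and>
     partial2 f (u, t * u) = vector [0, 2 * t * u, u * ray_g t u] \<and>
     partial1 (partial1 f) (u, t * u) = vector [0, ray_yy u, ray_xx t u] \<and>
     partial1 (partial2 f) (u, t * u) = vector [0, 0, ray_m t u] \<and>
     partial2 (partial2 f) (u, t * u) = vector [0, 2, ray_n t u]"
proof -
  have "filterlim (\<lambda>u. (u, t * u)) (nhds 0) (at (0::real))"
  proof -
    have "((\<lambda>u. (u, t * u)) \<longlongrightarrow> (0, t * 0)) (at (0::real))" by (intro tendsto_intros)
    then show ?thesis by (simp add: zero_prod_def)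
  qed
  from eventually_compose_filterlim[OF normal_form_partials this]
  show ?thesis
    by (rule eventually_mono)
      (auto simp: ray_f2_def ray_f3_def ray_y_def ray_x_def ray_g_def ray_yy_def ray_xx_def ray_m_def ray_n_def
        algebra_simps power2_eq_square)
qed

lemma jet2_germs:
  "\<exists>c. jet2 (deriv f21) a1 (2 * a2) c" "\<exists>b c. jet2 (deriv (deriv f21)) (2 * a2) b c"
  "\<exists>c. jet2 (deriv f31) b1 (2 * b2) c" "\<exists>b c. jet2 (deriv (deriv f31)) (2 * b2) b c"
  "\<exists>c. jet2 f321 c0 c1 c" "\<exists>b c. jet2 (deriv f321) c1 b c" "\<exists>a b c. jet2 (deriv (deriv f321)) a b c"
  "\<exists>c. jet2 (deriv f331) e1 (2 * e2) c" "\<exists>b c. jet2 (deriv (deriv f331)) (2 * e2) b c"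
  "jet2 f21 a0 a1 a2" "jet2 f31 b0 b1 b2" "jet2 f331 e0 e1 e2"
  using smooth_germs(1,2,3,5)[THEN jet2_smooth_germ]
    smooth_germs(1,2,3,5)[THEN smooth_germ_deriv, THEN jet2_smooth_germ]
    smooth_germs(1,2,3,5)[THEN smooth_germ_deriv, THEN smooth_germ_deriv, THEN jet2_smooth_germ]
    jet_coords by (auto simp: field_simps)

lemma jet2_germs_ray:
  "\<exists>c. jet2 (\<lambda>u. f322 (u, t * u)) d0 (d1 + t * d2) c"
  "\<exists>b c. jet2 (\<lambda>u. partial1 f322 (u, t * u)) d1 b c" "\<exists>b c. jet2 (\<lambda>u. partial2 f322 (u, t * u)) d2 b c"
  "\<exists>a b c. jet2 (\<lambda>u. partial1 (partial1 f322) (u, t * u)) a b c"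
  "\<exists>a b c. jet2 (\<lambda>u. partial1 (partial2 f322) (u, t * u)) a b c"
  "\<exists>a b c. jet2 (\<lambda>u. partial2 (partial2 f322) (u, t * u)) a b c"
  using jet2_ray[OF smooth_germs(4), of t] jet2_ray[OF smooth_germ_partials(1)[OF smooth_germs(4)], of t]
    jet2_ray[OF smooth_germ_partials(2)[OF smooth_germs(4)], of t]
    jet2_ray[OF smooth_germ_partials(1)[OF smooth_germ_partials(1)[OF smooth_germs(4)]], of t]
    jet2_ray[OF smooth_germ_partials(1)[OF smooth_germ_partials(2)[OF smooth_germs(4)]], of t]
    jet2_ray[OF smooth_germ_partials(2)[OF smooth_germ_partials(2)[OF smooth_germs(4)]], of t]
  unfolding jet_coords by blast+

text \<open>Each expansion is synthesised along the syntax of the ray function, with coefficients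
  left schematic; only afterwards are they compared with the stated ones.\<close>

lemma jet2_ray_coeffs:
  shows "jet2 (ray_f2 t) 0 0 (a0 + t\<^sup>2)"
    and "jet2 (ray_f3 t) 0 0 (b0 + t * e0)"
    and "jet2 ray_y 0 (2 * a0) (3 * a1)"
    and "jet2 (ray_x t) 0 (2 * b0 + t * e0) (3 * b1 + t\<^sup>2 * c0 + 2 * t * e1)"
    and "jet2 (ray_g t) e0 (poly g1 t) (poly g2 t)"
    and "jet2 ray_yy (2 * a0) (6 * a1) (12 * a2)"
    and "jet2 (ray_xx t) (2 * b0) (6 * b1 + 2 * t * e1) (12 * b2 + 2 * t\<^sup>2 * c1 + 6 * t * e2)"
    and "jet2 (ray_m t) e0 (2 * t * c0 + 2 * e1) (4 * t * c1 + 3 * t\<^sup>2 * d1 + 3 * e2)"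
    and "jet2 (ray_n t) 0 (2 * c0 + 6 * t * d0) (2 * c1 + 6 * t * d1 + 12 * t\<^sup>2 * d2)"
proof -
  obtain r1 where J1: "jet2 (deriv f21) a1 (2 * a2) r1"
    using jet2_germs(1) by blast
  obtain r2 r3 where J2: "jet2 (deriv (deriv f21)) (2 * a2) r2 r3"
    using jet2_germs(2) by blast
  obtain r4 where J3: "jet2 (deriv f31) b1 (2 * b2) r4"
    using jet2_germs(3) by blast
  obtain r5 r6 where J4: "jet2 (deriv (deriv f31)) (2 * b2) r5 r6"
    using jet2_germs(4) by blast
  obtain r7 where J5: "jet2 f321 c0 c1 r7"
    using jet2_germs(5) by blast
  obtain r8 r9 where J6: "jet2 (deriv f321) c1 r8 r9"
    using jet2_germs(6) by blast
  obtain r10 r11 r12 where J7: "jet2 (deriv (deriv f321)) r10 r11 r12"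
    using jet2_germs(7) by blast
  obtain r13 where J8: "jet2 (deriv f331) e1 (2 * e2) r13"
    using jet2_germs(8) by blast
  obtain r14 r15 where J9: "jet2 (deriv (deriv f331)) (2 * e2) r14 r15"
    using jet2_germs(9) by blast
  obtain s1 where J10: "jet2 (\<lambda>u. f322 (u, t * u)) d0 (d1 + t * d2) s1"
    using jet2_germs_ray(1)[of t] by blast
  obtain s2 s3 where J11: "jet2 (\<lambda>u. partial1 f322 (u, t * u)) d1 s2 s3"
    using jet2_germs_ray(2)[of t] by blast
  obtain s4 s5 where J12: "jet2 (\<lambda>u. partial2 f322 (u, t * u)) d2 s4 s5"
    using jet2_germs_ray(3)[of t] by blast
  obtain s6 s7 s8 where J13: "jet2 (\<lambda>u. partial1 (partial1 f322) (u, t * u)) s6 s7 s8"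
    using jet2_germs_ray(4)[of t] by blast
  obtain s9 s10 s11 where J14: "jet2 (\<lambda>u. partial1 (partial2 f322) (u, t * u)) s9 s10 s11"
    using jet2_germs_ray(5)[of t] by blast
  obtain s12 s13 s14 where J15: "jet2 (\<lambda>u. partial2 (partial2 f322) (u, t * u)) s12 s13 s14"
    using jet2_germs_ray(6)[of t] by blast
  note J = J1 J2 J3 J4 J5 J6 J7 J8 J9 J10 J11 J12 J13 J14 J15
    jet2_germs(10-12) jet2_intros
  show "jet2 (ray_f2 t) 0 0 (a0 + t\<^sup>2)"
    unfolding ray_f2_def[abs_def] by (rule jet2_coeff_cong, (rule J)+) (simp_all add: power2_eq_square)
  show "jet2 (ray_f3 t) 0 0 (b0 + t * e0)"
    unfolding ray_f3_def[abs_def] by (rule jet2_coeff_cong, (rule J)+) (simp_all add: power2_eq_square)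
  show "jet2 ray_y 0 (2 * a0) (3 * a1)"
    unfolding ray_y_def[abs_def] by (rule jet2_coeff_cong, (rule J)+) (simp_all add: power2_eq_square)
  show "jet2 (ray_x t) 0 (2 * b0 + t * e0) (3 * b1 + t\<^sup>2 * c0 + 2 * t * e1)"
    unfolding ray_x_def[abs_def] by (rule jet2_coeff_cong, (rule J)+) (simp_all add: power2_eq_square algebra_simps)
  show "jet2 (ray_g t) e0 (poly g1 t) (poly g2 t)"
    unfolding ray_g_def[abs_def] by (rule jet2_coeff_cong, (rule J)+)
      (simp_all add: power2_eq_square algebra_simps g1_def g2_def)
  show "jet2 ray_yy (2 * a0) (6 * a1) (12 * a2)"
    unfolding ray_yy_def[abs_def] by (rule jet2_coeff_cong, (rule J)+) (simp_all add: power2_eq_square)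
  show "jet2 (ray_xx t) (2 * b0) (6 * b1 + 2 * t * e1) (12 * b2 + 2 * t\<^sup>2 * c1 + 6 * t * e2)"
    unfolding ray_xx_def[abs_def] by (rule jet2_coeff_cong, (rule J)+) (simp_all add: power2_eq_square algebra_simps)
  show "jet2 (ray_m t) e0 (2 * t * c0 + 2 * e1) (4 * t * c1 + 3 * t\<^sup>2 * d1 + 3 * e2)"
    unfolding ray_m_def[abs_def] by (rule jet2_coeff_cong, (rule J)+) (simp_all add: power2_eq_square algebra_simps)
  show "jet2 (ray_n t) 0 (2 * c0 + 6 * t * d0) (2 * c1 + 6 * t * d1 + 12 * t\<^sup>2 * d2)"
    unfolding ray_n_def[abs_def] by (rule jet2_coeff_cong, (rule J)+) (simp_all add: power2_eq_square algebra_simps)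
qed

definition ray_W :: "real \<Rightarrow> real \<Rightarrow> real^3" where
  "ray_W t u = vector [ray_y u * ray_g t u - 2 * t * ray_x t u, - ray_g t u, 2 * t]"

text \<open>That - k0 reappears as first-order coefficient makes the first coordinate of
  \<open>A1\<close> equal to 1 - k0^2 / w = v / w.\<close>

lemma jet2_ray_W:
  "jet2 (\<lambda>u. ray_W t u $ 1) 0 (- poly k0 t) (poly x2 t)"
  "jet2 (\<lambda>u. ray_W t u $ 2) (- e0) (- poly g1 t) (- poly g2 t)"
  "jet2 (\<lambda>u. ray_W t u $ 3) (2 * t) 0 0"
  unfolding ray_W_def vector_3
  by (rule jet2_coeff_cong, (rule jet2_ray_coeffs jet2_intros)+;
      simp add: k0_def x2_def g1_def algebra_simps power2_eq_square)+

lemma jet2_ray_W_norm: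
  "jet2 (\<lambda>u. ray_W t u \<bullet> ray_W t u) (poly w t) (2 * e0 * poly g1 t)
     ((poly k0 t)\<^sup>2 + (poly g1 t)\<^sup>2 + 2 * e0 * poly g2 t)"
  unfolding inner_real3
  by (rule jet2_coeff_cong, (rule jet2_ray_W jet2_intros)+; simp add: poly_w power2_eq_square algebra_simps)

text \<open>Since g is nonzero, the two orthogonality conditions fix n up to a factor s, and the
  length fixes s^2; the sign stays open.\<close>

lemma unit_normal_ray:
  fixes n :: "real^3"
  assumes n: "norm n = 1" "n \<bullet> vector [1, y, X] = 0" "n \<bullet> vector [0, 2 * t * u, u * g] = 0"
    and "u \<noteq> 0" "g \<noteq> 0" and W: "W = vector [y * g - 2 * t * X, - g, 2 * t]"
  shows "\<exists>s. n = s *\<^sub>R W \<and> s\<^sup>2 * (W \<bullet> W) = 1"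
proof -
  define s where "s = - n $ 2 / g"
  have 2: "n $ 2 = - s * g" using \<open>g \<noteq> 0\<close> by (simp add: s_def)
  have "u * (2 * t * n $ 2 + g * n $ 3) = 0" using n(3) by (simp add: inner_real3 algebra_simps)
  then have "g * n $ 3 = g * (2 * t * s)" using \<open>u \<noteq> 0\<close> by (simp add: 2 algebra_simps)
  then have 3: "n $ 3 = 2 * t * s" using \<open>g \<noteq> 0\<close> by simp
  have "n $ 1 = - y * n $ 2 - X * n $ 3" using n(2) by (simp add: inner_real3 algebra_simps)
  then have 1: "n $ 1 = s * (y * g - 2 * t * X)" by (simp add: 2 3 algebra_simps)
  have nW: "n = s *\<^sub>R W" by (intro real_vec3_eqI) (simp_all add: 1 2 3 W)
  have "n \<bullet> n = 1" using n(1) by (simp add: norm_eq_1)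
  then have "s\<^sup>2 * (W \<bullet> W) = 1" by (simp add: nW power2_eq_square)
  with nW show ?thesis by blast
qed

text \<open>The common sign of \<nu> and \<kappa> could vary with u, but k = \<kappa>\<nu> . W does
  not see it. Convergence of \<kappa>\<nu> makes k bounded and thereby selects the root.\<close>

lemma ray_expansion:
  fixes \<nu> :: "real \<Rightarrow> real^3" and \<kappa> :: "real \<Rightarrow> real"
  assumes ev: "\<forall>\<^sub>F u in at 0. is_unit_normal f (u, t * u) (\<nu> u) \<and>
      is_principal_curvature f (u, t * u) (\<nu> u) (\<kappa> u)"
    and lim: "((\<lambda>u. \<kappa> u *\<^sub>R \<nu> u) \<longlongrightarrow> z) (at 0)"
  shows "jet2 (\<lambda>u. (f (u, t * u) + \<kappa> u *\<^sub>R \<nu> u) $ i) (A0 t $ i) (A1 t $ i) (A2 t $ i)"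
proof -
  define k where "k u = (\<kappa> u *\<^sub>R \<nu> u) \<bullet> ray_W t u" for u
  have w: "poly w t > 0" by (rule poly_w_pos[OF e0_pos])
  have "\<forall>\<^sub>F u in at 0. ray_g t u \<noteq> 0"
    using e0_pos by (intro tendsto_imp_eventually_ne[OF tendsto_jet2[OF jet2_ray_coeffs(5)]]) simp
  with ev ray_partials[of t] eventually_at_0_neq
  have key: "\<forall>\<^sub>F u in at 0.
     (\<kappa> u *\<^sub>R \<nu> u = (k u / (ray_W t u \<bullet> ray_W t u)) *\<^sub>R ray_W t u) \<and>
     ((- ray_g t u * ray_yy u + 2 * t * ray_xx t u) - k u * (1 + (ray_y u)\<^sup>2 + (ray_x t u)\<^sup>2))
       * ((- 2 * ray_g t u + 2 * t * ray_n t u) - k u * (u\<^sup>2 * (4 * t\<^sup>2 + (ray_g t u)\<^sup>2)))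
     = (2 * t * ray_m t u - k u * (u * (2 * t * ray_y u + ray_g t u * ray_x t u)))\<^sup>2"
  proof eventually_elim
    case (elim u)
    let ?W = "ray_W t u"
    obtain s where s: "\<nu> u = s *\<^sub>R ?W" "s\<^sup>2 * (?W \<bullet> ?W) = 1"
      using elim unit_normal_ray[of "\<nu> u" "ray_y u" "ray_x t u" t u "ray_g t u" ?W]
      by (auto simp: is_unit_normal_def ray_W_def)
    have s0: "s \<noteq> 0" "?W \<bullet> ?W \<noteq> 0" using s(2) by auto
    have k: "k u = \<kappa> u * s * (?W \<bullet> ?W)" by (simp add: k_def s(1))
    have 1: "\<kappa> u *\<^sub>R \<nu> u = (k u / (?W \<bullet> ?W)) *\<^sub>R ?W" using s0 by (simp add: k s(1))
    have "k u * s = \<kappa> u * (s\<^sup>2 * (?W \<bullet> ?W))" unfolding k by (simp add: power2_eq_square)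
    then have \<kappa>: "\<kappa> u = s * k u" using s(2) by (simp add: mult.commute)
    define L M N E F G where "L = - ray_g t u * ray_yy u + 2 * t * ray_xx t u"
      and "M = 2 * t * ray_m t u" and "N = - 2 * ray_g t u + 2 * t * ray_n t u"
      and "E = 1 + (ray_y u)\<^sup>2 + (ray_x t u)\<^sup>2" and "F = u * (2 * t * ray_y u + ray_g t u * ray_x t u)"
      and "G = u\<^sup>2 * (4 * t\<^sup>2 + (ray_g t u)\<^sup>2)"
    have II: "second_form f (u, t * u) (\<nu> u) = vector [vector [s * L, s * M], vector [s * M, s * N]]"
      using elim by (simp add: second_form_def s(1) inner_real3 ray_W_def L_def M_def N_def algebra_simps)
    have I: "first_form f (u, t * u) = vector [vector [E, F], vector [F, G]]"
      using elim by (simp add: first_form_def inner_real3 E_def F_def G_def algebra_simps power2_eq_square)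
    have "(s * L - \<kappa> u * E) * (s * N - \<kappa> u * G) - (s * M - \<kappa> u * F)\<^sup>2 = 0"
      using elim by (simp add: is_principal_curvature_def II I det_2 power2_eq_square)
    \<comment> \<open>By \<kappa> = s k, both fundamental forms in the determinant carry the factor
      s, so s^2 cancels and an equation for k with normal W remains.\<close>
    then have "s\<^sup>2 * ((L - k u * E) * (N - k u * G) - (M - k u * F)\<^sup>2) = 0"
      unfolding \<kappa> by (simp add: algebra_simps power2_eq_square)
    with 1 s0 show ?case by (simp add: L_def M_def N_def E_def F_def G_def)
  qed
  have limW: "((\<lambda>u. ray_W t u) \<longlongrightarrow> vector [0, - e0, 2 * t]) (at 0)"
  proof (rule vec_tendstoI)
    fix i :: 3
    show "((\<lambda>u. ray_W t u $ i) \<longlongrightarrow> vector [0, - e0, 2 * t] $ i) (at 0)"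
      using exhaust_3[of i] jet2_ray_W[THEN tendsto_jet2, of t] by auto
  qed
  have limk: "(k \<longlongrightarrow> z \<bullet> vector [0, - e0, 2 * t]) (at 0)"
    unfolding k_def by (intro tendsto_inner lim limW)
  define k2 where "k2 = poly ek2 t / e0"
  have k2: "poly ek2 t = e0 * k2" using e0_pos by (simp add: k2_def)
  have jk: "jet2 k (poly k0 t) (poly k1 t) k2"
  proof (rule bounded_root_expansion)
    show "jet2 (\<lambda>u. 1 + (ray_y u)\<^sup>2 + (ray_x t u)\<^sup>2) 1 0 (4 * a0\<^sup>2 + (2 * b0 + t * e0)\<^sup>2)"
      by (rule jet2_coeff_cong, (rule jet2_ray_coeffs jet2_intros)+; simp add: power2_eq_square)
    show "jet2 (\<lambda>u. u * (2 * t * ray_y u + ray_g t u * ray_x t u)) 0 0 (4 * t * a0 + e0 * (2 * b0 + t * e0))"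
      by (rule jet2_coeff_cong, (rule jet2_ray_coeffs jet2_intros)+; simp add: power2_eq_square)
    show "jet2 (\<lambda>u. u\<^sup>2 * (4 * t\<^sup>2 + (ray_g t u)\<^sup>2)) 0 0 (poly w t)"
      by (rule jet2_coeff_cong, (rule jet2_ray_coeffs jet2_intros)+; simp add: power2_eq_square poly_w)
    show "jet2 (\<lambda>u. - ray_g t u * ray_yy u + 2 * t * ray_xx t u)
       (- 2 * a0 * e0 + 4 * t * b0) (- 6 * e0 * a1 - 2 * a0 * poly g1 t + 2 * t * (6 * b1 + 2 * t * e1))
       (- 12 * e0 * a2 - 6 * a1 * poly g1 t - 2 * a0 * poly g2 t + 2 * t * (12 * b2 + 2 * t\<^sup>2 * c1 + 6 * t * e2))"
      by (rule jet2_coeff_cong, (rule jet2_ray_coeffs jet2_intros)+; simp add: power2_eq_square)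
    show "jet2 (\<lambda>u. 2 * t * ray_m t u) (2 * t * e0) (2 * t * (2 * t * c0 + 2 * e1))
       (2 * t * (4 * t * c1 + 3 * t\<^sup>2 * d1 + 3 * e2))"
      by (rule jet2_coeff_cong, (rule jet2_ray_coeffs jet2_intros)+; simp add: power2_eq_square)
    show "jet2 (\<lambda>u. - 2 * ray_g t u + 2 * t * ray_n t u) (- 2 * e0)
       (- 2 * poly g1 t + 2 * t * (2 * c0 + 6 * t * d0))
       (- 2 * poly g2 t + 2 * t * (2 * c1 + 6 * t * d1 + 12 * t\<^sup>2 * d2))"
      by (rule jet2_coeff_cong, (rule jet2_ray_coeffs jet2_intros)+; simp add: power2_eq_square)
    show "- 2 * e0 \<noteq> 0" using e0_pos by simp
    show "(k \<longlongrightarrow> z \<bullet> vector [0, - e0, 2 * t]) (at 0)" by (rule limk)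
    show "\<forall>\<^sub>F u in at 0.
      ((- ray_g t u * ray_yy u + 2 * t * ray_xx t u) - k u * (1 + (ray_y u)\<^sup>2 + (ray_x t u)\<^sup>2))
       * ((- 2 * ray_g t u + 2 * t * ray_n t u) - k u * (u\<^sup>2 * (4 * t\<^sup>2 + (ray_g t u)\<^sup>2)))
     = (2 * t * ray_m t u - k u * (u * (2 * t * ray_y u + ray_g t u * ray_x t u)))\<^sup>2"
      using key by (auto elim: eventually_mono)
    show "poly k0 t * (- 2 * e0) = (- 2 * a0 * e0 + 4 * t * b0) * (- 2 * e0) - (2 * t * e0)\<^sup>2"
      by (simp add: k0_def algebra_simps power2_eq_square)
    show "poly k0 t * (- 2 * poly g1 t + 2 * t * (2 * c0 + 6 * t * d0)) + poly k1 t * (- 2 * e0) =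
      (- 2 * a0 * e0 + 4 * t * b0) * (- 2 * poly g1 t + 2 * t * (2 * c0 + 6 * t * d0))
      + (- 6 * e0 * a1 - 2 * a0 * poly g1 t + 2 * t * (6 * b1 + 2 * t * e1)) * (- 2 * e0)
      - 2 * (2 * t * e0) * (2 * t * (2 * t * c0 + 2 * e1))"
      by (simp add: k0_def k1_def g1_def algebra_simps power2_eq_square)
    \<comment> \<open>The second-order comparison is first verified with \<open>ek2\<close>, as an
      identity of polynomials without division by e0.\<close>
    have "poly k0 t * (- 2 * poly g2 t + 2 * t * (2 * c1 + 6 * t * d1 + 12 * t\<^sup>2 * d2) + (4 * a0\<^sup>2 + (2 * b0 + t * e0)\<^sup>2) * (- 2 * e0))
       + poly k1 t * (- 2 * poly g1 t + 2 * t * (2 * c0 + 6 * t * d0)) - 2 * poly ek2 t =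
      (- 2 * a0 * e0 + 4 * t * b0) * (- 2 * poly g2 t + 2 * t * (2 * c1 + 6 * t * d1 + 12 * t\<^sup>2 * d2))
      + (- 6 * e0 * a1 - 2 * a0 * poly g1 t + 2 * t * (6 * b1 + 2 * t * e1)) * (- 2 * poly g1 t + 2 * t * (2 * c0 + 6 * t * d0))
      + (- 12 * e0 * a2 - 6 * a1 * poly g1 t - 2 * a0 * poly g2 t + 2 * t * (12 * b2 + 2 * t\<^sup>2 * c1 + 6 * t * e2)) * (- 2 * e0)
      - 2 * (2 * t * e0) * (2 * t * (4 * t * c1 + 3 * t\<^sup>2 * d1 + 3 * e2)) - (2 * t * (2 * t * c0 + 2 * e1))\<^sup>2
      - poly k0 t * poly w t * (- 2 * a0 * e0 + 4 * t * b0)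
      + 2 * poly k0 t * (2 * t * e0) * (4 * t * a0 + e0 * (2 * b0 + t * e0)) + (poly k0 t)\<^sup>2 * poly w t"
      by (simp add: k0_def k1_def g1_def g2_def ek2_def poly_w algebra_simps power2_eq_square)
    then show "poly k0 t * (- 2 * poly g2 t + 2 * t * (2 * c1 + 6 * t * d1 + 12 * t\<^sup>2 * d2) + (4 * a0\<^sup>2 + (2 * b0 + t * e0)\<^sup>2) * (- 2 * e0))
       + poly k1 t * (- 2 * poly g1 t + 2 * t * (2 * c0 + 6 * t * d0)) + k2 * (- 2 * e0) =
      (- 2 * a0 * e0 + 4 * t * b0) * (- 2 * poly g2 t + 2 * t * (2 * c1 + 6 * t * d1 + 12 * t\<^sup>2 * d2))
      + (- 6 * e0 * a1 - 2 * a0 * poly g1 t + 2 * t * (6 * b1 + 2 * t * e1)) * (- 2 * poly g1 t + 2 * t * (2 * c0 + 6 * t * d0))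
      + (- 12 * e0 * a2 - 6 * a1 * poly g1 t - 2 * a0 * poly g2 t + 2 * t * (12 * b2 + 2 * t\<^sup>2 * c1 + 6 * t * e2)) * (- 2 * e0)
      - 2 * (2 * t * e0) * (2 * t * (4 * t * c1 + 3 * t\<^sup>2 * d1 + 3 * e2)) - (2 * t * (2 * t * c0 + 2 * e1))\<^sup>2
      - poly k0 t * poly w t * (- 2 * a0 * e0 + 4 * t * b0)
      + 2 * poly k0 t * (2 * t * e0) * (4 * t * a0 + e0 * (2 * b0 + t * e0)) + (poly k0 t)\<^sup>2 * poly w t"
      unfolding k2 by (simp only: algebra_simps)
  qed
  \<comment> \<open>The expansion of q = k / (W . W), so that h = f + q W.\<close>
  define q0 q1 q2 where "q0 = poly k0 t / poly w t"
    and "q1 = poly k1 t / poly w t - 2 * e0 * poly g1 t * poly k0 t / (poly w t)\<^sup>2"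
    and "q2 = k2 / poly w t - 2 * e0 * poly g1 t * poly k1 t / (poly w t)\<^sup>2
     + poly k0 t * (4 * e0\<^sup>2 * (poly g1 t)\<^sup>2 / poly w t ^ 3
       - ((poly k0 t)\<^sup>2 + (poly g1 t)\<^sup>2 + 2 * e0 * poly g2 t) / (poly w t)\<^sup>2)"
  have jq: "jet2 (\<lambda>u. k u / (ray_W t u \<bullet> ray_W t u)) q0 q1 q2"
    by (rule jet2_divide[OF jk jet2_ray_W_norm])
      (use w in \<open>simp_all add: q0_def q1_def q2_def field_simps power2_eq_square power3_eq_cube\<close>)
  \<comment> \<open>The frame form of \<open>A1\<close>, suited to the degree count, is matched with
    the Cartesian coefficient (1, 0, 0) + q1 W0 + q0 W1.\<close>
  have A1: "A1 t = vector [1 - q0 * poly k0 t, - e0 * q1 - q0 * poly g1 t, 2 * t * q1]"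
  proof -
    have 1: "poly v t / poly w t = 1 - q0 * poly k0 t"
      using w by (simp add: poly_v q0_def field_simps)
    have "- e0 * (poly bet t / (poly w t)\<^sup>2) + 2 * t * (poly gam t / (poly w t)\<^sup>2)
       = (- e0 * poly bet t + 2 * t * poly gam t) / (poly w t)\<^sup>2"
      by (simp add: add_divide_distrib diff_divide_distrib)
    also have "- e0 * poly bet t + 2 * t * poly gam t = - e0 * poly k1 t * poly w t
        + 2 * e0 * e0 * poly g1 t * poly k0 t - poly k0 t * poly g1 t * poly w t"
      by (simp add: poly_bet poly_gam poly_w algebra_simps)
    also have "\<dots> / (poly w t)\<^sup>2 = - e0 * q1 - q0 * poly g1 t"
      using w by (simp add: q0_def q1_def field_simps power2_eq_square)
    finally have 3: "- e0 * (poly bet t / (poly w t)\<^sup>2) + 2 * t * (poly gam t / (poly w t)\<^sup>2) = - e0 * q1 - q0 * poly g1 t" .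
    have "2 * t * (poly bet t / (poly w t)\<^sup>2) + e0 * (poly gam t / (poly w t)\<^sup>2)
       = (2 * t * poly bet t + e0 * poly gam t) / (poly w t)\<^sup>2"
      by (simp add: add_divide_distrib)
    also have "2 * t * poly bet t + e0 * poly gam t = 2 * t * poly k1 t * poly w t - 4 * t * e0 * poly g1 t * poly k0 t"
      by (simp add: poly_bet poly_gam algebra_simps)
    also have "\<dots> / (poly w t)\<^sup>2 = 2 * t * q1"
      using w by (simp add: q1_def field_simps power2_eq_square)
    finally have 4: "2 * t * (poly bet t / (poly w t)\<^sup>2) + e0 * (poly gam t / (poly w t)\<^sup>2) = 2 * t * q1" .
    show ?thesis unfolding A1_def frame_def 1 3 4 ..
  qed
  have A0: "A0 t = vector [0, - e0 * q0, 2 * t * q0]" by (simp add: A0_def frame_def q0_def)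
  have A2: "A2 t = vector [0, a0 + t\<^sup>2, b0 + t * e0] + q2 *\<^sub>R vector [0, - e0, 2 * t]
      + q1 *\<^sub>R vector [- poly k0 t, - poly g1 t, 0] + q0 *\<^sub>R vector [poly x2 t, - poly g2 t, 0]"
    unfolding A2_def q0_def q1_def q2_def k2_def ..
  have "\<forall>\<^sub>F u in at 0. vector [u, ray_f2 t u, ray_f3 t u] $ i
      + k u / (ray_W t u \<bullet> ray_W t u) * ray_W t u $ i = (f (u, t * u) + \<kappa> u *\<^sub>R \<nu> u) $ i"
    using key ray_partials[of t] by eventually_elim simp
  moreover have "jet2 (\<lambda>u. vector [u, ray_f2 t u, ray_f3 t u] $ i + k u / (ray_W t u \<bullet> ray_W t u) * ray_W t u $ i)
      (A0 t $ i) (A1 t $ i) (A2 t $ i)"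
  proof -
    consider "i = 1" | "i = 2" | "i = 3" using exhaust_3[of i] by blast
    then show ?thesis
    proof cases
      case 1
      show ?thesis unfolding 1 A0 A1 A2 vector_3 vector_add_component vector_scaleR_component
        by (rule jet2_coeff_cong, (rule jq jet2_ray_W jet2_ray_coeffs jet2_intros)+) simp_all
    next
      case 2
      show ?thesis unfolding 2 A0 A1 A2 vector_3 vector_add_component vector_scaleR_component
        by (rule jet2_coeff_cong, (rule jq jet2_ray_W jet2_ray_coeffs jet2_intros)+) simp_all
    next
      case 3
      show ?thesis unfolding 3 A0 A1 A2 vector_3 vector_add_component vector_scaleR_component
        by (rule jet2_coeff_cong, (rule jq jet2_ray_W jet2_ray_coeffs jet2_intros)+) simp_all
    qed
  qed
  ultimately show ?thesis by (rule jet2_cong[rotated])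
qed

end

section \<open>The geometry along the exceptional divisor\<close>

lemma polar_eq_iff:
  "polar (r, \<theta>) = polar (r', \<theta>') \<longleftrightarrow>
     (\<exists>k::int. \<theta>' = \<theta> + of_int k * pi \<and> r' = (if even k then r else - r))"
  by (simp add: blowup.abs_eq_iff blowup_rel_def)

lemma polar_0_eq_iff: "polar (r, \<theta>) = polar (0, \<theta>') \<longleftrightarrow> r = 0 \<and> (\<exists>k::int. \<theta>' = \<theta> + of_int k * pi)"
  by (auto simp: polar_eq_iff split: if_splits)

lemma cos_add_int_pi: "cos (\<theta> + of_int k * pi) \<noteq> 0 \<longleftrightarrow> cos \<theta> \<noteq> 0"
  using cos_int_times_real[of k pi] sin_int_times_real[of k pi]
  by (auto simp: cos_add sin_times_pi_eq_0 mult.commute)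

lemma tan_eq_imp_int_pi:
  assumes "cos \<theta> \<noteq> 0" "cos \<theta>' \<noteq> 0" "tan \<theta> = tan \<theta>'"
  shows "\<exists>k::int. \<theta>' = \<theta> + of_int k * pi"
proof -
  have "sin (\<theta>' - \<theta>) = 0"
    using assms by (simp add: sin_diff tan_def field_simps)
  then obtain k :: int where "\<theta>' - \<theta> = of_int k * pi" unfolding sin_zero_iff_int2 ..
  then show ?thesis by (intro exI[of _ k]) simp
qed

lemma blow_down_polar: "blow_down (polar (r, \<theta>)) = (r * cos \<theta>, r * sin \<theta>)"
  by (simp add: blow_down.abs_eq)

lemma polar_in_exceptional0: "polar x \<in> exceptional0 \<longleftrightarrow> fst x = 0 \<and> cos (snd x) \<noteq> 0"
  using cos_add_int_pi by (cases x) (auto simp: exceptional0_def polar_0_eq_iff)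

text \<open>The slope t = tan \<theta> is a bijective coordinate on \<open>exceptional0\<close>,
  where \<theta> matters modulo \<pi>; \<open>arctan\<close> selects the representatives.\<close>

lemma card_curvature_zeros:
  fixes P :: "real poly"
  assumes sing: "singular_points h \<inter> exceptional0 = {}"
    and curv: "\<And>\<theta>. cos \<theta> \<noteq> 0 \<Longrightarrow> curv (h \<circ> polar) (0, \<theta>) = 0 \<longleftrightarrow> poly P (tan \<theta>) = 0"
  shows "curvature_zeros curv h = (\<lambda>t. polar (0, arctan t)) ` {t. poly P t = 0}"
    and "card (curvature_zeros curv h) = card {t. poly P t = 0}"
proof -
  show eq: "curvature_zeros curv h = (\<lambda>t. polar (0, arctan t)) ` {t. poly P t = 0}"
  proof (intro equalityI subsetI)
    fix p assume "p \<in> curvature_zeros curv h"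
    then obtain x where x: "polar x \<in> exceptional0" "p = polar x" "curv (h \<circ> polar) x = 0"
      unfolding curvature_zeros_def by blast
    then obtain \<theta> where \<theta>: "x = (0, \<theta>)" "cos \<theta> \<noteq> 0"
      by (cases x) (simp add: polar_in_exceptional0)
    have "\<exists>k::int. \<theta> = arctan (tan \<theta>) + of_int k * pi"
      using \<theta>(2) cos_arctan_not_zero by (intro tan_eq_imp_int_pi) (auto simp: tan_arctan)
    then have "p = polar (0, arctan (tan \<theta>))" unfolding x(2) \<theta>(1) by (subst eq_commute) (simp add: polar_0_eq_iff)
    moreover have "poly P (tan \<theta>) = 0" using curv[OF \<theta>(2)] x(3) \<theta>(1) by simp
    ultimately show "p \<in> (\<lambda>t. polar (0, arctan t)) ` {t. poly P t = 0}" by blast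
  next
    fix p assume "p \<in> (\<lambda>t. polar (0, arctan t)) ` {t. poly P t = 0}"
    then obtain t where t: "p = polar (0, arctan t)" "poly P t = 0" by blast
    have "p \<in> exceptional0" using cos_arctan_not_zero by (simp add: t(1) polar_in_exceptional0)
    moreover have "curv (h \<circ> polar) (0, arctan t) = 0"
      using curv[OF cos_arctan_not_zero[of t]] t(2) by (simp add: tan_arctan)
    ultimately show "p \<in> curvature_zeros curv h"
      using sing t(1) unfolding curvature_zeros_def by blast
  qed
  have "inj_on (\<lambda>t. polar (0, arctan t)) {t. poly P t = 0}"
  proof (rule inj_onI)
    fix s t assume "polar (0, arctan s) = polar (0, arctan t)"
    then obtain k :: int where "arctan t = arctan s + of_int k * pi" by (auto simp: polar_0_eq_iff)
    then have "tan (arctan t) = tan (arctan s)" using tan_periodic_int[of "arctan s" k] by simp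
    then show "s = t" by (simp add: tan_arctan)
  qed
  then show "card (curvature_zeros curv h) = card {t. poly P t = 0}"
    unfolding eq by (rule card_image)
qed

lemma has_vector_derivative_compose_tan:
  assumes "cos \<theta> \<noteq> 0" "(G has_vector_derivative D) (at (tan \<theta>))"
  shows "((\<lambda>\<theta>. G (tan \<theta>)) has_vector_derivative (1 / (cos \<theta>)\<^sup>2) *\<^sub>R D) (at \<theta>)"
proof -
  have "(tan has_vector_derivative 1 / (cos \<theta>)\<^sup>2) (at \<theta>)"
    using DERIV_tan[OF assms(1)]
    by (simp add: has_real_derivative_iff_has_vector_derivative inverse_eq_divide)
  from vector_diff_chain_at[OF this assms(2)] show ?thesis by (simp add: o_def)
qed

section \<open>Transfer of the ray expansions to the coordinates (r, \<theta>) and count of the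
  zeros\<close>

context umbrella_germ
begin

lemma principal_curvature_surface_jet:
  assumes h: "principal_curvature_surface f h"
  shows "\<exists>T. open T \<and> (\<forall>\<theta>. cos \<theta> \<noteq> 0 \<longrightarrow> (0, \<theta>) \<in> T) \<and> (\<forall>k. Ck_on k T (h \<circ> polar)) \<and>
    (\<forall>\<theta>. cos \<theta> \<noteq> 0 \<longrightarrow>
      (h \<circ> polar) (0, \<theta>) = A0 (tan \<theta>) \<and>
      partial1 (h \<circ> polar) (0, \<theta>) = cos \<theta> *\<^sub>R A1 (tan \<theta>) \<and>
      partial1 (partial1 (h \<circ> polar)) (0, \<theta>) = (2 * (cos \<theta>)\<^sup>2) *\<^sub>R A2 (tan \<theta>))"
proof -
  obtain U \<nu> \<kappa> where U: "open_blowup U" "exceptional0 \<subseteq> U"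
    and sm: "smooth_on_blowup U \<nu>" "smooth_on_blowup U \<kappa>"
    and pc: "\<And>p. p \<in> U - exceptional \<Longrightarrow>
           is_unit_normal f (blow_down p) (\<nu> p) \<and> is_principal_curvature f (blow_down p) (\<nu> p) (\<kappa> p)"
    and hU: "\<And>p. p \<in> U \<Longrightarrow> h p = f (blow_down p) + \<kappa> p *\<^sub>R \<nu> p"
    using h unfolding principal_curvature_surface_def by blast
  obtain S where S: "open S" "0 \<in> S" "\<And>k. Ck_on k S f"
    using smooth_germ_f unfolding smooth_germ_def smooth_on_def by blast
  define B where "B = (\<lambda>p :: real \<times> real. (fst p * cos (snd p), fst p * sin (snd p)))"
  \<comment> \<open>f is smooth only near the origin, so U is cut down to points lying over S; the
    divisor is retained since it is mapped to 0.\<close>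
  define T where "T = polar -` U \<inter> B -` S"
  have oU: "open (polar -` U)" using U(1) by (simp add: open_blowup_def)
  have "open (B -` S)" unfolding B_def
    by (rule open_vimage[OF S(1)]) (intro continuous_intros)
  then have T: "open T" using oU by (auto simp: T_def)
  have T0: "(0, \<theta>) \<in> T" if "cos \<theta> \<noteq> 0" for \<theta>
    using that U(2) S(2) polar_in_exceptional0[of "(0, \<theta>)"] by (auto simp: T_def B_def zero_prod_def)
  have CT: "Ck_on k T (h \<circ> polar)" for k
  proof -
    have "Ck_on k T (\<nu> \<circ> polar)" "Ck_on k T (\<kappa> \<circ> polar)"
      using sm Ck_on_subset[of k "polar -` U" _ T] by (auto simp: smooth_on_blowup_def smooth_on_def T_def)
    moreover have "Ck_on k T (\<lambda>p. f (B p))"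
      unfolding B_def by (rule Ck_on_compose[OF T S(3) Ck_on_subset[OF Ck_on_polar subset_UNIV]])
        (auto simp: T_def B_def)
    ultimately have "Ck_on k T (\<lambda>p. f (B p) + (\<kappa> \<circ> polar) p *\<^sub>R (\<nu> \<circ> polar) p)"
      by (intro Ck_on_add[OF T] Ck_on_bilinear[OF T bounded_bilinear_scaleR])
    then show ?thesis
      by (rule Ck_on_cong[OF T]) (auto simp: T_def hU B_def blow_down_polar)
  qed
  have "(h \<circ> polar) (0, \<theta>) = A0 (tan \<theta>) \<and>
      partial1 (h \<circ> polar) (0, \<theta>) = cos \<theta> *\<^sub>R A1 (tan \<theta>) \<and>
      partial1 (partial1 (h \<circ> polar)) (0, \<theta>) = (2 * (cos \<theta>)\<^sup>2) *\<^sub>R A2 (tan \<theta>)"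
    if c: "cos \<theta> \<noteq> 0" for \<theta>
  proof -
    let ?H = "h \<circ> polar" and ?c = "cos \<theta>" and ?t = "tan \<theta>"
    \<comment> \<open>On the ray of angle \<theta> one has r = u / cos \<theta>, so the ray is
      parametrised by u and blown down to (u, t u).\<close>
    define \<rho> where "\<rho> u = (u / ?c, \<theta>)" for u
    define R where "R = \<rho> -` T"
    have R: "open R" unfolding R_def \<rho>_def
      by (rule open_vimage[OF T]) (auto intro!: continuous_intros simp: c)
    have R0: "0 \<in> R" using T0[OF c] by (simp add: R_def \<rho>_def)
    have B\<rho>: "blow_down (polar (\<rho> u)) = (u, ?t * u)" for u
      using c by (simp add: \<rho>_def blow_down_polar tan_def)
    have evR: "\<forall>\<^sub>F u in at 0. u \<in> R" using R R0 by (rule eventually_at_in_open')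
    have "\<forall>\<^sub>F u in at 0. is_unit_normal f (u, ?t * u) (\<nu> (polar (\<rho> u))) \<and>
        is_principal_curvature f (u, ?t * u) (\<nu> (polar (\<rho> u))) (\<kappa> (polar (\<rho> u)))"
      using evR eventually_at_0_neq
    proof eventually_elim
      case (elim u)
      have "polar (\<rho> u) \<notin> exceptional" using elim c by (auto simp: exceptional_def \<rho>_def polar_0_eq_iff)
      then have "polar (\<rho> u) \<in> U - exceptional" using elim by (auto simp: R_def T_def)
      from pc[OF this] show ?case unfolding B\<rho> .
    qed
    moreover have "((\<lambda>u. \<kappa> (polar (\<rho> u)) *\<^sub>R \<nu> (polar (\<rho> u))) \<longlongrightarrow> \<kappa> (polar (\<rho> 0)) *\<^sub>R \<nu> (polar (\<rho> 0))) (at 0)"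
    proof -
      have 1: "isCont (\<nu> \<circ> polar) (\<rho> 0)" "isCont (\<kappa> \<circ> polar) (\<rho> 0)"
        using sm oU T0[OF c]
        using Ck_on_imp_continuous_on[of 0 "polar -` U" "\<nu> \<circ> polar"] Ck_on_imp_continuous_on[of 0 "polar -` U" "\<kappa> \<circ> polar"]
        by (simp_all only: smooth_on_blowup_def smooth_on_def T_def \<rho>_def continuous_on_eq_continuous_at Int_iff
            div_0)
      have \<rho>: "isCont \<rho> 0" unfolding \<rho>_def using c by (intro continuous_intros) auto
      have "isCont (\<lambda>u. (\<kappa> \<circ> polar) (\<rho> u) *\<^sub>R (\<nu> \<circ> polar) (\<rho> u)) 0"
        by (rule continuous_scaleR[OF isCont_o2[OF \<rho> 1(2)] isCont_o2[OF \<rho> 1(1)]])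
      then show ?thesis by (simp add: isCont_def)
    qed
    ultimately have jet: "jet2 (\<lambda>u. (f (u, ?t * u) + \<kappa> (polar (\<rho> u)) *\<^sub>R \<nu> (polar (\<rho> u))) $ i)
        (A0 ?t $ i) (A1 ?t $ i) (A2 ?t $ i)" for i
      by (rule ray_expansion)
    have jetA: "jet2 (\<lambda>u. ?H (\<rho> u) $ i) (A0 ?t $ i) (A1 ?t $ i) (A2 ?t $ i)" for i
    proof (rule jet2_cong[OF jet])
      show "\<forall>\<^sub>F u in at 0. (f (u, ?t * u) + \<kappa> (polar (\<rho> u)) *\<^sub>R \<nu> (polar (\<rho> u))) $ i = ?H (\<rho> u) $ i"
        using evR by (rule eventually_mono) (simp add: R_def T_def hU B\<rho>)
    qed
    have C2: "Ck_on (Suc (Suc 0)) T ?H" by (rule CT)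
    have d\<rho>: "((\<lambda>u. G (\<rho> u) $ i) has_real_derivative partial1 G (\<rho> u) $ i / ?c) (at u)"
      if "u \<in> R" "Ck_on (Suc 0) T G" for G :: "real \<times> real \<Rightarrow> real^3" and u i
    proof -
      have "G differentiable (at (u / ?c, \<theta>))" using that by (auto simp: R_def \<rho>_def)
      from has_vector_derivative_partial1[OF this]
      have "((\<lambda>s. G (s, \<theta>)) has_vector_derivative partial1 G (\<rho> u)) (at (u / ?c))" by (simp add: \<rho>_def)
      from bounded_linear.has_vector_derivative[OF bounded_linear_vec_nth this]
      have 1: "((\<lambda>s. G (s, \<theta>) $ i) has_real_derivative partial1 G (\<rho> u) $ i) (at (u / ?c))"
        by (simp add: has_real_derivative_iff_has_vector_derivative)
      have 2: "((\<lambda>u. u / ?c) has_real_derivative 1 / ?c) (at u)"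
        using c by (auto intro!: derivative_eq_intros)
      from DERIV_chain2[OF 1 2] show ?thesis by (simp add: \<rho>_def)
    qed
    \<comment> \<open>The Taylor expansion of the smooth map h along the same ray; uniqueness of
      two-jets equates its derivatives with \<open>A0\<close>, \<open>A1\<close>,
      \<open>A2\<close>.\<close>
    have "jet2 (\<lambda>u. ?H (\<rho> u) $ i) (?H (\<rho> 0) $ i) (partial1 ?H (\<rho> 0) $ i / ?c)
        (partial1 (partial1 ?H) (\<rho> 0) $ i / ?c / ?c / 2)" for i
    proof (rule jet2_Taylor[OF R R0])
      show "((\<lambda>u. ?H (\<rho> u) $ i) has_real_derivative partial1 ?H (\<rho> u) $ i / ?c) (at u)" if "u \<in> R" for u
        by (rule d\<rho>[OF that CT])
      show "((\<lambda>u. partial1 ?H (\<rho> u) $ i / ?c) has_real_derivative partial1 (partial1 ?H) (\<rho> 0) $ i / ?c / ?c) (at 0)"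
        by (rule DERIV_cdivide[OF d\<rho>[OF R0 Ck_on_partial1[OF C2]]])
    qed
    from jet2_unique[OF this jetA]
    have "?H (\<rho> 0) $ i = A0 ?t $ i \<and> partial1 ?H (\<rho> 0) $ i = ?c * A1 ?t $ i \<and>
        partial1 (partial1 ?H) (\<rho> 0) $ i = 2 * ?c\<^sup>2 * A2 ?t $ i" for i
      using c by (simp add: field_simps power2_eq_square)
    then show ?thesis
      by (simp add: Finite_Cartesian_Product.vec_eq_iff \<rho>_def)
  qed
  with T T0 CT show ?thesis by (intro exI[of _ T]) simp
qed

lemma principal_curvature_surface_partials:
  assumes h: "principal_curvature_surface f h" and c: "cos \<theta> \<noteq> 0"
  shows "(h \<circ> polar) differentiable (at (0, \<theta>))"
    and "partial1 (h \<circ> polar) (0, \<theta>) = cos \<theta> *\<^sub>R A1 (tan \<theta>)"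
    and "partial2 (h \<circ> polar) (0, \<theta>) = (1 / (cos \<theta>)\<^sup>2) *\<^sub>R A0' (tan \<theta>)"
    and "partial1 (partial1 (h \<circ> polar)) (0, \<theta>) = (2 * (cos \<theta>)\<^sup>2) *\<^sub>R A2 (tan \<theta>)"
    and "partial1 (partial2 (h \<circ> polar)) (0, \<theta>) = (1 / cos \<theta>) *\<^sub>R A1' (tan \<theta>) - sin \<theta> *\<^sub>R A1 (tan \<theta>)"
    and "partial2 (partial2 (h \<circ> polar)) (0, \<theta>) =
      (1 / cos \<theta> ^ 4) *\<^sub>R A0'' (tan \<theta>) + (2 * sin \<theta> / cos \<theta> ^ 3) *\<^sub>R A0' (tan \<theta>)"
proof -
  let ?H = "h \<circ> polar"
  obtain T where T: "open T" "\<And>\<theta>. cos \<theta> \<noteq> 0 \<Longrightarrow> (0, \<theta>) \<in> T" "\<And>k. Ck_on k T ?H"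
    and H0: "\<And>\<theta>. cos \<theta> \<noteq> 0 \<Longrightarrow> ?H (0, \<theta>) = A0 (tan \<theta>)"
    and H1: "\<And>\<theta>. cos \<theta> \<noteq> 0 \<Longrightarrow> partial1 ?H (0, \<theta>) = cos \<theta> *\<^sub>R A1 (tan \<theta>)"
    and H11: "\<And>\<theta>. cos \<theta> \<noteq> 0 \<Longrightarrow> partial1 (partial1 ?H) (0, \<theta>) = (2 * (cos \<theta>)\<^sup>2) *\<^sub>R A2 (tan \<theta>)"
    using principal_curvature_surface_jet[OF h] by metis
  define S where "S = {p :: real \<times> real. cos (snd p) \<noteq> 0}"
  have "S = (\<lambda>p. cos (snd p)) -` (- {0})" by (auto simp: S_def)
  then have S: "open S" by (auto intro!: open_vimage continuous_intros)
  have inS: "(0, \<theta>) \<in> S \<longleftrightarrow> cos \<theta> \<noteq> 0" for \<theta> by (simp add: S_def)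
  have C2: "Ck_on (Suc (Suc 0)) T ?H" by (rule T(3))
  have diff: "?H differentiable (at (0, \<theta>))" "partial1 ?H differentiable (at (0, \<theta>))"
      "partial2 ?H differentiable (at (0, \<theta>))" if "cos \<theta> \<noteq> 0" for \<theta>
    using T(2)[OF that] C2 Ck_on_partial1[OF C2] Ck_on_partial2[OF C2] by (simp_all only: Ck_on.simps)
  have H2: "partial2 ?H (0, \<theta>) = (1 / (cos \<theta>)\<^sup>2) *\<^sub>R A0' (tan \<theta>)" if "cos \<theta> \<noteq> 0" for \<theta>
    by (rule partial2_eqI[OF S _ diff(1)[OF that], where G = "\<lambda>\<theta>. A0 (tan \<theta>)"])
      (use that H0 has_vector_derivative_compose_tan[OF that has_vector_derivative_A0[OF e0_pos]] in
        \<open>simp_all add: inS\<close>)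
  show "?H differentiable (at (0, \<theta>))" by (rule diff(1)[OF c])
  show "partial1 ?H (0, \<theta>) = cos \<theta> *\<^sub>R A1 (tan \<theta>)" by (rule H1[OF c])
  show "partial2 ?H (0, \<theta>) = (1 / (cos \<theta>)\<^sup>2) *\<^sub>R A0' (tan \<theta>)" by (rule H2[OF c])
  show "partial1 (partial1 ?H) (0, \<theta>) = (2 * (cos \<theta>)\<^sup>2) *\<^sub>R A2 (tan \<theta>)" by (rule H11[OF c])
  \<comment> \<open>h_\<theta> is known only on the divisor and cannot be differentiated in r from
    there; h_r is known along the divisor, so the order of differentiation is exchanged.\<close>
  have "partial1 (partial2 ?H) (0, \<theta>) = partial2 (partial1 ?H) (0, \<theta>)"
    by (rule partial12_eq_partial21[OF T(1) T(2)[OF c] T(3)])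
  also have "\<dots> = cos \<theta> *\<^sub>R (1 / (cos \<theta>)\<^sup>2) *\<^sub>R A1' (tan \<theta>) + (- sin \<theta>) *\<^sub>R A1 (tan \<theta>)"
  proof (rule partial2_eqI[OF S _ diff(2)[OF c], where G = "\<lambda>\<theta>. cos \<theta> *\<^sub>R A1 (tan \<theta>)"])
    show "((\<lambda>\<theta>. cos \<theta> *\<^sub>R A1 (tan \<theta>)) has_vector_derivative
        cos \<theta> *\<^sub>R (1 / (cos \<theta>)\<^sup>2) *\<^sub>R A1' (tan \<theta>) + (- sin \<theta>) *\<^sub>R A1 (tan \<theta>)) (at \<theta>)"
      by (intro has_vector_derivative_scaleR DERIV_cos
          has_vector_derivative_compose_tan[OF c has_vector_derivative_A1[OF e0_pos]])
  qed (use c H1 in \<open>simp_all add: inS\<close>)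
  also have "\<dots> = (1 / cos \<theta>) *\<^sub>R A1' (tan \<theta>) - sin \<theta> *\<^sub>R A1 (tan \<theta>)"
    using c by (simp add: power2_eq_square)
  finally show "partial1 (partial2 ?H) (0, \<theta>) = (1 / cos \<theta>) *\<^sub>R A1' (tan \<theta>) - sin \<theta> *\<^sub>R A1 (tan \<theta>)" .
  have "partial2 (partial2 ?H) (0, \<theta>) = (1 / (cos \<theta>)\<^sup>2) *\<^sub>R (1 / (cos \<theta>)\<^sup>2) *\<^sub>R A0'' (tan \<theta>)
      + (2 * sin \<theta> / cos \<theta> ^ 3) *\<^sub>R A0' (tan \<theta>)"
  proof (rule partial2_eqI[OF S _ diff(3)[OF c], where G = "\<lambda>\<theta>. (1 / (cos \<theta>)\<^sup>2) *\<^sub>R A0' (tan \<theta>)"])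
    have "((\<lambda>\<theta>. 1 / (cos \<theta>)\<^sup>2) has_real_derivative 2 * sin \<theta> / cos \<theta> ^ 3) (at \<theta>)"
      using c by (auto intro!: derivative_eq_intros simp: field_simps eval_nat_numeral)
    then show "((\<lambda>\<theta>. (1 / (cos \<theta>)\<^sup>2) *\<^sub>R A0' (tan \<theta>)) has_vector_derivative
        (1 / (cos \<theta>)\<^sup>2) *\<^sub>R (1 / (cos \<theta>)\<^sup>2) *\<^sub>R A0'' (tan \<theta>)
        + (2 * sin \<theta> / cos \<theta> ^ 3) *\<^sub>R A0' (tan \<theta>)) (at \<theta>)"
      by (rule has_vector_derivative_scaleR[OF _
          has_vector_derivative_compose_tan[OF c has_vector_derivative_A0'[OF e0_pos]]])
  qed (use c H2 in \<open>simp_all add: inS\<close>)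
  then show "partial2 (partial2 ?H) (0, \<theta>) =
      (1 / cos \<theta> ^ 4) *\<^sub>R A0'' (tan \<theta>) + (2 * sin \<theta> / cos \<theta> ^ 3) *\<^sub>R A0' (tan \<theta>)"
    by (simp add: power2_eq_square eval_nat_numeral)
qed

lemma principal_curvature_surface_curvatures:
  assumes h: "principal_curvature_surface f h" and c: "cos \<theta> \<noteq> 0" and nh0: "nh (tan \<theta>) \<noteq> 0"
  shows "inj (frechet_derivative (h \<circ> polar) (at (0, \<theta>)))"
    and "gauss_curvature (h \<circ> polar) (0, \<theta>) = 0 \<longleftrightarrow> poly PK (tan \<theta>) = 0"
    and "mean_curvature (h \<circ> polar) (0, \<theta>) = 0 \<longleftrightarrow> poly PH (tan \<theta>) = 0"
proof -
  let ?H = "h \<circ> polar"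
  define t W C where "t = tan \<theta>" and "W = poly w t" and "C = cos \<theta>"
  note D = principal_curvature_surface_partials[OF h c, folded t_def C_def]
  have W: "W > 0" using poly_w_pos[OF e0_pos, of t] by (simp add: W_def)
  have C: "C \<noteq> 0" using c by (simp add: C_def)
  have cr: "cross3 (A1 t) (A0' t) = (1 / W ^ 3) *\<^sub>R nh t"
    unfolding W_def by (rule cross3_A1_A0'[OF e0_pos])
  have cr2: "cross3 (partial1 ?H (0, \<theta>)) (partial2 ?H (0, \<theta>)) = (1 / (C * W ^ 3)) *\<^sub>R nh t"
    using C by (simp add: D cross_mult_left cross_mult_right cr power2_eq_square)
  have cr0: "cross3 (partial1 ?H (0, \<theta>)) (partial2 ?H (0, \<theta>)) \<noteq> 0"
    using W C nh0 by (simp add: cr2 t_def)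
  show "inj (frechet_derivative ?H (at (0, \<theta>)))"
  proof (rule injI)
    fix p q :: "real \<times> real"
    obtain p1 p2 q1 q2 where pq: "p = (p1, p2)" "q = (q1, q2)" by (cases p; cases q)
    assume "frechet_derivative ?H (at (0, \<theta>)) p = frechet_derivative ?H (at (0, \<theta>)) q"
    then have "(p1 - q1) *\<^sub>R partial1 ?H (0, \<theta>) + (p2 - q2) *\<^sub>R partial2 ?H (0, \<theta>) = 0"
      by (simp add: pq frechet_derivative_partials[OF D(1)] algebra_simps)
    then have "cross3 ((p1 - q1) *\<^sub>R partial1 ?H (0, \<theta>) + (p2 - q2) *\<^sub>R partial2 ?H (0, \<theta>)) (partial2 ?H (0, \<theta>)) = 0"
      "cross3 (partial1 ?H (0, \<theta>)) ((p1 - q1) *\<^sub>R partial1 ?H (0, \<theta>) + (p2 - q2) *\<^sub>R partial2 ?H (0, \<theta>)) = 0"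
      by simp_all
    then have "p1 - q1 = 0" "p2 - q2 = 0"
      using cr0 by (simp_all add: cross_add_left cross_add_right cross_mult_left cross_mult_right)
    then show "p = q" by (simp add: pq)
  qed
  \<comment> \<open>Its sign is that of cos \<theta>; this is the sign by which H depends on the
    representative (r, \<theta>).\<close>
  define \<mu> where "\<mu> = 1 / (C * W ^ 3) / norm ((1 / (C * W ^ 3)) *\<^sub>R nh t)"
  have \<mu>: "\<mu> \<noteq> 0" using C W nh0 by (simp add: \<mu>_def t_def)
  have un: "unit_normal ?H (0, \<theta>) = \<mu> *\<^sub>R nh t"
    by (simp add: unit_normal_def cr2 sgn_div_norm \<mu>_def divide_inverse mult.commute)
  \<comment> \<open>The tangential terms that the change from (u, t) to (r, \<theta>) adds to the
    second derivatives therefore do not contribute to the second form.\<close>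
  have "A1 t \<bullet> nh t = 0" "A0' t \<bullet> nh t = 0"
    using dot_cross_self[of "A1 t" "A0' t"] W unfolding cr by (simp_all add: inner_commute)
  note orth = this
  have "nh t \<bullet> A2 t = poly L t / (2 * W)" using inner_nh_A2[OF e0_pos, of t] by (simp add: W_def)
  then have 2: "A2 t \<bullet> nh t = poly L t / (2 * W)" "A1' t \<bullet> nh t = poly M t / W" "A0'' t \<bullet> nh t = poly N t / W"
    using inner_nh_A1'[OF e0_pos, of t] inner_nh_A0''[OF e0_pos, of t] by (simp_all add: W_def inner_commute)
  have II: "second_form ?H (0, \<theta>) (unit_normal ?H (0, \<theta>)) = vector
     [vector [C\<^sup>2 * \<mu> * poly L t / W, \<mu> * poly M t / (C * W)], vector [\<mu> * poly M t / (C * W), \<mu> * poly N t / (C ^ 4 * W)]]"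
    unfolding second_form_def un D
    by (simp add: inner_add_left inner_diff_left orth 2 mult.assoc mult.left_commute)
  have I: "first_form ?H (0, \<theta>) = vector
     [vector [C\<^sup>2 * poly E t / W\<^sup>2, poly F t / (C * W\<^sup>2)], vector [poly F t / (C * W\<^sup>2), poly G t / (C ^ 4 * W\<^sup>2)]]"
    unfolding first_form_def D using C
    by (simp add: inner_A1_A0'[OF e0_pos] W_def[symmetric] power2_eq_square eval_nat_numeral mult.assoc)
  define \<Delta> where "\<Delta> = C\<^sup>2 * poly E t / W\<^sup>2 * (poly G t / (C ^ 4 * W\<^sup>2)) - (poly F t / (C * W\<^sup>2))\<^sup>2"
  \<comment> \<open>By Lagrange's identity, the determinant of the first form is the squared length
    of the cross product, hence nonzero.\<close>
  have "\<Delta> = cross3 (partial1 ?H (0, \<theta>)) (partial2 ?H (0, \<theta>)) \<bullet> cross3 (partial1 ?H (0, \<theta>)) (partial2 ?H (0, \<theta>))"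
  proof -
    have "first_form ?H (0, \<theta>) $ 1 $ 1 * first_form ?H (0, \<theta>) $ 2 $ 2 - (first_form ?H (0, \<theta>) $ 1 $ 2)\<^sup>2 = \<Delta>"
      unfolding I \<Delta>_def by simp
    then show ?thesis unfolding dot_cross by (simp add: first_form_def inner_commute power2_eq_square)
  qed
  then have \<Delta>: "\<Delta> \<noteq> 0" using cr0 by simp
  have "gauss_curvature ?H (0, \<theta>) = (\<mu>\<^sup>2 / (C\<^sup>2 * W\<^sup>2) * poly PK t) / \<Delta>"
  proof -
    have "C\<^sup>2 * \<mu> * poly L t / W * (\<mu> * poly N t / (C ^ 4 * W)) - (\<mu> * poly M t / (C * W))\<^sup>2
        = \<mu>\<^sup>2 / (C\<^sup>2 * W\<^sup>2) * poly PK t"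
      using C W by (simp add: PK_def field_simps power2_eq_square eval_nat_numeral)
    then show ?thesis unfolding gauss_curvature_def Let_def II I \<Delta>_def by simp
  qed
  then show "gauss_curvature ?H (0, \<theta>) = 0 \<longleftrightarrow> poly PK (tan \<theta>) = 0"
    using \<Delta> \<mu> C W by (simp add: t_def)
  have "mean_curvature ?H (0, \<theta>) = (\<mu> / (C\<^sup>2 * W ^ 3) * poly PH t) / (2 * \<Delta>)"
  proof -
    have "C\<^sup>2 * poly E t / W\<^sup>2 * (\<mu> * poly N t / (C ^ 4 * W)) - 2 * (poly F t / (C * W\<^sup>2)) * (\<mu> * poly M t / (C * W))
        + poly G t / (C ^ 4 * W\<^sup>2) * (C\<^sup>2 * \<mu> * poly L t / W)
        = \<mu> / (C\<^sup>2 * W ^ 3) * poly PH t"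
      using C W by (simp add: PH_def field_simps power2_eq_square eval_nat_numeral)
    then show ?thesis unfolding mean_curvature_def Let_def II I \<Delta>_def by simp
  qed
  then show "mean_curvature ?H (0, \<theta>) = 0 \<longleftrightarrow> poly PH (tan \<theta>) = 0"
    using \<Delta> \<mu> C W by (simp add: t_def)
qed

lemma generic_curvature_zeros:
  assumes h: "principal_curvature_surface f h" and gen: "generic_poly \<noteq> 0"
  shows "singular_points h \<inter> exceptional0 = {}"
    and "finite (curvature_zeros gauss_curvature h)"
    and "\<exists>n\<in>{1..11}. card (curvature_zeros gauss_curvature h) = 2 * n - 1"
    and "finite (curvature_zeros mean_curvature h)"
    and "\<exists>n\<in>{0..9}. card (curvature_zeros mean_curvature h) = 2 * n"
proof -
  note simple = generic_poly_simple_roots[OF e0_pos gen]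
  have nh: "nh t \<noteq> 0" for t by (rule nh_neq_0[OF e0_pos simple(2)])
  note geom = principal_curvature_surface_curvatures[OF h _ nh]
  show sing: "singular_points h \<inter> exceptional0 = {}"
  proof (rule ccontr)
    assume "singular_points h \<inter> exceptional0 \<noteq> {}"
    then obtain x where x: "\<not> inj (frechet_derivative (h \<circ> polar) (at x))" "polar x \<in> exceptional0"
      unfolding singular_points_def by blast
    then show False using geom(1)[of "snd x"] by (cases x) (simp add: polar_in_exceptional0)
  qed
  have nz: "PK \<noteq> 0" "PH \<noteq> 0" using simple(1,3) by auto
  have K: "curvature_zeros gauss_curvature h = (\<lambda>t. polar (0, arctan t)) ` {t. poly PK t = 0}"
    "card (curvature_zeros gauss_curvature h) = card {t. poly PK t = 0}"
    by (rule card_curvature_zeros[where curv = gauss_curvature and P = PK, OF sing geom(2)]; assumption)+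
  have H: "curvature_zeros mean_curvature h = (\<lambda>t. polar (0, arctan t)) ` {t. poly PH t = 0}"
    "card (curvature_zeros mean_curvature h) = card {t. poly PH t = 0}"
    by (rule card_curvature_zeros[where curv = mean_curvature and P = PH, OF sing geom(3)]; assumption)+
  show "finite (curvature_zeros gauss_curvature h)" "finite (curvature_zeros mean_curvature h)"
    unfolding K(1) H(1) using poly_roots_finite[OF nz(1)] poly_roots_finite[OF nz(2)] by simp_all
  have "card {t. poly PK t = 0} \<le> 21 \<and> even (21 - card {t. poly PK t = 0})"
    using card_simple_roots[OF nz(1) simple(2)] unfolding simple(1) .
  then obtain m where "21 - card {t. poly PK t = 0} = 2 * m" "card {t. poly PK t = 0} \<le> 21"
    unfolding dvd_def by blast
  \<comment> \<open>The count is 21 - 2 m with m at most 10, so n = 11 - m is at least 1 and the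
    truncated subtraction is exact.\<close>
  then have "card {t. poly PK t = 0} = 2 * (11 - m) - 1" "11 - m \<in> {1..11}" by auto
  then show "\<exists>n\<in>{1..11}. card (curvature_zeros gauss_curvature h) = 2 * n - 1" unfolding K(2) by blast
  have "card {t. poly PH t = 0} \<le> 18 \<and> even (18 - card {t. poly PH t = 0})"
    using card_simple_roots[OF nz(2) simple(4)] unfolding simple(3) .
  then obtain m where "18 - card {t. poly PH t = 0} = 2 * m" "card {t. poly PH t = 0} \<le> 18"
    unfolding dvd_def by blast
  then have "card {t. poly PH t = 0} = 2 * (9 - m)" "9 - m \<in> {0..9}" by auto
  then show "\<exists>n\<in>{0..9}. card (curvature_zeros mean_curvature h) = 2 * n" unfolding H(2) by blast
qed

end

theorem theorem5p4:
  shows "(\<exists>A\<^sub>k. algebraic_subset A\<^sub>k \<and> A\<^sub>k \<subset> umbrella_jets \<and>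
           (\<forall>f h. umbrella_in f (umbrella_jets - A\<^sub>k) \<and> principal_curvature_surface f h \<longrightarrow>
              singular_points h \<inter> exceptional0 = {} \<and>
              finite (curvature_zeros gauss_curvature h) \<and>
              (\<exists>n\<in>{1..11}. card (curvature_zeros gauss_curvature h) = 2 * n - 1)))
       \<and> (\<exists>A\<^sub>h. algebraic_subset A\<^sub>h \<and> A\<^sub>h \<subset> umbrella_jets \<and>
           (\<forall>f h. umbrella_in f (umbrella_jets - A\<^sub>h) \<and> principal_curvature_surface f h \<longrightarrow>
              singular_points h \<inter> exceptional0 = {} \<and>
              finite (curvature_zeros mean_curvature h) \<and>
              (\<exists>n\<in>{0..9}. card (curvature_zeros mean_curvature h) = 2 * n)))"
proof -
  define A where "A = {x \<in> umbrella_jets. umbrella_jet.generic_poly x = 0}"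
  have alg: "algebraic_subset A"
    unfolding algebraic_subset_def A_def
    using real_polynomial_function_generic_poly by (intro exI[of _ "{umbrella_jet.generic_poly}"]) simp
  have "sample_jet \<in> umbrella_jets - A"
    using generic_poly_sample_jet by (simp add: A_def) (simp add: umbrella_jets_def sample_jet_def)
  then have A: "A \<subset> umbrella_jets" by (auto simp: A_def)
  have "singular_points h \<inter> exceptional0 = {} \<and>
      finite (curvature_zeros gauss_curvature h) \<and>
      (\<exists>n\<in>{1..11}. card (curvature_zeros gauss_curvature h) = 2 * n - 1) \<and>
      finite (curvature_zeros mean_curvature h) \<and>
      (\<exists>n\<in>{0..9}. card (curvature_zeros mean_curvature h) = 2 * n)"
    if f: "umbrella_in f (umbrella_jets - A)" and h: "principal_curvature_surface f h" for f h
  proof -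
    obtain f21 f31 f321 f322 f331 where nf: "normal_form f f21 f31 f321 f322 f331"
      and j: "jets f21 f31 f321 f322 f331 \<in> umbrella_jets - A" and "smooth_germ f 0"
      using f unfolding umbrella_in_def whitney_umbrella_def by blast
    then interpret umbrella_germ "jets f21 f31 f321 f322 f331" f f21 f31 f321 f322 f331
      by unfold_locales simp_all
    have "generic_poly \<noteq> 0" using j by (simp add: A_def)
    from generic_curvature_zeros[OF h this] show ?thesis by blast
  qed
  then show ?thesis using alg A by (intro conjI exI[of _ A]) blast+
qed

end
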